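(* Consider the coupled queueing model described in the context with parameters $\rho_1,\rho_2\in[0,\infty)$ such that $\rho_1\rho_2<1$, and assume $\mu_1,\mu_2>0$. Then \[V_{\rho_1,\rho_2}+V'_{0,0} \stackrel{\rm d}{=} V_{\rho_1,0}+V'_{0,\rho_2},\] where on each side the two summands are independent (primes denote independent copies), and $V_{0,0}$ has the stationary workload distribution of the stand-alone first queue (i.e. of $-X_1$ reflected at $0$).
   Context: Let $X_1,X_2$ be independent processes $X_i(t)=c_i t-\sum_{k=1}^{N_i(t)} J_{i,k}$, $t\ge 0$, where $c_i>0$, $N_i$ is a Poisson process of rate $\lambda_i$, and $J_{i,k}$ are i.i.d. positive random variables independent of $N_i$. Let $\mu_i=\mathbb E X_i(1)$ and $Y_i=-X_i$. Coupled queueing model with parameters $\rho_1,\rho_2\ge0$, $\rho_1\rho_2<1$: server $i$ works at speed $c_i$ on workload arriving as the jumps $J_{i,k}$; when queue $i$ is empty it stays empty until the next arrival to it, and during this time the other server $j\ne i$ works at speed $c_j+\rho_i c_i$. Formally the workload $(W_1(t),W_2(t))$ is the two-dimensional Skorokhod reflection $W_1=W_1(0)+Y_1+L_1-\rho_2L_2$, $W_2=W_2(0)+Y_2+L_2-\rho_1L_1$, with $W_i\ge0$ and $L_i$ nondecreasing, $L_i(0)=0$, increasing only when $W_i=0$. Let $(W_1,W_2)$ have the stationary distribution of this process (which exists under the assumptions). Define $V_{\rho_1,\rho_2}$ as a random variable with law \[\mathbb P(V_{\rho_1,\rho_2}\in B)=\frac{c_2(1-\rho_1\rho_2)}{\mu_2+\rho_1\mu_1}\,\mathbb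 P(W_1\in B,\,W_2=0)+\rho_1\frac{c_2\rho_2+c_1}{\mu_2+\rho_1\mu_1}\,\mathbb P(W_1=W_2=0)\,\mathbf 1_B(0),\] i.e. with Laplace transform $\mathbb E e^{-sV_{\rho_1,\rho_2}}=\frac{c_2(1-\rho_1\rho_2)}{\mu_2+\rho_1\mu_1}\mathbb E(e^{-sW_1};W_2=0)+\rho_1\frac{c_2\rho_2+c_1}{\mu_2+\rho_1\mu_1}\mathbb P(W_1=W_2=0)$; under the assumptions this is a probability distribution (a mixture of the law of $W_1$ given $W_2=0$ and a point mass at $0$). Here $(W_1,W_2)$ is the stationary workload of the model with the indicated parameters $(\rho_1,\rho_2)$, and $V_{\rho_1,0},V_{0,\rho_2},V_{0,0}$ are defined in the same way from the models with the respective parameter pairs. *)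

theory Defs
  imports "HOL-Probability.Probability"
begin

text \<open>Driving randomness of one compound Poisson process with drift:
  a sequence of i.i.d. pairs (interarrival time, jump size), the interarrival
  times Exp(lam) distributed, the jump sizes distributed according to F.\<close>

definition cp_noise :: "real \<Rightarrow> real measure \<Rightarrow> (nat \<Rightarrow> real \<times> real) measure" where
  "cp_noise lam F = PiM UNIV (\<lambda>_. density lborel (exponential_density lam) \<Otimes>\<^sub>M F)"

definition arrival_time :: "(nat \<Rightarrow> real \<times> real) \<Rightarrow> nat \<Rightarrow> real" where
  "arrival_time \<omega> k = (\<Sum>j\<le>k. fst (\<omega> j))"

definition cp_path :: "real \<Rightarrow> (nat \<Rightarrow> real \<times> real) \<Rightarrow> real \<Rightarrow> real" where
  "cp_path c \<omega> t = c * t - (\<Sum>k\<in>{k. arrival_time \<omega> k \<le> t}. snd (\<omega> k))"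

text \<open>Mean drift mu = E X(1) = c - lam E J.\<close>
definition cp_mean :: "real \<Rightarrow> real \<Rightarrow> real measure \<Rightarrow> real" where
  "cp_mean c lam F = c - lam * (\<integral>x. x \<partial>F)"

text \<open>Two-dimensional Skorokhod reflection (on times t \<ge> 0):
  W1 = w1 + Y1 + L1 - rho2 L2, W2 = w2 + Y2 + L2 - rho1 L1, W \<ge> 0,
  L continuous nondecreasing, L(0) = 0, L_i increasing only when W_i = 0.\<close>
definition is_reflection2 ::
  "real \<Rightarrow> real \<Rightarrow> (real \<Rightarrow> real) \<Rightarrow> (real \<Rightarrow> real) \<Rightarrow> real \<times> real
   \<Rightarrow> (real \<Rightarrow> real \<times> real) \<Rightarrow> (real \<Rightarrow> real \<times> real) \<Rightarrow> bool" where
  "is_reflection2 \<rho>1 \<rho>2 Y1 Y2 w W L \<longleftrightarrow>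
     (\<forall>t\<ge>0. fst (W t) = fst w + Y1 t + fst (L t) - \<rho>2 * snd (L t)
          \<and> snd (W t) = snd w + Y2 t + snd (L t) - \<rho>1 * fst (L t)
          \<and> fst (W t) \<ge> 0 \<and> snd (W t) \<ge> 0)
   \<and> fst (L 0) = 0 \<and> snd (L 0) = 0
   \<and> mono_on {0..} (\<lambda>t. fst (L t)) \<and> mono_on {0..} (\<lambda>t. snd (L t))
   \<and> continuous_on {0..} (\<lambda>t. fst (L t)) \<and> continuous_on {0..} (\<lambda>t. snd (L t))
   \<and> (\<forall>s t. 0 \<le> s \<and> s \<le> t \<and> (\<forall>u\<in>{s..t}. fst (W u) > 0) \<longrightarrow> fst (L s) = fst (L t))
   \<and> (\<forall>s t. 0 \<le> s \<and> s \<le> t \<and> (\<forall>u\<in>{s..t}. snd (W u) > 0) \<longrightarrow> snd (L s) = snd (L t))"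

text \<open>The reflected workload at time t \<ge> 0 (the solution is unique when rho1 rho2 < 1).\<close>
definition refl_workload ::
  "real \<Rightarrow> real \<Rightarrow> (real \<Rightarrow> real) \<Rightarrow> (real \<Rightarrow> real) \<Rightarrow> real \<times> real \<Rightarrow> real \<Rightarrow> real \<times> real" where
  "refl_workload \<rho>1 \<rho>2 Y1 Y2 w t =
     (THE x. \<exists>W L. is_reflection2 \<rho>1 \<rho>2 Y1 Y2 w W L \<and> W t = x)"

definition model_state ::
  "real \<Rightarrow> real \<Rightarrow> real \<Rightarrow> real \<Rightarrow> real
   \<Rightarrow> (real \<times> real) \<times> (nat \<Rightarrow> real \<times> real) \<times> (nat \<Rightarrow> real \<times> real) \<Rightarrow> real \<times> real" where
  "model_state \<rho>1 \<rho>2 c1 c2 t x =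
     (case x of (w, om1, om2) \<Rightarrow>
        refl_workload \<rho>1 \<rho>2 (\<lambda>s. - cp_path c1 om1 s) (\<lambda>s. - cp_path c2 om2 s) w t)"

definition stationary_dist ::
  "real \<Rightarrow> real \<Rightarrow> real \<Rightarrow> real \<Rightarrow> real \<Rightarrow> real \<Rightarrow> real measure \<Rightarrow> real measure
   \<Rightarrow> (real \<times> real) measure \<Rightarrow> bool" where
  "stationary_dist \<rho>1 \<rho>2 c1 c2 lam1 lam2 F1 F2 p \<longleftrightarrow>
     prob_space p \<and> sets p = sets borel \<and> emeasure p ({0..} \<times> {0..}) = 1 \<and>
     (\<forall>t\<ge>0.
        model_state \<rho>1 \<rho>2 c1 c2 t
          \<in> measurable (p \<Otimes>\<^sub>M (cp_noise lam1 F1 \<Otimes>\<^sub>M cp_noise lam2 F2)) borel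
      \<and> distr (p \<Otimes>\<^sub>M (cp_noise lam1 F1 \<Otimes>\<^sub>M cp_noise lam2 F2)) borel
             (model_state \<rho>1 \<rho>2 c1 c2 t) = p)"

definition V_law ::
  "real \<Rightarrow> real \<Rightarrow> real \<Rightarrow> real \<Rightarrow> real \<Rightarrow> real \<Rightarrow> (real \<times> real) measure \<Rightarrow> real measure" where
  "V_law \<rho>1 \<rho>2 c1 c2 mu1 mu2 p = measure_of UNIV (sets borel)
     (\<lambda>B. ennreal (c2 * (1 - \<rho>1 * \<rho>2) / (mu2 + \<rho>1 * mu1)) * emeasure p (B \<times> {0})
        + ennreal (\<rho>1 * (c2 * \<rho>2 + c1) / (mu2 + \<rho>1 * mu1)) * emeasure p {(0, 0)}
          * indicator B 0)"

end

theory Submission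
  imports Defs "HOL-Complex_Analysis.Complex_Analysis" "HOL-Real_Asymp.Real_Asymp"
begin

text \<open>
  Let \<open>\<psi>\<^sub>i\<close> be the Laplace exponent of \<open>X\<^sub>i\<close>, \<open>\<Phi>\<^sub>i\<close> its inverse on the right half-plane and
  \<open>G\<^sub>i\<close> the Laplace transform of the stationary state of the other queue, taken with respect to the
  regulator \<open>L\<^sub>i\<close>. Expanding \<open>E exp (- s\<^sub>1 W\<^sub>1 - s\<^sub>2 W\<^sub>2)\<close> over a short time interval, stationarity gives
  the kernel equation, whose left side vanishes for \<open>s\<^sub>1 = \<Phi>\<^sub>1 q\<close>, \<open>s\<^sub>2 = \<Phi>\<^sub>2 (- q)\<close> with imaginary \<open>q\<close>:
  there \<open>(\<rho>\<^sub>2 s\<^sub>1 - s\<^sub>2) G\<^sub>2 s\<^sub>1 = (s\<^sub>1 - \<rho>\<^sub>1 s\<^sub>2) G\<^sub>1 s\<^sub>2\<close>. This is a Wiener-Hopf problem: as a function of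
  \<open>q\<close>, \<open>G\<^sub>2 s\<^sub>1\<close> extends to the right and \<open>G\<^sub>1 s\<^sub>2\<close> to the left half-plane. Its symbol is, up to the
  factor \<open>- s\<^sub>2 / s\<^sub>1\<close>, the product of the symbols for \<open>(\<rho>\<^sub>1, 0)\<close> and \<open>(0, \<rho>\<^sub>2)\<close>, and this factor is
  itself factorized by \<open>\<psi>\<^sub>i s\<^sub>i / s\<^sub>i\<close>. Hence the theorem follows once solutions are unique up to a
  constant. For uniqueness, a solution vanishing at \<open>q = 1\<close> is divided by \<open>q - 1\<close>, multiplied by
  \<open>q / \<Phi>\<^sub>1 q\<close> and paired with its counterpart; by Cauchy's theorem the integral of the product along
  the imaginary axis is zero, although its real part is a positive multiple of \<open>|G\<^sub>1|\<^sup>2\<close>.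
\<close>

section \<open>Skorokhod reflection of upper Lipschitz paths\<close>

lemma reflection_deviation_bound:
  fixes l l' W W' :: "real \<Rightarrow> real"
  assumes T: "0 \<le> T"
    and cont: "continuous_on {0..T} (\<lambda>t. l t - l' t)"
    and zero: "l 0 = l' 0"
    and mono: "\<And>s t. 0 \<le> s \<Longrightarrow> s \<le> t \<Longrightarrow> t \<le> T \<Longrightarrow> l' s \<le> l' t"
    and compl: "\<And>s t. 0 \<le> s \<Longrightarrow> s \<le> t \<Longrightarrow> t \<le> T \<Longrightarrow> \<forall>u\<in>{s..t}. 0 < W u \<Longrightarrow> l s = l t"
    and bound: "\<And>u. 0 \<le> u \<Longrightarrow> u \<le> T \<Longrightarrow> W u \<le> 0 \<Longrightarrow> l u - l' u \<le> m"
    and M: "\<And>t. t \<in> {0..T} \<Longrightarrow> l t - l' t \<le> M" "\<exists>t\<in>{0..T}. l t - l' t = M"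
    and pos: "0 < M"
  shows "M \<le> m"
proof -
  define D where "D t = l t - l' t" for t
  have cD: "continuous_on {0..T} D" using cont by (simp add: D_def)
  have "closed {t \<in> {0..T}. D t = M}"
    by (intro continuous_closed_preimage_constant cD closed_atLeastAtMost)
  moreover have "bounded {t \<in> {0..T}. D t = M}"
    by (rule bounded_subset[of "{0..T}"]) auto
  ultimately have "compact {t \<in> {0..T}. D t = M}"
    by (simp add: compact_eq_bounded_closed)
  moreover have "{t \<in> {0..T}. D t = M} \<noteq> {}" using M(2) by (auto simp: D_def)
  ultimately obtain t1 where t1: "t1 \<in> {0..T}" "D t1 = M"
    and first: "\<And>t. t \<in> {0..T} \<Longrightarrow> D t = M \<Longrightarrow> t1 \<le> t"
    using compact_attains_inf[of "{t \<in> {0..T}. D t = M}"] by blast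
  have "t1 \<noteq> 0" using zero t1(2) pos by (auto simp: D_def)
  hence t1p: "0 < t1" using t1 by auto
  have near: "\<exists>u\<in>{s..t1}. D u \<le> m" if s: "0 \<le> s" "s < t1" for s
  proof -
    have "D s \<noteq> M" using first[of s] that t1(1) by auto
    hence "D s < M" using M(1)[of s] that t1(1) by (auto simp: D_def)
    hence "l s < l t1" using t1(2) mono[of s t1] that t1(1) by (auto simp: D_def)
    then obtain u where u: "u \<in> {s..t1}" "W u \<le> 0"
      using compl[of s t1] s t1(1) by force
    have "D u \<le> m" using bound[of u] u that t1(1) by (auto simp: D_def)
    with u show ?thesis by blast
  qed
  show ?thesis
  proof (rule field_le_epsilon)
    fix e :: real assume e: "0 < e"
    from cD t1(1) e obtain d where d: "0 < d"
      "\<And>x. x \<in> {0..T} \<Longrightarrow> dist x t1 < d \<Longrightarrow> dist (D x) (D t1) < e"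
      unfolding continuous_on_iff by blast
    define s where "s = max 0 (t1 - d/2)"
    have "0 \<le> s" "s < t1" using d t1p by (auto simp: s_def)
    from near[OF this] obtain u where u: "u \<in> {s..t1}" "D u \<le> m" by blast
    have "dist u t1 < d" using u d by (auto simp: s_def dist_real_def)
    with d(2)[of u] u \<open>0 \<le> s\<close> t1 have "dist (D u) M < e" by auto
    thus "M \<le> m + e" using u by (auto simp: dist_real_def)
  qed
qed

lemma is_reflection2_le:
  assumes r: "0 \<le> \<rho>1" "0 \<le> \<rho>2" "\<rho>1 * \<rho>2 < 1"
    and R: "is_reflection2 \<rho>1 \<rho>2 Y1 Y2 w W L" "is_reflection2 \<rho>1 \<rho>2 Y1 Y2 w W' L'"
    and T: "0 \<le> T"
  shows "fst (L T) \<le> fst (L' T) \<and> snd (L T) \<le> snd (L' T)"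
proof -
  note R' = R[unfolded is_reflection2_def]
  define D1 where "D1 t = fst (L t) - fst (L' t)" for t
  define D2 where "D2 t = snd (L t) - snd (L' t)" for t
  have c1: "continuous_on {0..T} D1" and c2: "continuous_on {0..T} D2"
    unfolding D1_def D2_def using R'
    by (auto intro!: continuous_on_diff elim!: continuous_on_subset)
  obtain M1 where M1: "\<And>t. t \<in> {0..T} \<Longrightarrow> D1 t \<le> M1" "\<exists>t\<in>{0..T}. D1 t = M1"
    using continuous_attains_sup[OF compact_Icc _ c1] T by fastforce
  obtain M2 where M2: "\<And>t. t \<in> {0..T} \<Longrightarrow> D2 t \<le> M2" "\<exists>t\<in>{0..T}. D2 t = M2"
    using continuous_attains_sup[OF compact_Icc _ c2] T by fastforce
  have D0: "D1 0 = 0" "D2 0 = 0" using R' by (auto simp: D1_def D2_def)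
  have M0: "0 \<le> M1" "0 \<le> M2" using M1(1)[of 0] M2(1)[of 0] D0 T by auto
  have W1: "fst (W u) - fst (W' u) = D1 u - \<rho>2 * D2 u"
    and W2: "snd (W u) - snd (W' u) = D2 u - \<rho>1 * D1 u"
    and Wp: "0 \<le> fst (W' u)" "0 \<le> snd (W' u)" if "0 \<le> u" for u
    using R' that by (auto simp: D1_def D2_def algebra_simps)
  have le1: "M1 \<le> \<rho>2 * M2" if "0 < M1"
  proof (rule reflection_deviation_bound[of T "\<lambda>t. fst (L t)" "\<lambda>t. fst (L' t)" "\<lambda>t. fst (W t)"])
    fix u assume u: "0 \<le> u" "u \<le> T" "fst (W u) \<le> 0"
    have "D1 u \<le> \<rho>2 * D2 u" using W1[of u] Wp[of u] u by linarith
    also have "\<dots> \<le> \<rho>2 * M2" using M2(1)[of u] u r by (intro mult_left_mono) auto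
    finally show "fst (L u) - fst (L' u) \<le> \<rho>2 * M2" by (simp add: D1_def)
  qed (use R' T M1 c1 that in \<open>auto simp: D1_def[abs_def] mono_on_def\<close>)
  have le2: "M2 \<le> \<rho>1 * M1" if "0 < M2"
  proof (rule reflection_deviation_bound[of T "\<lambda>t. snd (L t)" "\<lambda>t. snd (L' t)" "\<lambda>t. snd (W t)"])
    fix u assume u: "0 \<le> u" "u \<le> T" "snd (W u) \<le> 0"
    have "D2 u \<le> \<rho>1 * D1 u" using W2[of u] Wp[of u] u by linarith
    also have "\<dots> \<le> \<rho>1 * M1" using M1(1)[of u] u r by (intro mult_left_mono) auto
    finally show "snd (L u) - snd (L' u) \<le> \<rho>1 * M1" by (simp add: D2_def)
  qed (use R' T M2 c2 that in \<open>auto simp: D2_def[abs_def] mono_on_def\<close>)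
  have "M1 = 0"
  proof (rule ccontr)
    assume "M1 \<noteq> 0"
    hence p: "0 < M1" using M0 by simp
    have m2: "0 < M2" using le1[OF p] p r M0 by (cases "M2 = 0") auto
    have "M1 \<le> \<rho>2 * (\<rho>1 * M1)"
      using le1[OF p] mult_left_mono[OF le2[OF m2] r(2)] by linarith
    hence "M1 * (1 - \<rho>1 * \<rho>2) \<le> 0" by (simp add: algebra_simps)
    moreover have "0 < M1 * (1 - \<rho>1 * \<rho>2)" using p r(3) by simp
    ultimately show False by linarith
  qed
  moreover have "\<not> 0 < M2" using le2 \<open>M1 = 0\<close> by (metis mult_zero_right not_le)
  ultimately show ?thesis using M1(1)[of T] M2(1)[of T] T by (auto simp: D1_def D2_def)
qed

lemma is_reflection2_unique:
  assumes r: "0 \<le> \<rho>1" "0 \<le> \<rho>2" "\<rho>1 * \<rho>2 < 1"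
    and R: "is_reflection2 \<rho>1 \<rho>2 Y1 Y2 w W L" "is_reflection2 \<rho>1 \<rho>2 Y1 Y2 w W' L'"
    and T: "0 \<le> T"
  shows "W T = W' T"
proof -
  have "fst (L T) = fst (L' T)" "snd (L T) = snd (L' T)"
    using is_reflection2_le[OF r R T] is_reflection2_le[OF r R(2,1) T] by auto
  thus ?thesis using R T by (auto simp: is_reflection2_def prod_eq_iff)
qed

lemma refl_workload_eq:
  assumes "0 \<le> \<rho>1" "0 \<le> \<rho>2" "\<rho>1 * \<rho>2 < 1"
    and "is_reflection2 \<rho>1 \<rho>2 Y1 Y2 w W L" "0 \<le> T"
  shows "refl_workload \<rho>1 \<rho>2 Y1 Y2 w T = W T"
  unfolding refl_workload_def
proof (rule the_equality)
  show "\<exists>W' L. is_reflection2 \<rho>1 \<rho>2 Y1 Y2 w W' L \<and> W' T = W T" using assms(4) by blast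
next
  fix x assume "\<exists>W L. is_reflection2 \<rho>1 \<rho>2 Y1 Y2 w W L \<and> W T = x"
  thus "x = W T" using is_reflection2_unique[OF assms(1-4) _ assms(5)] by metis
qed

text \<open>The regulators are the pointwise infimum of all pairs of nondecreasing functions
  that keep both components nonnegative. Minimality, tested against modifications of the
  regulators on an interval, yields both their Lipschitz continuity and the complementarity
  conditions.\<close>

definition is_supersolution ::
  "real \<Rightarrow> real \<Rightarrow> (real \<Rightarrow> real) \<Rightarrow> (real \<Rightarrow> real) \<Rightarrow> real \<times> real
   \<Rightarrow> (real \<Rightarrow> real) \<Rightarrow> (real \<Rightarrow> real) \<Rightarrow> bool" where
  "is_supersolution \<rho>1 \<rho>2 X1 X2 w l1 l2 \<longleftrightarrow>
     mono_on {0..} l1 \<and> mono_on {0..} l2 \<and>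
     (\<forall>t\<ge>0. 0 \<le> l1 t \<and> 0 \<le> l2 t \<and> X1 t - fst w + \<rho>2 * l2 t \<le> l1 t
                            \<and> X2 t - snd w + \<rho>1 * l1 t \<le> l2 t)"

lemma is_supersolution_swap:
  "is_supersolution \<rho>1 \<rho>2 X1 X2 w l1 l2 \<longleftrightarrow>
   is_supersolution \<rho>2 \<rho>1 X2 X1 (prod.swap w) l2 l1"
  by (auto simp: is_supersolution_def)

definition max_rate :: "real \<Rightarrow> real \<Rightarrow> real \<Rightarrow> real \<Rightarrow> real" where
  "max_rate \<rho>1 \<rho>2 c1 c2 = (c1 + \<rho>2 * c2) / (1 - \<rho>1 * \<rho>2)"

lemma max_rate_eq:
  assumes "\<rho>1 * \<rho>2 < 1"
  shows "max_rate \<rho>1 \<rho>2 c1 c2 = c1 + \<rho>2 * max_rate \<rho>2 \<rho>1 c2 c1"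
  using assms by (simp add: max_rate_def field_simps)

lemma max_rate_nonneg:
  assumes "0 \<le> \<rho>1" "0 \<le> \<rho>2" "\<rho>1 * \<rho>2 < 1" "0 \<le> c1" "0 \<le> c2"
  shows "0 \<le> max_rate \<rho>1 \<rho>2 c1 c2"
  using assms by (simp add: max_rate_def)

lemma least_supersolution_exists:
  assumes r: "0 \<le> \<rho>1" "0 \<le> \<rho>2"
    and ex: "is_supersolution \<rho>1 \<rho>2 X1 X2 w u1 u2"
  obtains l1 l2 where "is_supersolution \<rho>1 \<rho>2 X1 X2 w l1 l2"
    and "\<forall>k1 k2. is_supersolution \<rho>1 \<rho>2 X1 X2 w k1 k2 \<longrightarrow> (\<forall>t\<ge>0. l1 t \<le> k1 t \<and> l2 t \<le> k2 t)"
proof -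
  define S where "S = {(k1, k2). is_supersolution \<rho>1 \<rho>2 X1 X2 w k1 k2}"
  have ne: "S \<noteq> {}" using ex by (auto simp: S_def)
  have SD: "is_supersolution \<rho>1 \<rho>2 X1 X2 w (fst k) (snd k)"
      "0 \<le> t \<Longrightarrow> 0 \<le> fst k t" "0 \<le> t \<Longrightarrow> 0 \<le> snd k t"
      "0 \<le> t \<Longrightarrow> X1 t - fst w + \<rho>2 * snd k t \<le> fst k t"
      "0 \<le> t \<Longrightarrow> X2 t - snd w + \<rho>1 * fst k t \<le> snd k t" if "k \<in> S" for k t
    using that unfolding S_def is_supersolution_def by (simp_all add: case_prod_beta)
  define l1 where "l1 t = (INF k\<in>S. fst k t)" for t
  define l2 where "l2 t = (INF k\<in>S. snd k t)" for t
  have bdd: "bdd_below ((\<lambda>k. fst k t) ` S)" "bdd_below ((\<lambda>k. snd k t) ` S)" if "0 \<le> t" for t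
    by (rule bdd_belowI2[of _ 0], use that SD in blast)+
  have low: "l1 t \<le> k1 t \<and> l2 t \<le> k2 t" if "is_supersolution \<rho>1 \<rho>2 X1 X2 w k1 k2" "0 \<le> t" for k1 k2 t
  proof -
    have "(k1, k2) \<in> S" using that by (simp add: S_def)
    thus ?thesis
      using cINF_lower[OF bdd(1)[OF that(2)], of "(k1, k2)"]
        cINF_lower[OF bdd(2)[OF that(2)], of "(k1, k2)"] by (simp add: l1_def l2_def)
  qed
  have "is_supersolution \<rho>1 \<rho>2 X1 X2 w l1 l2"
    unfolding is_supersolution_def
  proof (intro conjI allI impI)
    show "mono_on {0..} l1"
    proof (rule mono_onI)
      fix s t :: real assume st: "s \<in> {0..}" "t \<in> {0..}" "s \<le> t"
      show "l1 s \<le> l1 t"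
        unfolding l1_def[of t]
      proof (rule cINF_greatest[OF ne])
        fix k assume "k \<in> S"
        hence "fst k s \<le> fst k t" "is_supersolution \<rho>1 \<rho>2 X1 X2 w (fst k) (snd k)"
          using st by (auto simp: S_def is_supersolution_def mono_on_def)
        thus "l1 s \<le> fst k t" using low[of "fst k" "snd k" s] st by auto
      qed
    qed
    show "mono_on {0..} l2"
    proof (rule mono_onI)
      fix s t :: real assume st: "s \<in> {0..}" "t \<in> {0..}" "s \<le> t"
      show "l2 s \<le> l2 t"
        unfolding l2_def[of t]
      proof (rule cINF_greatest[OF ne])
        fix k assume "k \<in> S"
        hence "snd k s \<le> snd k t" "is_supersolution \<rho>1 \<rho>2 X1 X2 w (fst k) (snd k)"
          using st by (auto simp: S_def is_supersolution_def mono_on_def)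
        thus "l2 s \<le> snd k t" using low[of "fst k" "snd k" s] st by auto
      qed
    qed
    fix t :: real assume t: "0 \<le> t"
    show "0 \<le> l1 t" unfolding l1_def
      by (rule cINF_greatest[OF ne]) (use t SD in blast)
    show "0 \<le> l2 t" unfolding l2_def
      by (rule cINF_greatest[OF ne]) (use t SD in blast)
    show "X1 t - fst w + \<rho>2 * l2 t \<le> l1 t"
      unfolding l1_def
    proof (rule cINF_greatest[OF ne])
      fix k assume k: "k \<in> S"
      hence "l2 t \<le> snd k t" using low[of "fst k" "snd k" t] t SD(1) by blast
      hence "\<rho>2 * l2 t \<le> \<rho>2 * snd k t" using r by (intro mult_left_mono)
      moreover have "X1 t - fst w + \<rho>2 * snd k t \<le> fst k t"
        using k t SD(4,5) by blast
      ultimately show "X1 t - fst w + \<rho>2 * l2 t \<le> fst k t" by linarith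
    qed
    show "X2 t - snd w + \<rho>1 * l1 t \<le> l2 t"
      unfolding l2_def
    proof (rule cINF_greatest[OF ne])
      fix k assume k: "k \<in> S"
      hence "l1 t \<le> fst k t" using low[of "fst k" "snd k" t] t SD(1) by blast
      hence "\<rho>1 * l1 t \<le> \<rho>1 * fst k t" using r by (intro mult_left_mono)
      moreover have "X2 t - snd w + \<rho>1 * fst k t \<le> snd k t"
        using k t SD(4,5) by blast
      ultimately show "X2 t - snd w + \<rho>1 * l1 t \<le> snd k t" by linarith
    qed
  qed
  with low that show ?thesis by blast
qed

locale skorokhod_input =
  fixes \<rho>1 \<rho>2 c1 c2 :: real and X1 X2 :: "real \<Rightarrow> real" and w :: "real \<times> real"
  assumes rho: "0 \<le> \<rho>1" "0 \<le> \<rho>2" "\<rho>1 * \<rho>2 < 1"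
    and c_nonneg: "0 \<le> c1" "0 \<le> c2"
    and X0: "X1 0 = 0" "X2 0 = 0"
    and X1_lip: "\<And>s t. 0 \<le> s \<Longrightarrow> s \<le> t \<Longrightarrow> X1 t - X1 s \<le> c1 * (t - s)"
    and X2_lip: "\<And>s t. 0 \<le> s \<Longrightarrow> s \<le> t \<Longrightarrow> X2 t - X2 s \<le> c2 * (t - s)"
    and w_nonneg: "0 \<le> fst w" "0 \<le> snd w"
begin

abbreviation "K1 \<equiv> max_rate \<rho>1 \<rho>2 c1 c2"
abbreviation "K2 \<equiv> max_rate \<rho>2 \<rho>1 c2 c1"

lemma K1_eq: "K1 = c1 + \<rho>2 * K2" and K2_eq: "K2 = c2 + \<rho>1 * K1"
  using rho by (auto intro!: max_rate_eq simp: mult.commute)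

lemma K_nonneg: "0 \<le> K1" "0 \<le> K2"
  using rho c_nonneg by (auto intro!: max_rate_nonneg simp: mult.commute)

lemma linear_supersolution: "is_supersolution \<rho>1 \<rho>2 X1 X2 w (\<lambda>t. K1 * t) (\<lambda>t. K2 * t)"
proof -
  have "X1 t - fst w + \<rho>2 * (K2 * t) \<le> K1 * t \<and> X2 t - snd w + \<rho>1 * (K1 * t) \<le> K2 * t"
    if "0 \<le> t" for t
  proof -
    have "K1 * t = c1 * t + \<rho>2 * (K2 * t)" "K2 * t = c2 * t + \<rho>1 * (K1 * t)"
      by (subst K1_eq, simp add: algebra_simps) (subst K2_eq, simp add: algebra_simps)
    thus ?thesis using X1_lip[of 0 t] X2_lip[of 0 t] that X0 w_nonneg by auto
  qed
  thus ?thesis using K_nonneg by (auto simp: is_supersolution_def mono_on_def intro: mult_left_mono)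
qed

lemma least_supersolution_lipschitz:
  assumes l: "is_supersolution \<rho>1 \<rho>2 X1 X2 w l1 l2"
    and least: "\<forall>k1 k2. is_supersolution \<rho>1 \<rho>2 X1 X2 w k1 k2 \<longrightarrow> (\<forall>t\<ge>0. l1 t \<le> k1 t \<and> l2 t \<le> k2 t)"
    and at: "0 \<le> a" "a \<le> t"
  shows "l1 t \<le> l1 a + K1 * (t - a) \<and> l2 t \<le> l2 a + K2 * (t - a)"
proof -
  note l' = l[unfolded is_supersolution_def]
  define k1 where "k1 u = (if u \<le> a then l1 u else min (l1 u) (l1 a + K1 * (u - a)))" for u
  define k2 where "k2 u = (if u \<le> a then l2 u else min (l2 u) (l2 a + K2 * (u - a)))" for u
  have mono1: "l1 x \<le> l1 y" and mono2: "l2 x \<le> l2 y" if "0 \<le> x" "x \<le> y" for x y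
    using l' that by (auto simp: mono_on_def)
  have kle: "k1 u \<le> l1 u" "k2 u \<le> l2 u" for u by (auto simp: k1_def k2_def)
  have KK1: "K1 * d = c1 * d + \<rho>2 * (K2 * d)" and KK2: "K2 * d = c2 * d + \<rho>1 * (K1 * d)" for d
    by (subst K1_eq, simp add: algebra_simps) (subst K2_eq, simp add: algebra_simps)
  have "is_supersolution \<rho>1 \<rho>2 X1 X2 w k1 k2"
    unfolding is_supersolution_def
  proof (intro conjI allI impI)
    show "mono_on {0..} k1"
    proof (rule mono_onI)
      fix x y :: real assume xy: "x \<in> {0..}" "y \<in> {0..}" "x \<le> y"
      have "K1 * (x - a) \<le> K1 * (y - a)" using xy K_nonneg by (intro mult_left_mono) auto
      moreover have "a < y \<Longrightarrow> 0 \<le> K1 * (y - a)" using K_nonneg by simp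
      ultimately show "k1 x \<le> k1 y"
        using mono1[of x y] mono1[of x a] xy at by (auto simp: k1_def min_def)
    qed
    show "mono_on {0..} k2"
    proof (rule mono_onI)
      fix x y :: real assume xy: "x \<in> {0..}" "y \<in> {0..}" "x \<le> y"
      have "K2 * (x - a) \<le> K2 * (y - a)" using xy K_nonneg by (intro mult_left_mono) auto
      moreover have "a < y \<Longrightarrow> 0 \<le> K2 * (y - a)" using K_nonneg by simp
      ultimately show "k2 x \<le> k2 y"
        using mono2[of x y] mono2[of x a] xy at by (auto simp: k2_def min_def)
    qed
    fix u :: real assume u: "0 \<le> u"
    have kk: "\<rho>2 * k2 u \<le> \<rho>2 * l2 u" "\<rho>1 * k1 u \<le> \<rho>1 * l1 u"
      using kle rho by (auto intro: mult_left_mono)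
    have Xl: "X1 u - fst w + \<rho>2 * l2 u \<le> l1 u" "X2 u - snd w + \<rho>1 * l1 u \<le> l2 u"
      using l' u by auto
    have Xa: "X1 a - fst w + \<rho>2 * l2 a \<le> l1 a" "X2 a - snd w + \<rho>1 * l1 a \<le> l2 a"
      using l' at by auto
    show "0 \<le> k1 u" "0 \<le> k2 u" using l' u at K_nonneg by (auto simp: k1_def k2_def)
    show "X1 u - fst w + \<rho>2 * k2 u \<le> k1 u"
    proof (cases "k1 u = l1 u")
      case False
      hence ua: "a < u" and k1u: "k1 u = l1 a + K1 * (u - a)"
        by (auto simp: k1_def min_def split: if_splits)
      have "\<rho>2 * k2 u \<le> \<rho>2 * (l2 a + K2 * (u - a))"
        using ua rho by (intro mult_left_mono) (auto simp: k2_def)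
      thus ?thesis using X1_lip[of a u] at ua Xa KK1[of "u - a"] k1u by (auto simp: algebra_simps)
    qed (use kk Xl in linarith)
    show "X2 u - snd w + \<rho>1 * k1 u \<le> k2 u"
    proof (cases "k2 u = l2 u")
      case False
      hence ua: "a < u" and k2u: "k2 u = l2 a + K2 * (u - a)"
        by (auto simp: k2_def min_def split: if_splits)
      have "\<rho>1 * k1 u \<le> \<rho>1 * (l1 a + K1 * (u - a))"
        using ua rho by (intro mult_left_mono) (auto simp: k1_def)
      thus ?thesis using X2_lip[of a u] at ua Xa KK2[of "u - a"] k2u by (auto simp: algebra_simps)
    qed (use kk Xl in linarith)
  qed
  from least[rule_format, OF this, of t] at show ?thesis
    by (cases "t = a") (auto simp: k1_def k2_def)
qed

lemma least_supersolution_complementarity: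
  assumes l: "is_supersolution \<rho>1 \<rho>2 X1 X2 w l1 l2"
    and least: "\<forall>k1 k2. is_supersolution \<rho>1 \<rho>2 X1 X2 w k1 k2 \<longrightarrow> (\<forall>t\<ge>0. l1 t \<le> k1 t \<and> l2 t \<le> k2 t)"
    and cont: "continuous_on {0..} l1"
    and lip2: "\<And>s t. 0 \<le> s \<Longrightarrow> s \<le> t \<Longrightarrow> l2 t \<le> l2 s + K2 * (t - s)"
    and st: "0 \<le> s" "s \<le> t"
    and pos: "\<forall>u\<in>{s..t}. 0 < fst w - X1 u + l1 u - \<rho>2 * l2 u"
  shows "l1 s = l1 t"
proof (rule ccontr)
  assume "l1 s \<noteq> l1 t"
  note l' = l[unfolded is_supersolution_def]
  have mono1: "l1 x \<le> l1 y" if "0 \<le> x" "x \<le> y" for x y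
    using l' that by (auto simp: mono_on_def)
  have lt: "l1 s < l1 t" using mono1[OF st] \<open>l1 s \<noteq> l1 t\<close> by simp
  define Z where "Z u = X1 u - fst w + \<rho>2 * l2 u" for u
  have "continuous_on {s..t} l1" using cont st by (auto intro: continuous_on_subset)
  hence "closed {v \<in> {s..t}. l1 v = l1 s}"
    by (intro continuous_closed_preimage_constant closed_atLeastAtMost)
  moreover have "bounded {v \<in> {s..t}. l1 v = l1 s}"
    by (rule bounded_subset[of "{s..t}"]) auto
  ultimately have "compact {v \<in> {s..t}. l1 v = l1 s}"
    by (simp add: compact_eq_bounded_closed)
  moreover have "s \<in> {v \<in> {s..t}. l1 v = l1 s}" using st by auto
  ultimately obtain v where v: "v \<in> {s..t}" "l1 v = l1 s"
    and last: "\<And>x. x \<in> {s..t} \<Longrightarrow> l1 x = l1 s \<Longrightarrow> x \<le> v"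
    using compact_attains_sup[of "{v \<in> {s..t}. l1 v = l1 s}"] by blast
  have vt: "v < t" using v lt by (cases "v = t") auto
  have ex: "\<exists>x\<in>{v..y}. l1 s < Z x" if y: "v < y" "y \<le> t" for y
  proof (rule ccontr)
    assume "\<not> ?thesis"
    hence H: "\<And>x. x \<in> {v..y} \<Longrightarrow> Z x \<le> l1 s" by force
    define k1 where "k1 x = (if x \<in> {v..y} then l1 s else l1 x)" for x
    have kle: "k1 x \<le> l1 x" if "0 \<le> x" for x
      using mono1[of v x] v that st by (auto simp: k1_def)
    have "is_supersolution \<rho>1 \<rho>2 X1 X2 w k1 l2"
      unfolding is_supersolution_def
    proof (intro conjI allI impI)
      show "mono_on {0..} k1"
      proof (rule mono_onI)
        fix a b :: real assume ab: "a \<in> {0..}" "b \<in> {0..}" "a \<le> b"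
        show "k1 a \<le> k1 b"
          using mono1[of a b] mono1[of v b] mono1[of a v] ab v st
          by (auto simp: k1_def)
      qed
      show "mono_on {0..} l2" using l' by auto
      fix u :: real assume u: "0 \<le> u"
      show "0 \<le> k1 u" "0 \<le> l2 u" using l' u st by (auto simp: k1_def)
      show "X1 u - fst w + \<rho>2 * l2 u \<le> k1 u"
        using H[of u] l' u by (auto simp: k1_def Z_def)
      show "X2 u - snd w + \<rho>1 * k1 u \<le> l2 u"
      proof -
        have "\<rho>1 * k1 u \<le> \<rho>1 * l1 u" using kle[OF u] rho by (intro mult_left_mono)
        moreover have "X2 u - snd w + \<rho>1 * l1 u \<le> l2 u" using l' u by auto
        ultimately show ?thesis by linarith
      qed
    qed
    from least[rule_format, OF this, of y] have "l1 y \<le> l1 s" using y v st by (auto simp: k1_def)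
    hence "l1 y = l1 s" using mono1[of s y] y v st by auto
    thus False using last[of y] y v by auto
  qed
  have "l1 s \<le> Z v"
  proof (rule field_le_epsilon)
    fix e :: real assume e: "0 < e"
    define d where "d = min (t - v) (e / (K1 + 1))"
    have d: "0 < d" "v + d \<le> t" "d \<le> e / (K1 + 1)"
      using vt e K_nonneg by (auto simp: d_def)
    have de: "d * (K1 + 1) \<le> e"
      using d(3) K_nonneg pos_le_divide_eq[of "K1 + 1" d e] by linarith
    from ex[of "v + d"] d obtain x where x: "x \<in> {v..v+d}" "l1 s < Z x" by auto
    have 1: "X1 x - X1 v \<le> c1 * (x - v)" using X1_lip[of v x] x v st by auto
    have "\<rho>2 * l2 x \<le> \<rho>2 * (l2 v + K2 * (x - v))"
      using lip2[of v x] x v st rho by (intro mult_left_mono) auto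
    with 1 have "Z x \<le> Z v + (c1 + \<rho>2 * K2) * (x - v)" by (simp add: Z_def algebra_simps)
    also have "\<dots> = Z v + K1 * (x - v)" using K1_eq by simp
    also have "\<dots> \<le> Z v + K1 * d" using x K_nonneg by (intro add_left_mono mult_left_mono) auto
    also have "\<dots> \<le> Z v + e" using d de by (simp add: algebra_simps)
    finally show "l1 s \<le> Z v + e" using x by linarith
  qed
  hence "fst w - X1 v + l1 v - \<rho>2 * l2 v \<le> 0" using v by (simp add: Z_def)
  thus False using pos v by force
qed

end

lemma skorokhod_input_swap:
  assumes "skorokhod_input \<rho>1 \<rho>2 c1 c2 X1 X2 w"
  shows "skorokhod_input \<rho>2 \<rho>1 c2 c1 X2 X1 (prod.swap w)"
  using assms by (simp add: skorokhod_input_def mult.commute)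

context skorokhod_input
begin

lemma reflection_exists:
  obtains W L where "is_reflection2 \<rho>1 \<rho>2 (\<lambda>t. - X1 t) (\<lambda>t. - X2 t) w W L"
    and "\<And>t. 0 \<le> t \<Longrightarrow> fst (L t) \<le> K1 * t \<and> snd (L t) \<le> K2 * t"
proof -
  obtain l1 l2 where l: "is_supersolution \<rho>1 \<rho>2 X1 X2 w l1 l2"
    and least: "\<forall>k1 k2. is_supersolution \<rho>1 \<rho>2 X1 X2 w k1 k2 \<longrightarrow> (\<forall>t\<ge>0. l1 t \<le> k1 t \<and> l2 t \<le> k2 t)"
    using least_supersolution_exists[OF rho(1,2) linear_supersolution] by blast
  note l' = l[unfolded is_supersolution_def]
  note lip = least_supersolution_lipschitz[OF l least]
  have up: "l1 t \<le> K1 * t" "l2 t \<le> K2 * t" if "0 \<le> t" for t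
    using least[rule_format, OF linear_supersolution that] by auto
  have cont: "continuous_on {0..} g"
    if g: "\<And>s t. 0 \<le> s \<Longrightarrow> s \<le> t \<Longrightarrow> g s \<le> g t \<and> g t \<le> g s + K * (t - s)" and "0 \<le> K"
    for g :: "real \<Rightarrow> real" and K
  proof -
    have "K-lipschitz_on {0..} g"
    proof (rule lipschitz_onI)
      fix x y :: real assume "x \<in> {0..}" "y \<in> {0..}"
      thus "dist (g x) (g y) \<le> K * dist x y"
        using g[of x y] g[of y x] by (cases "x \<le> y") (auto simp: dist_real_def)
    qed (use that in auto)
    thus ?thesis by (rule lipschitz_on_continuous_on)
  qed
  have c1: "continuous_on {0..} l1"
    by (rule cont[of _ K1]) (use lip l' K_nonneg in \<open>auto simp: mono_on_def\<close>)
  have c2: "continuous_on {0..} l2"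
    by (rule cont[of _ K2]) (use lip l' K_nonneg in \<open>auto simp: mono_on_def\<close>)
  interpret sw: skorokhod_input \<rho>2 \<rho>1 c2 c1 X2 X1 "prod.swap w"
    by (rule skorokhod_input_swap) (rule skorokhod_input_axioms)
  have l_sw: "is_supersolution \<rho>2 \<rho>1 X2 X1 (prod.swap w) l2 l1"
    using l by (simp add: is_supersolution_swap[of \<rho>1])
  have least_sw: "\<forall>k2 k1. is_supersolution \<rho>2 \<rho>1 X2 X1 (prod.swap w) k2 k1
      \<longrightarrow> (\<forall>t\<ge>0. l2 t \<le> k2 t \<and> l1 t \<le> k1 t)"
    using least by (simp add: is_supersolution_swap[of \<rho>1])
  define L where "L t = (l1 t, l2 t)" for t
  define W where "W t = (fst w - X1 t + l1 t - \<rho>2 * l2 t, snd w - X2 t + l2 t - \<rho>1 * l1 t)" for t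
  have z: "l1 0 = 0" "l2 0 = 0" using up[of 0] l' by (auto simp: order_antisym)
  have "is_reflection2 \<rho>1 \<rho>2 (\<lambda>t. - X1 t) (\<lambda>t. - X2 t) w W L"
    unfolding is_reflection2_def
  proof (intro conjI allI impI)
    fix s t :: real
    { assume H: "0 \<le> s \<and> s \<le> t \<and> (\<forall>u\<in>{s..t}. 0 < fst (W u))"
      show "fst (L s) = fst (L t)"
        using least_supersolution_complementarity[OF l least c1, of s t] lip H
        by (auto simp: L_def W_def) }
    { assume H: "0 \<le> s \<and> s \<le> t \<and> (\<forall>u\<in>{s..t}. 0 < snd (W u))"
      show "snd (L s) = snd (L t)"
        using sw.least_supersolution_complementarity[OF l_sw least_sw c2, of s t] lip H
        by (auto simp: L_def W_def) }
  qed (use l' z c1 c2 in \<open>auto simp: L_def W_def algebra_simps\<close>)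
  moreover have "fst (L t) \<le> K1 * t \<and> snd (L t) \<le> K2 * t" if "0 \<le> t" for t
    using up[OF that] by (simp add: L_def)
  ultimately show ?thesis using that by blast
qed

end

definition idle_rate :: "real \<Rightarrow> real \<Rightarrow> real \<Rightarrow> real \<Rightarrow> real \<times> real \<Rightarrow> real" where
  "idle_rate \<rho>1 \<rho>2 c1 c2 w =
     (if fst w = 0 then if snd w = 0 then max_rate \<rho>1 \<rho>2 c1 c2 else c1 else 0)"

context skorokhod_input
begin

lemma workload_representation:
  assumes "0 \<le> T"
  obtains l1 l2 where "0 \<le> l1" "l1 \<le> K1 * T" "0 \<le> l2" "l2 \<le> K2 * T"
    and "refl_workload \<rho>1 \<rho>2 (\<lambda>t. - X1 t) (\<lambda>t. - X2 t) w T =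
           (fst w - X1 T + l1 - \<rho>2 * l2, snd w - X2 T + l2 - \<rho>1 * l1)"
    and "0 \<le> fst w - X1 T + l1 - \<rho>2 * l2" "0 \<le> snd w - X2 T + l2 - \<rho>1 * l1"
proof -
  obtain W L where R: "is_reflection2 \<rho>1 \<rho>2 (\<lambda>t. - X1 t) (\<lambda>t. - X2 t) w W L"
    and B: "\<And>t. 0 \<le> t \<Longrightarrow> fst (L t) \<le> K1 * t \<and> snd (L t) \<le> K2 * t"
    using reflection_exists by blast
  note R' = R[unfolded is_reflection2_def]
  have "0 \<le> fst (L T)" "0 \<le> snd (L T)"
    using R' assms by (auto simp: mono_on_def) (metis order_refl)+
  moreover have "W T = (fst w - X1 T + fst (L T) - \<rho>2 * snd (L T),
      snd w - X2 T + snd (L T) - \<rho>1 * fst (L T))"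
    and "0 \<le> fst (W T)" "0 \<le> snd (W T)"
    using R' assms by (auto simp: prod_eq_iff)
  ultimately show ?thesis
    using that[of "fst (L T)" "snd (L T)"] B[OF assms] refl_workload_eq[OF rho R assms] by auto
qed

lemma regulator_zero_if_far:
  assumes R: "is_reflection2 \<rho>1 \<rho>2 (\<lambda>t. - X1 t) (\<lambda>t. - X2 t) w W L"
    and B: "\<And>t. 0 \<le> t \<Longrightarrow> snd (L t) \<le> K2 * t"
    and far: "K1 * T < fst w" and t: "0 \<le> t" "t \<le> T"
  shows "fst (L t) = 0"
proof -
  note R' = R[unfolded is_reflection2_def]
  have "0 < fst (W u)" if u: "u \<in> {0..t}" for u
  proof -
    have "mono_on {0..} (\<lambda>t. fst (L t))" using R' by blast
    from mono_onD[OF this, of 0 u] have "fst (L 0) \<le> fst (L u)" using u by simp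
    hence "0 \<le> fst (L u)" using R' by simp
    moreover have "\<rho>2 * snd (L u) \<le> \<rho>2 * (K2 * u)"
      using B[of u] u rho by (intro mult_left_mono) auto
    moreover have "X1 u \<le> c1 * u" using X1_lip[of 0 u] X0 u by auto
    moreover have "K1 * u = c1 * u + \<rho>2 * (K2 * u)" by (subst K1_eq) (simp add: algebra_simps)
    moreover have "K1 * u \<le> K1 * T" using u t K_nonneg by (intro mult_left_mono) auto
    moreover have "fst (W u) = fst w + - X1 u + fst (L u) - \<rho>2 * snd (L u)" using R' u by auto
    ultimately show ?thesis using far by linarith
  qed
  hence "fst (L 0) = fst (L t)" using R' t by blast
  thus ?thesis using R' by simp
qed

lemma regulator_linear_at_boundary:
  assumes R: "is_reflection2 \<rho>1 \<rho>2 (\<lambda>t. - X1 t) (\<lambda>t. - X2 t) w W L"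
    and z: "\<And>t. 0 \<le> t \<Longrightarrow> t \<le> T \<Longrightarrow> snd (L t) = 0"
    and X: "\<And>t. 0 \<le> t \<Longrightarrow> t \<le> T \<Longrightarrow> X1 t = c1 * t"
    and w0: "fst w = 0" and T: "0 \<le> T"
  shows "fst (L T) = c1 * T"
proof -
  note R' = R[unfolded is_reflection2_def]
  have W: "fst (W t) = fst (L t) - c1 * t" "0 \<le> fst (W t)" if "0 \<le> t" "t \<le> T" for t
    using R' that z[of t] X[of t] w0 by auto
  have c: "continuous_on {0..T} (\<lambda>t. fst (L t) - c1 * t)"
    using R' by (auto intro!: continuous_intros elim!: continuous_on_subset)
  obtain M where M: "\<And>t. t \<in> {0..T} \<Longrightarrow> fst (L t) - c1 * t \<le> M" "\<exists>t\<in>{0..T}. fst (L t) - c1 * t = M"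
    using continuous_attains_sup[OF compact_Icc _ c] T by fastforce
  have "\<not> 0 < M"
  proof
    assume "0 < M"
    have "M \<le> 0"
    proof (rule reflection_deviation_bound[OF T c _ _ _ _ M \<open>0 < M\<close>, where W="\<lambda>t. fst (W t)"])
      show "c1 * s \<le> c1 * t" if "s \<le> t" for s t
        using that c_nonneg by (intro mult_left_mono)
      show "fst (L s) = fst (L t)" if "0 \<le> s" "s \<le> t" "\<forall>u\<in>{s..t}. 0 < fst (W u)" for s t
        using R' that by blast
      show "fst (L u) - c1 * u \<le> 0" if "0 \<le> u" "u \<le> T" "fst (W u) \<le> 0" for u
        using W(1)[OF that(1,2)] that(3) by linarith
      show "fst (L 0) = c1 * 0" using R' by simp
    qed
    thus False using \<open>0 < M\<close> by simp
  qed
  thus ?thesis using M(1)[of T] W[of T] T by auto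
qed

lemma workload_small_time:
  assumes T: "0 \<le> T"
    and X: "\<And>t. 0 \<le> t \<Longrightarrow> t \<le> T \<Longrightarrow> X1 t = c1 * t" "\<And>t. 0 \<le> t \<Longrightarrow> t \<le> T \<Longrightarrow> X2 t = c2 * t"
    and far: "fst w = 0 \<or> K1 * T < fst w" "snd w = 0 \<or> K2 * T < snd w"
  defines "g1 \<equiv> idle_rate \<rho>1 \<rho>2 c1 c2 w" and "g2 \<equiv> idle_rate \<rho>2 \<rho>1 c2 c1 (prod.swap w)"
  shows "refl_workload \<rho>1 \<rho>2 (\<lambda>t. - X1 t) (\<lambda>t. - X2 t) w T =
           (fst w - T * (c1 - g1 + \<rho>2 * g2), snd w - T * (c2 - g2 + \<rho>1 * g1))"
proof -
  obtain W L where R: "is_reflection2 \<rho>1 \<rho>2 (\<lambda>t. - X1 t) (\<lambda>t. - X2 t) w W L"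
    and B: "\<And>t. 0 \<le> t \<Longrightarrow> fst (L t) \<le> K1 * t \<and> snd (L t) \<le> K2 * t"
    using reflection_exists by blast
  note R' = R[unfolded is_reflection2_def]
  interpret sw: skorokhod_input \<rho>2 \<rho>1 c2 c1 X2 X1 "prod.swap w"
    by (rule skorokhod_input_swap) (rule skorokhod_input_axioms)
  have Rs: "is_reflection2 \<rho>2 \<rho>1 (\<lambda>t. - X2 t) (\<lambda>t. - X1 t) (prod.swap w)
      (\<lambda>t. prod.swap (W t)) (\<lambda>t. prod.swap (L t))"
    using R' unfolding is_reflection2_def fst_swap snd_swap by blast
  have far1: "fst (L t) = 0" if "K1 * T < fst w" "0 \<le> t" "t \<le> T" for t
    using regulator_zero_if_far[OF R _ that] B by auto
  have far2: "snd (L t) = 0" if "K2 * T < snd w" "0 \<le> t" "t \<le> T" for t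
    using sw.regulator_zero_if_far[OF Rs, of T t] B that by auto
  have KT: "0 \<le> K1 * T" "0 \<le> K2 * T" using K_nonneg T by auto
  have "fst (L T) = g1 * T \<and> snd (L T) = g2 * T"
  proof (cases "fst w = 0")
    case w1: True
    show ?thesis
    proof (cases "snd w = 0")
      case w2: True
      have W: "c1 * T + \<rho>2 * snd (L T) \<le> fst (L T)" "c2 * T + \<rho>1 * fst (L T) \<le> snd (L T)"
        using R' T X[of T] w1 w2 by auto
      have BT: "fst (L T) \<le> K1 * T" "snd (L T) \<le> K2 * T" using B T by auto
      have K1T: "K1 * T = c1 * T + \<rho>2 * (K2 * T)" by (subst K1_eq) (simp add: algebra_simps)
      have K2T: "K2 * T = c2 * T + \<rho>1 * (K1 * T)" by (subst K2_eq) (simp add: algebra_simps)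
      define x where "x = K1 * T - fst (L T)"
      define y where "y = K2 * T - snd (L T)"
      have xy: "0 \<le> x" "0 \<le> y" "x \<le> \<rho>2 * y" "y \<le> \<rho>1 * x"
        unfolding x_def y_def right_diff_distrib using W BT K1T K2T by linarith+
      have "x \<le> \<rho>2 * (\<rho>1 * x)" using xy mult_left_mono[OF xy(4) rho(2)] by linarith
      hence "x * (1 - \<rho>1 * \<rho>2) \<le> 0" by (simp add: algebra_simps)
      hence "x = 0" using xy rho by (simp add: mult_le_0_iff)
      hence "y = 0" using xy by simp
      with \<open>x = 0\<close> show ?thesis using w1 w2 by (simp add: g1_def g2_def idle_rate_def x_def y_def)
    next
      case w2: False
      hence "K2 * T < snd w" using far by auto
      hence "snd (L t) = 0" if "0 \<le> t" "t \<le> T" for t using far2 that by auto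
      with regulator_linear_at_boundary[OF R, of T] X w1 T w2 show ?thesis
        by (simp add: g1_def g2_def idle_rate_def)
    qed
  next
    case w1: False
    hence 1: "K1 * T < fst w" using far by auto
    show ?thesis
    proof (cases "snd w = 0")
      case w2: True
      show ?thesis using sw.regulator_linear_at_boundary[OF Rs, of T] far1[OF 1] X w1 T w2
        by (simp add: g1_def g2_def idle_rate_def)
    next
      case w2: False
      hence 2: "K2 * T < snd w" using far by auto
      show ?thesis using far1[OF 1, of T] far2[OF 2, of T] T w1 w2
        by (simp add: g1_def g2_def idle_rate_def)
    qed
  qed
  hence "W T = (fst w - T * (c1 - g1 + \<rho>2 * g2), snd w - T * (c2 - g2 + \<rho>1 * g1))"
  proof -
    assume LT: "fst (L T) = g1 * T \<and> snd (L T) = g2 * T"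
    have "fst (W T) = fst w + - X1 T + fst (L T) - \<rho>2 * snd (L T)"
      "snd (W T) = snd w + - X2 T + snd (L T) - \<rho>1 * fst (L T)"
      using R' T by blast+
    thus ?thesis using LT X[of T] T by (simp add: prod_eq_iff algebra_simps)
  qed
  thus ?thesis using refl_workload_eq[OF rho R T] by simp
qed

end

section \<open>Laplace transforms of measures on the half-line\<close>

definition laplace :: "real measure \<Rightarrow> complex \<Rightarrow> complex" where
  "laplace M s = (LINT x|M. exp (- s * of_real x))"

lemma norm_exp_minus_mult_le_one:
  assumes "0 \<le> Re s" "0 \<le> x"
  shows "norm (exp (- s * of_real x)) \<le> 1"
  using assms by simp

lemma norm_exp_diff_le:
  assumes "r \<le> Re a" "r \<le> Re b" "0 \<le> x"
  shows "norm (exp (- a * of_real x) - exp (- b * of_real x)) \<le> x * exp (- (r * x)) * norm (a - b)"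
proof (rule field_differentiable_bound[where S="{s. r \<le> Re s}"
      and f="\<lambda>s. exp (- s * of_real x)" and f'="\<lambda>s. - of_real x * exp (- s * of_real x)"])
  show "convex {s. r \<le> Re s}" by (rule convex_halfspace_Re_ge)
  show "((\<lambda>s. exp (- s * of_real x)) has_field_derivative - of_real x * exp (- z * of_real x))
          (at z within {s. r \<le> Re s})" for z
    by (auto intro!: derivative_eq_intros)
  fix z assume z: "z \<in> {s. r \<le> Re s}"
  have "exp (- (Re z * x)) \<le> exp (- (r * x))" using z assms(3) by (auto intro: mult_right_mono)
  thus "norm (- of_real x * exp (- z * of_real x)) \<le> x * exp (- (r * x))"
    using assms(3) by (simp add: norm_mult mult_left_mono)
qed (use assms in auto)

locale nonneg_measure = finite_measure M for M :: "real measure" +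
  assumes sets_M[simp, measurable_cong]: "sets M = sets borel"
    and nonneg: "AE x in M. 0 \<le> x"
begin

lemma integrable_exp_laplace:
  assumes "0 \<le> Re s"
  shows "integrable M (\<lambda>x. exp (- s * of_real x))"
proof (rule integrable_const_bound[where B=1])
  show "AE x in M. norm (exp (- s * of_real x)) \<le> 1"
    using nonneg by eventually_elim (rule norm_exp_minus_mult_le_one[OF assms])
qed measurable

lemma norm_laplace_le:
  assumes "0 \<le> Re s"
  shows "norm (laplace M s) \<le> measure M (space M)"
proof -
  have "norm (laplace M s) \<le> (LINT x|M. norm (exp (- s * of_real x)))"
    unfolding laplace_def by (rule integral_norm_bound)
  also have "\<dots> \<le> (LINT x|M. 1)"
  proof (rule integral_mono_AE)
    show "AE x in M. norm (exp (- s * of_real x)) \<le> 1"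
      using nonneg by eventually_elim (rule norm_exp_minus_mult_le_one[OF assms])
  qed (use integrable_norm[OF integrable_exp_laplace[OF assms]] in auto)
  finally show ?thesis by simp
qed

lemma laplace_0: "laplace M 0 = of_real (measure M (space M))"
  by (simp add: laplace_def scaleR_conv_of_real)

lemma laplace_cnj: "laplace M (cnj s) = cnj (laplace M s)"
proof -
  have "cnj (laplace M s) = (LINT x|M. cnj (exp (- s * of_real x)))" by (simp add: laplace_def)
  also have "(\<lambda>x. cnj (exp (- s * of_real x))) = (\<lambda>x. exp (- cnj s * of_real x))"
    by (simp add: exp_cnj)
  finally show ?thesis by (simp add: laplace_def)
qed

lemma laplace_real:
  "laplace M (of_real s) = of_real (LINT x|M. exp (- s * x))"
  by (simp add: laplace_def flip: exp_of_real integral_complex_of_real)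

lemma continuous_on_laplace: "continuous_on {s. 0 \<le> Re s} (laplace M)"
  unfolding continuous_on_sequentially comp_def
proof (intro ballI allI impI)
  fix s and X :: "nat \<Rightarrow> complex"
  assume s: "s \<in> {s. 0 \<le> Re s}" and X: "(\<forall>n. X n \<in> {s. 0 \<le> Re s}) \<and> X \<longlonglongrightarrow> s"
  show "(\<lambda>n. laplace M (X n)) \<longlonglongrightarrow> laplace M s"
    unfolding laplace_def
  proof (rule integral_dominated_convergence[where w="\<lambda>_. 1"])
    show "AE x in M. (\<lambda>n. exp (- X n * of_real x)) \<longlonglongrightarrow> exp (- s * of_real x)"
      using X by (auto intro!: tendsto_intros)
    show "AE x in M. norm (exp (- X n * of_real x)) \<le> 1" for n
      using nonneg by eventually_elim (rule norm_exp_minus_mult_le_one, use X in auto)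
  qed auto
qed

lemma holomorphic_on_laplace: "laplace M holomorphic_on {s. 0 < Re s}"
  unfolding holomorphic_on_def field_differentiable_def
proof (intro ballI exI)
  fix s assume "s \<in> {s. 0 < Re s}"
  hence s: "0 < Re s" by simp
  define r where "r = Re s / 2"
  have r: "0 < r" using s by (simp add: r_def)
  define S where "S = {s. r < Re s}"
  have oS: "open S" unfolding S_def by (rule open_halfspace_Re_gt)
  have sS: "s \<in> S" using s by (simp add: S_def r_def)
  have "(laplace M has_field_derivative (LINT x|M. - of_real x * exp (- s * of_real x))) (at s within S)"
    unfolding has_field_derivative_iff tendsto_at_iff_sequentially comp_def
  proof (intro allI impI)
    fix X assume X: "\<forall>n. X n \<in> S - {s}" "X \<longlonglongrightarrow> s"
    have Re: "0 \<le> Re (X n)" for n using X r by (auto simp: S_def intro: order_trans less_imp_le)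
    have eq: "(laplace M (X n) - laplace M s) / (X n - s) =
        (LINT x|M. (exp (- X n * of_real x) - exp (- s * of_real x)) / (X n - s))" for n
      unfolding laplace_def using integrable_exp_laplace[OF Re[of n]] integrable_exp_laplace[of s] s
      by simp
    show "(\<lambda>n. (laplace M (X n) - laplace M s) / (X n - s))
            \<longlonglongrightarrow> (LINT x|M. - of_real x * exp (- s * of_real x))"
      unfolding eq
    proof (rule integral_dominated_convergence[where w="\<lambda>_. 1 / r"])
      show "AE x in M. (\<lambda>n. (exp (- X n * of_real x) - exp (- s * of_real x)) / (X n - s))
              \<longlonglongrightarrow> - of_real x * exp (- s * of_real x)"
      proof (rule AE_I2)
        fix x
        have "((\<lambda>s. exp (- s * complex_of_real x)) has_field_derivative
            - of_real x * exp (- s * of_real x)) (at s within S)"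
          by (auto intro!: derivative_eq_intros)
        with X show "(\<lambda>n. (exp (- X n * of_real x) - exp (- s * of_real x)) / (X n - s))
              \<longlonglongrightarrow> - of_real x * exp (- s * of_real x)"
          unfolding has_field_derivative_iff tendsto_at_iff_sequentially comp_def by blast
      qed
      show "AE x in M. norm ((exp (- X n * of_real x) - exp (- s * of_real x)) / (X n - s)) \<le> 1 / r" for n
        using nonneg
      proof eventually_elim
        fix x :: real assume x: "0 \<le> x"
        have "norm (exp (- X n * of_real x) - exp (- s * of_real x))
            \<le> x * exp (- (r * x)) * norm (X n - s)"
          using X sS by (intro norm_exp_diff_le x) (auto simp: S_def intro: less_imp_le)
        moreover have "x * exp (- (r * x)) \<le> 1 / r"
        proof -
          have "r * x \<le> exp (r * x)" using exp_ge_add_one_self[of "r * x"] by linarith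
          thus ?thesis using r by (simp add: exp_minus field_simps)
        qed
        ultimately have "norm (exp (- X n * of_real x) - exp (- s * of_real x)) \<le> 1 / r * norm (X n - s)"
          by (meson mult_right_mono norm_ge_zero order_trans)
        moreover have "0 < norm (X n - s)" using X by auto
        ultimately show "norm ((exp (- X n * of_real x) - exp (- s * of_real x)) / (X n - s)) \<le> 1 / r"
          by (simp add: norm_divide pos_divide_le_eq)
      qed
    qed (use X in auto)
  qed
  hence "(laplace M has_field_derivative (LINT x|M. - of_real x * exp (- s * of_real x))) (at s)"
    using at_within_open[OF sS oS] by simp
  thus "(laplace M has_field_derivative (LINT x|M. - of_real x * exp (- s * of_real x)))
      (at s within {s. 0 < Re s})" by (rule has_field_derivative_at_within)
qed

lemma laplace_real_pos:
  assumes "0 < measure M (space M)" "0 \<le> s"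
  shows "0 < (LINT x|M. exp (- s * x))"
proof -
  have int: "integrable M (\<lambda>x. exp (- s * x))"
  proof (rule integrable_const_bound[where B=1])
    show "AE x in M. norm (exp (- s * x)) \<le> 1"
      using nonneg by eventually_elim (use assms in auto)
  qed measurable
  have "(LINT x|M. exp (- s * x)) \<noteq> 0"
  proof
    assume "(LINT x|M. exp (- s * x)) = 0"
    hence "AE x in M. exp (- s * x) = 0"
      using integral_nonneg_eq_0_iff_AE[OF int] by auto
    hence "AE x in M. False" by eventually_elim simp
    hence "emeasure M (space M) = 0" by (simp add: eventually_False ae_filter_eq_bot_iff)
    thus False using assms by (simp add: emeasure_eq_measure)
  qed
  moreover have "0 \<le> (LINT x|M. exp (- s * x))" by (intro integral_nonneg_AE) auto
  ultimately show ?thesis by linarith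
qed

end

lemma laplace_unique:
  assumes M: "prob_space M" "nonneg_measure M" and N: "prob_space N" "nonneg_measure N"
    and eq: "\<And>s. 0 < s \<Longrightarrow> laplace M (of_real s) = laplace N (of_real s)"
  shows "M = N"
proof -
  interpret M: prob_space M by fact
  interpret M: nonneg_measure M by fact
  interpret N: prob_space N by fact
  interpret N: nonneg_measure N by fact
  define f where "f s = laplace M s - laplace N s" for s
  have zero: "f s = 0" if "0 < Re s" for s
  proof (rule analytic_continuation[of f "{s. 0 < Re s}" "complex_of_real ` {0<..}" 1])
    show "f holomorphic_on {s. 0 < Re s}" unfolding f_def
      by (intro holomorphic_intros M.holomorphic_on_laplace N.holomorphic_on_laplace)
    show "open {s. 0 < Re s}" by (rule open_halfspace_Re_gt)
    show "connected {s. 0 < Re s}" by (intro convex_connected convex_halfspace_Re_gt)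
    show "1 islimpt complex_of_real ` {0<..}"
      unfolding islimpt_approachable
    proof (intro allI impI)
      fix e :: real assume "0 < e"
      thus "\<exists>x'\<in>complex_of_real ` {0<..}. x' \<noteq> 1 \<and> dist x' 1 < e"
        by (intro bexI[of _ "complex_of_real (1 + e / 2)"] imageI) (auto simp: dist_norm)
    qed
  qed (use eq that in \<open>auto simp: f_def\<close>)
  have cont: "continuous_on {s. 0 \<le> Re s} f" unfolding f_def
    by (intro continuous_intros M.continuous_on_laplace N.continuous_on_laplace)
  have zero': "f s = 0" if s: "0 \<le> Re s" for s
  proof -
    have "(\<lambda>n. f (s + of_real (1 / real (Suc n)))) \<longlonglongrightarrow> f (s + of_real 0)"
    proof (rule continuous_on_tendsto_compose[OF cont])
      have "(\<lambda>n. 1 / real (Suc n)) \<longlonglongrightarrow> 0" using LIMSEQ_inverse_real_of_nat by (simp add: inverse_eq_divide)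
      thus "(\<lambda>n. s + complex_of_real (1 / real (Suc n))) \<longlonglongrightarrow> s + of_real 0"
        by (intro tendsto_intros)
    qed (use s in auto)
    moreover have "f (s + of_real (1 / real (Suc n))) = 0" for n
      by (rule zero) (use s in \<open>simp add: add_nonneg_pos\<close>)
    ultimately have "(\<lambda>n::nat. 0) \<longlonglongrightarrow> f s" by simp
    thus ?thesis by (simp add: LIMSEQ_const_iff)
  qed
  have "char M = char N"
  proof
    fix t
    have "char M t = laplace M (- \<i> * of_real t)" "char N t = laplace N (- \<i> * of_real t)"
      by (simp_all add: char_def laplace_def mult.assoc)
    thus "char M t = char N t" using zero'[of "- \<i> * of_real t"] by (simp add: f_def)
  qed
  moreover have "real_distribution M" "real_distribution N"
    by (auto simp: real_distribution_def real_distribution_axioms_def M.prob_space_axioms N.prob_space_axioms)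
  ultimately show ?thesis by (intro Levy_uniqueness)
qed

lemma integral_pair_mult:
  fixes f :: "'a \<Rightarrow> 'c::{real_normed_field, banach, second_countable_topology}" and g :: "'b \<Rightarrow> 'c"
  assumes "sigma_finite_measure M" "sigma_finite_measure N"
    and f: "integrable M f" and g: "integrable N g"
  shows "integrable (M \<Otimes>\<^sub>M N) (\<lambda>z. f (fst z) * g (snd z))"
    and "(LINT z|(M \<Otimes>\<^sub>M N). f (fst z) * g (snd z)) = (LINT x|M. f x) * (LINT y|N. g y)"
proof -
  interpret M: sigma_finite_measure M by fact
  interpret N: sigma_finite_measure N by fact
  interpret P: pair_sigma_finite M N by unfold_locales
  note [measurable] = borel_measurable_integrable[OF f] borel_measurable_integrable[OF g]
  show int: "integrable (M \<Otimes>\<^sub>M N) (\<lambda>z. f (fst z) * g (snd z))"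
  proof (rule P.Fubini_integrable)
    show "integrable M (\<lambda>x. LINT y|N. norm (f (fst (x, y)) * g (snd (x, y))))"
      using f g by (simp add: norm_mult)
    show "AE x in M. integrable N (\<lambda>y. f (fst (x, y)) * g (snd (x, y)))"
      using g by simp
  qed measurable
  show "(LINT z|(M \<Otimes>\<^sub>M N). f (fst z) * g (snd z)) = (LINT x|M. f x) * (LINT y|N. g y)"
    using P.integral_fst'[OF int] by simp
qed

lemma laplace_convolution:
  assumes "nonneg_measure M" "nonneg_measure N" "0 \<le> Re s"
  shows "laplace (M \<star> N) s = laplace M s * laplace N s"
proof -
  interpret M: nonneg_measure M by fact
  interpret N: nonneg_measure N by fact
  have "laplace (M \<star> N) s = (LINT z|(M \<Otimes>\<^sub>M N). exp (- s * of_real (fst z)) * exp (- s * of_real (snd z)))"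
    unfolding laplace_def convolution_def
    by (subst integral_distr) (auto simp: case_prod_beta algebra_simps exp_add[symmetric])
  also have "\<dots> = laplace M s * laplace N s"
    unfolding laplace_def
    by (intro integral_pair_mult M.integrable_exp_laplace N.integrable_exp_laplace
      M.sigma_finite_measure_axioms N.sigma_finite_measure_axioms assms(3))
  finally show ?thesis .
qed

lemma nonneg_measure_convolution:
  assumes "prob_space M" "nonneg_measure M" "prob_space N" "nonneg_measure N"
  shows "prob_space (M \<star> N)" "nonneg_measure (M \<star> N)"
proof -
  interpret M: prob_space M by fact
  interpret M: nonneg_measure M by fact
  interpret N: prob_space N by fact
  interpret N: nonneg_measure N by fact
  interpret P: pair_prob_space M N by unfold_locales
  show *: "prob_space (M \<star> N)"
    unfolding convolution_def by (rule P.prob_space_distr) measurable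
  interpret C: prob_space "M \<star> N" by fact
  have "AE z in M \<Otimes>\<^sub>M N. 0 \<le> fst z + snd z"
  proof (rule P.AE_pair_measure)
    show "AE x in M. AE y in N. 0 \<le> fst (x, y) + snd (x, y)"
      using M.nonneg
    proof eventually_elim
      fix x :: real assume "0 \<le> x"
      show "AE y in N. 0 \<le> fst (x, y) + snd (x, y)"
        using N.nonneg by eventually_elim (use \<open>0 \<le> x\<close> in auto)
    qed
  qed measurable
  hence "AE x in M \<star> N. 0 \<le> x"
    unfolding convolution_def by (subst AE_distr_iff) (auto simp: case_prod_beta)
  thus "nonneg_measure (M \<star> N)" by unfold_locales auto
qed

section \<open>Laplace exponents and their inverses\<close>

definition exp_quotient :: "complex \<Rightarrow> real \<Rightarrow> complex" where
  "exp_quotient s x = (if s = 0 then of_real x else (1 - exp (- s * of_real x)) / s)"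

lemma isCont_exp_quotient: "isCont (\<lambda>s. exp_quotient s x) s"
proof (cases "s = 0")
  case True
  have "((\<lambda>s::complex. - exp (- s * of_real x)) has_field_derivative of_real x) (at 0)"
    by (auto intro!: derivative_eq_intros)
  hence "((\<lambda>y. (- exp (- y * of_real x) + 1) / y) \<longlongrightarrow> complex_of_real x) (at 0)"
    by (simp add: has_field_derivative_iff)
  hence "((\<lambda>s. exp_quotient s x) \<longlongrightarrow> of_real x) (at 0)"
    by (rule Lim_transform_eventually) (auto simp: exp_quotient_def eventually_at_filter)
  thus ?thesis using True by (simp add: isCont_def exp_quotient_def)
next
  case False
  have "continuous_on (- {0}) (\<lambda>s::complex. (1 - exp (- s * of_real x)) / s)"
    by (intro continuous_intros) auto
  hence "continuous_on (- {0}) (\<lambda>s. exp_quotient s x)"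
    by (rule continuous_on_eq) (auto simp: exp_quotient_def)
  thus ?thesis using False by (simp add: continuous_on_eq_continuous_at[OF open_Compl[OF closed_singleton]])
qed

locale queue_input =
  fixes c lam :: real and F :: "real measure"
  assumes c_pos: "0 < c" and lam_pos: "0 < lam"
    and prob_F: "prob_space F" and sets_F: "sets F = sets borel"
    and F_pos: "emeasure F {0<..} = 1" and F_int: "integrable F (\<lambda>x. x)"
    and mean_pos: "0 < cp_mean c lam F"

sublocale queue_input \<subseteq> F: prob_space F by (rule prob_F)

sublocale queue_input \<subseteq> F: nonneg_measure F
proof
  show "sets F = sets borel" by (rule sets_F)
  have "F.prob {0<..} = 1" using F_pos by (simp add: F.emeasure_eq_measure)
  hence "AE x in F. x \<in> {0<..}" by (rule F.AE_prob_1)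
  thus "AE x in F. 0 \<le> x" by eventually_elim simp
qed

context queue_input
begin

abbreviation "m \<equiv> (LINT x|F. x)"
abbreviation "\<mu> \<equiv> cp_mean c lam F"

lemma F_positive: "AE x in F. 0 < x"
proof -
  have "F.prob {0<..} = 1" using F_pos by (simp add: F.emeasure_eq_measure)
  hence "AE x in F. x \<in> {0<..}" by (rule F.AE_prob_1)
  thus ?thesis by eventually_elim simp
qed

lemma m_nonneg: "0 \<le> m" using F.nonneg by (rule integral_nonneg_AE)

lemma mu_eq: "\<mu> = c - lam * m" by (simp add: cp_mean_def)

definition \<psi> :: "complex \<Rightarrow> complex" where
  "\<psi> s = of_real c * s - of_real lam * (1 - laplace F s)"

definition \<kappa> :: "complex \<Rightarrow> complex" where
  "\<kappa> s = (LINT x|F. exp_quotient s x)"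

definition \<Psi> :: "complex \<Rightarrow> complex" where
  "\<Psi> s = of_real c - of_real lam * \<kappa> s"

lemma laplace_F_0: "laplace F 0 = 1"
  using F.laplace_0 by (simp add: F.prob_space)

lemma laplace_F_diff_le:
  assumes "0 \<le> Re a" "0 \<le> Re b"
  shows "norm (laplace F a - laplace F b) \<le> m * norm (a - b)"
proof -
  have "laplace F a - laplace F b = (LINT x|F. exp (- a * of_real x) - exp (- b * of_real x))"
    unfolding laplace_def using assms F.integrable_exp_laplace by (subst Bochner_Integration.integral_diff) auto
  also have "norm \<dots> \<le> (LINT x|F. norm (exp (- a * of_real x) - exp (- b * of_real x)))"
    by (rule integral_norm_bound)
  also have "\<dots> \<le> (LINT x|F. x * norm (a - b))"
  proof (rule integral_mono_AE)
    show "integrable F (\<lambda>x. norm (exp (- a * of_real x) - exp (- b * of_real x)))"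
      using assms by (intro integrable_norm Bochner_Integration.integrable_diff F.integrable_exp_laplace)
    show "AE x in F. norm (exp (- a * of_real x) - exp (- b * of_real x)) \<le> x * norm (a - b)"
      using F.nonneg by eventually_elim (use norm_exp_diff_le[of 0 a b] assms in simp)
  qed (use F_int in auto)
  finally show ?thesis by simp
qed

lemma psi_diff_ge:
  assumes "0 \<le> Re a" "0 \<le> Re b"
  shows "\<mu> * norm (a - b) \<le> norm (\<psi> a - \<psi> b)"
proof -
  have eq: "\<psi> a - \<psi> b = of_real c * (a - b) + of_real lam * (laplace F a - laplace F b)"
    by (simp add: \<psi>_def algebra_simps)
  have "norm (of_real lam * (laplace F a - laplace F b)) \<le> lam * (m * norm (a - b))"
    using laplace_F_diff_le[OF assms] lam_pos by (simp add: norm_mult)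
  moreover have "norm (of_real c * (a - b)) = c * norm (a - b)"
    using c_pos by (simp add: norm_mult)
  ultimately have "c * norm (a - b) - lam * (m * norm (a - b)) \<le> norm (\<psi> a - \<psi> b)"
    unfolding eq using norm_diff_ineq[of "of_real c * (a - b)" "of_real lam * (laplace F a - laplace F b)"]
    by linarith
  thus ?thesis by (simp add: mu_eq algebra_simps)
qed

lemma psi_inj: "0 \<le> Re a \<Longrightarrow> 0 \<le> Re b \<Longrightarrow> \<psi> a = \<psi> b \<Longrightarrow> a = b"
  using psi_diff_ge[of a b] mean_pos by (auto simp: mult_le_0_iff)

lemma psi_0: "\<psi> 0 = 0" by (simp add: \<psi>_def laplace_F_0)

lemma psi_cnj: "\<psi> (cnj s) = cnj (\<psi> s)"
  by (simp add: \<psi>_def F.laplace_cnj)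

lemma Re_laplace_F_le_1: "0 \<le> Re s \<Longrightarrow> Re (laplace F s) \<le> 1"
  using F.norm_laplace_le[of s] complex_Re_le_cmod[of "laplace F s"] by (simp add: F.prob_space)

lemma norm_kappa_integrand:
  assumes "0 \<le> Re s" "0 \<le> x"
  shows "norm (exp_quotient s x) \<le> x"
  using norm_exp_diff_le[of 0 s 0 x] assms
  by (auto simp: exp_quotient_def norm_divide pos_divide_le_eq norm_minus_commute)

lemma measurable_kappa_integrand[measurable]:
  "(\<lambda>x. exp_quotient s x) \<in> borel_measurable borel"
  unfolding exp_quotient_def by (cases "s = 0") auto

lemma integrable_kappa_integrand:
  assumes "0 \<le> Re s"
  shows "integrable F (\<lambda>x. exp_quotient s x)"
proof (rule Bochner_Integration.integrable_bound[OF F_int])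
  show "AE x in F. norm (exp_quotient s x) \<le> norm x"
    using F.nonneg by eventually_elim (use norm_kappa_integrand[OF assms] in auto)
qed measurable

lemma norm_kappa_le:
  assumes "0 \<le> Re s"
  shows "norm (\<kappa> s) \<le> m"
proof -
  have "norm (\<kappa> s) \<le> (LINT x|F. norm (exp_quotient s x))"
    unfolding \<kappa>_def by (rule integral_norm_bound)
  also have "\<dots> \<le> m"
  proof (rule integral_mono_AE)
    show "AE x in F. norm (exp_quotient s x) \<le> x"
      using F.nonneg by eventually_elim (use norm_kappa_integrand[OF assms] in auto)
  qed (intro integrable_norm integrable_kappa_integrand assms F_int)+
  finally show ?thesis .
qed

lemma kappa_0: "\<kappa> 0 = of_real m"
  by (simp add: \<kappa>_def exp_quotient_def)

lemma Psi_0: "\<Psi> 0 = of_real \<mu>"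
  by (simp add: \<Psi>_def kappa_0 mu_eq)

lemma psi_eq_Psi:
  assumes "0 \<le> Re s"
  shows "\<psi> s = s * \<Psi> s"
proof (cases "s = 0")
  case False
  have "\<kappa> s = (LINT x|F. (1 - exp (- s * of_real x)) / s)" using False by (simp add: \<kappa>_def exp_quotient_def)
  also have "\<dots> = (1 - laplace F s) / s"
    unfolding laplace_def using F.integrable_exp_laplace[OF assms] by (simp add: F.prob_space)
  finally have "s * \<kappa> s = 1 - laplace F s" using False by simp
  hence "of_real lam * (1 - laplace F s) = of_real lam * (s * \<kappa> s)" by simp
  thus ?thesis by (simp only: \<psi>_def \<Psi>_def) (simp add: algebra_simps)
qed (simp add: psi_0)

lemma continuous_on_Psi: "continuous_on {s. 0 \<le> Re s} \<Psi>"
proof -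
  have "continuous_on {s. 0 \<le> Re s} \<kappa>"
    unfolding continuous_on_sequentially comp_def
  proof (intro ballI allI impI)
    fix s and X :: "nat \<Rightarrow> complex"
    assume s: "s \<in> {s. 0 \<le> Re s}" and X: "(\<forall>n. X n \<in> {s. 0 \<le> Re s}) \<and> X \<longlonglongrightarrow> s"
    show "(\<lambda>n. \<kappa> (X n)) \<longlonglongrightarrow> \<kappa> s"
      unfolding \<kappa>_def
    proof (rule integral_dominated_convergence[where w="\<lambda>x. x"])
      show "AE x in F. (\<lambda>n. exp_quotient (X n) x)
          \<longlonglongrightarrow> (exp_quotient s x)"
        by (rule AE_I2, rule isCont_tendsto_compose[OF isCont_exp_quotient]) (use X in auto)
      show "AE x in F. norm (exp_quotient (X n) x) \<le> x" for n
        using F.nonneg by eventually_elim (rule norm_kappa_integrand, use X in auto)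
    qed (use F_int in auto)
  qed
  thus ?thesis unfolding \<Psi>_def by (intro continuous_intros)
qed

lemma norm_Psi_ge:
  assumes "0 \<le> Re s"
  shows "\<mu> \<le> norm (\<Psi> s)"
proof -
  have "norm (of_real lam * \<kappa> s) \<le> lam * m"
    using norm_kappa_le[OF assms] lam_pos by (simp add: norm_mult)
  thus ?thesis unfolding \<Psi>_def mu_eq
    using norm_triangle_ineq2[of "of_real c" "of_real lam * \<kappa> s"] c_pos by simp
qed

lemma Psi_nonzero: "0 \<le> Re s \<Longrightarrow> \<Psi> s \<noteq> 0"
  using norm_Psi_ge[of s] mean_pos by auto

lemma norm_Psi_le:
  assumes "0 \<le> Re s"
  shows "norm (\<Psi> s) \<le> c + lam * m"
proof -
  have "norm (of_real lam * \<kappa> s) \<le> lam * m"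
    using norm_kappa_le[OF assms] lam_pos by (simp add: norm_mult)
  thus ?thesis unfolding \<Psi>_def
    using norm_triangle_ineq4[of "of_real c" "of_real lam * \<kappa> s"] c_pos by simp
qed

lemma psi_of_real_pos:
  assumes "0 < s"
  obtains q where "0 < q" "\<psi> (of_real s) = of_real q"
proof
  define q where "q = c * s - lam * (1 - (LINT x|F. exp (- s * x)))"
  show eq: "\<psi> (of_real s) = of_real q"
    by (simp add: \<psi>_def q_def F.laplace_real[of s, simplified])
  have "norm (laplace F (of_real s) - laplace F 0) \<le> m * norm (complex_of_real s - 0)"
    by (rule laplace_F_diff_le) (use assms in auto)
  hence "norm (complex_of_real ((LINT x|F. exp (- s * x)) - 1)) \<le> m * norm (complex_of_real s)"
    by (simp only: laplace_F_0 F.laplace_real of_real_diff of_real_1 diff_zero)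
  hence "1 - (LINT x|F. exp (- s * x)) \<le> m * s"
    using abs_of_pos[OF assms] by (simp only: norm_of_real abs_le_iff minus_diff_eq)
  hence "lam * (1 - (LINT x|F. exp (- s * x))) \<le> lam * (m * s)"
    using lam_pos by simp
  moreover have "0 < (c - lam * m) * s" using mean_pos assms by (simp add: mu_eq)
  ultimately show "0 < q" by (simp add: q_def algebra_simps)
qed

lemma ex1_psi_inverse:
  assumes q: "0 \<le> Re q"
  shows "\<exists>!s. 0 \<le> Re s \<and> \<psi> s = q"
proof -
  define T where "T s = (q + of_real lam * (1 - laplace F s)) / of_real c" for s
  have "\<exists>!s\<in>{s. 0 \<le> Re s}. T s = s"
  proof (rule Banach_fix[OF iffD2[OF complete_eq_closed closed_halfspace_Re_ge], where c="lam * m / c"])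
    show "{s. 0 \<le> Re s} \<noteq> {}" by (auto intro: exI[of _ 0])
    show "0 \<le> lam * m / c" using lam_pos m_nonneg c_pos by simp
    show "lam * m / c < 1" using mean_pos c_pos by (simp add: mu_eq)
    show "T ` {s. 0 \<le> Re s} \<subseteq> {s. 0 \<le> Re s}"
    proof clarify
      fix s assume s: "0 \<le> Re s"
      have "0 \<le> Re (q + of_real lam * (1 - laplace F s))"
        using q lam_pos Re_laplace_F_le_1[OF s] by simp
      thus "0 \<le> Re (T s)" using c_pos by (simp add: T_def)
    qed
    fix a b assume ab: "a \<in> {s. 0 \<le> Re s}" "b \<in> {s. 0 \<le> Re s}"
    have "T a - T b = of_real lam * (laplace F b - laplace F a) / of_real c"
      using c_pos by (simp add: T_def field_simps)
    hence "norm (T a - T b) = lam * norm (laplace F a - laplace F b) / c"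
      using c_pos lam_pos by (simp add: norm_mult norm_divide norm_minus_commute)
    also have "\<dots> \<le> lam * (m * norm (a - b)) / c"
      using laplace_F_diff_le[of a b] ab lam_pos c_pos by (intro divide_right_mono mult_left_mono) auto
    finally show "dist (T a) (T b) \<le> lam * m / c * dist a b" by (simp add: dist_norm)
  qed
  moreover have "T s = s \<longleftrightarrow> \<psi> s = q" for s
    using c_pos by (auto simp: T_def \<psi>_def field_simps)
  ultimately show ?thesis by simp
qed

definition \<Phi> :: "complex \<Rightarrow> complex" where
  "\<Phi> q = (THE s. 0 \<le> Re s \<and> \<psi> s = q)"

lemma Phi:
  assumes "0 \<le> Re q"
  shows Re_Phi: "0 \<le> Re (\<Phi> q)" and psi_Phi: "\<psi> (\<Phi> q) = q"
  using theI'[OF ex1_psi_inverse[OF assms]] by (auto simp: \<Phi>_def)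

lemma Phi_eqI: "0 \<le> Re s \<Longrightarrow> \<psi> s = q \<Longrightarrow> 0 \<le> Re q \<Longrightarrow> \<Phi> q = s"
  using psi_inj[of "\<Phi> q" s] Phi[of q] by auto

lemma Phi_0: "\<Phi> 0 = 0" by (rule Phi_eqI) (auto simp: psi_0)

lemma Phi_nonzero: "0 \<le> Re q \<Longrightarrow> q \<noteq> 0 \<Longrightarrow> \<Phi> q \<noteq> 0"
  using psi_Phi[of q] psi_0 by auto

lemma Psi_Phi: "0 \<le> Re q \<Longrightarrow> q \<noteq> 0 \<Longrightarrow> \<Psi> (\<Phi> q) = q / \<Phi> q"
  using psi_eq_Psi[OF Re_Phi] psi_Phi Phi_nonzero by (simp add: field_simps)

lemma Phi_mult_Psi: "0 \<le> Re q \<Longrightarrow> \<Phi> q * \<Psi> (\<Phi> q) = q"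
  using psi_eq_Psi[OF Re_Phi] psi_Phi by simp

lemma Re_Phi_pos:
  assumes "0 < Re q"
  shows "0 < Re (\<Phi> q)"
proof -
  have "Re q = c * Re (\<Phi> q) - lam * (1 - Re (laplace F (\<Phi> q)))"
    using arg_cong[OF psi_Phi[of q], of Re] assms by (simp add: \<psi>_def)
  moreover have "0 \<le> lam * (1 - Re (laplace F (\<Phi> q)))"
    using Re_laplace_F_le_1[OF Re_Phi] assms lam_pos by simp
  ultimately have "0 < c * Re (\<Phi> q)" using assms by linarith
  thus ?thesis using c_pos by (simp add: zero_less_mult_iff)
qed

lemma continuous_on_Phi: "continuous_on {q. 0 \<le> Re q} \<Phi>"
proof (rule lipschitz_on_continuous_on)
  show "(1 / \<mu>)-lipschitz_on {q. 0 \<le> Re q} \<Phi>"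
  proof (rule lipschitz_onI)
    fix p q assume "p \<in> {q. 0 \<le> Re q}" "q \<in> {q. 0 \<le> Re q}"
    thus "dist (\<Phi> p) (\<Phi> q) \<le> 1 / \<mu> * dist p q"
      using psi_diff_ge[of "\<Phi> p" "\<Phi> q"] Phi[of p] Phi[of q] mean_pos
      by (simp add: dist_norm field_simps)
  qed (use mean_pos in auto)
qed

lemma holomorphic_on_psi: "\<psi> holomorphic_on {s. 0 < Re s}"
  unfolding \<psi>_def by (intro holomorphic_intros F.holomorphic_on_laplace)

lemma holomorphic_on_Phi: "\<Phi> holomorphic_on {q. 0 < Re q}"
  unfolding holomorphic_on_open[OF open_halfspace_Re_gt]
proof (intro ballI)
  fix q assume "q \<in> {q. 0 < Re q}"
  hence q: "0 < Re q" by simp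
  obtain D where D: "(\<psi> has_field_derivative D) (at (\<Phi> q))"
    using holomorphic_on_psi Re_Phi_pos[OF q] unfolding holomorphic_on_open[OF open_halfspace_Re_gt] by auto
  have "\<mu> \<le> norm D"
  proof (rule tendsto_lowerbound)
    show "((\<lambda>s. norm ((\<psi> s - \<psi> (\<Phi> q)) / (s - \<Phi> q))) \<longlongrightarrow> norm D) (at (\<Phi> q))"
      using D by (intro tendsto_norm) (simp add: has_field_derivative_iff)
    have "eventually (\<lambda>s. s \<in> {s. 0 < Re s}) (at (\<Phi> q))"
      by (rule eventually_at_in_open') (use Re_Phi_pos[OF q] in \<open>auto intro: open_halfspace_Re_gt\<close>)
    moreover have "eventually (\<lambda>s. s \<noteq> \<Phi> q) (at (\<Phi> q))" by (simp add: eventually_at_filter)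
    ultimately show "eventually (\<lambda>s. \<mu> \<le> norm ((\<psi> s - \<psi> (\<Phi> q)) / (s - \<Phi> q))) (at (\<Phi> q))"
      by eventually_elim (use psi_diff_ge[of _ "\<Phi> q"] Re_Phi_pos[OF q] in
        \<open>simp add: norm_divide pos_le_divide_eq\<close>)
  qed simp
  hence "D \<noteq> 0" using mean_pos by auto
  have "(\<Phi> has_field_derivative inverse D) (at q)"
  proof (rule has_field_derivative_inverse_basic[where f=\<psi> and t="{q. 0 < Re q}"])
    show "isCont \<Phi> q"
    proof -
      have "continuous_on {q. 0 < Re q} \<Phi>" by (rule continuous_on_subset[OF continuous_on_Phi]) auto
      thus ?thesis using q by (simp add: continuous_on_eq_continuous_at[OF open_halfspace_Re_gt])
    qed
  qed (use q psi_Phi D \<open>D \<noteq> 0\<close> open_halfspace_Re_gt in auto)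
  thus "\<exists>f'. (\<Phi> has_field_derivative f') (at q)" by blast
qed

lemma holomorphic_on_Psi_Phi: "(\<lambda>q. \<Psi> (\<Phi> q)) holomorphic_on {q. 0 < Re q}"
proof (rule holomorphic_transform)
  show "(\<lambda>q. q / \<Phi> q) holomorphic_on {q. 0 < Re q}"
    using holomorphic_on_Phi Re_Phi_pos by (intro holomorphic_intros) fastforce+
  show "q / \<Phi> q = \<Psi> (\<Phi> q)" if "q \<in> {q. 0 < Re q}" for q
    using Psi_Phi[of q] that by force
qed

lemma continuous_on_Psi_Phi: "continuous_on {q. 0 \<le> Re q} (\<lambda>q. \<Psi> (\<Phi> q))"
  by (rule continuous_on_compose2[OF continuous_on_Psi continuous_on_Phi]) (use Re_Phi in auto)

lemma Phi_cnj: "0 \<le> Re q \<Longrightarrow> \<Phi> (cnj q) = cnj (\<Phi> q)"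
  by (rule Phi_eqI) (auto simp: Re_Phi psi_cnj psi_Phi)

lemma Phi_real_pos:
  assumes "0 < q"
  obtains s where "0 < s" "\<Phi> (of_real q) = of_real s"
proof -
  have "\<Phi> (of_real q) = cnj (\<Phi> (of_real q))" using Phi_cnj[of "of_real q"] assms by simp
  hence "\<Phi> (of_real q) = of_real (Re (\<Phi> (of_real q)))" by (simp add: complex_eq_iff)
  thus ?thesis using that Re_Phi_pos[of "of_real q"] assms by simp
qed

lemma Im_Phi_pos:
  assumes y: "0 < y"
  shows "0 < Im (\<Phi> (\<i> * of_real y))"
proof -
  define s where "s = \<Phi> (\<i> * of_real y)"
  have s: "0 \<le> Re s" "\<psi> s = \<i> * of_real y" using Phi[of "\<i> * of_real y"] by (auto simp: s_def)
  define r where "r = complex_of_real (Re s)"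
  have "Im (laplace F r) = 0" by (simp add: r_def F.laplace_real)
  hence "\<bar>Im (laplace F s)\<bar> \<le> norm (laplace F s - laplace F r)"
    using abs_Im_le_cmod[of "laplace F s - laplace F r"] by simp
  also have "\<dots> \<le> m * norm (s - r)" by (rule laplace_F_diff_le) (use s in \<open>auto simp: r_def\<close>)
  also have "norm (s - r) = \<bar>Im s\<bar>"
  proof -
    have "s - r = \<i> * of_real (Im s)" by (simp add: r_def complex_eq_iff)
    thus ?thesis by (simp add: norm_mult)
  qed
  finally have "lam * \<bar>Im (laplace F s)\<bar> \<le> lam * (m * \<bar>Im s\<bar>)" using lam_pos by simp
  moreover have "y = c * Im s + lam * Im (laplace F s)"
    using arg_cong[OF s(2), of Im] by (simp add: \<psi>_def)
  moreover have "lam * Im (laplace F s) \<le> lam * \<bar>Im (laplace F s)\<bar>" using lam_pos by simp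
  ultimately have *: "y \<le> c * Im s + lam * m * \<bar>Im s\<bar>" by linarith
  show ?thesis
  proof (rule ccontr)
    assume "\<not> ?thesis"
    hence "Im s \<le> 0" by (simp add: s_def)
    hence "y \<le> (c - lam * m) * Im s" using * by (simp add: algebra_simps)
    also have "\<dots> \<le> 0" using \<open>Im s \<le> 0\<close> mean_pos by (simp add: mu_eq mult_nonneg_nonpos)
    finally show False using y by simp
  qed
qed

end

section \<open>Uniqueness in the Wiener-Hopf problem\<close>

lemma Im_contour_integral_vertical:
  assumes cont: "continuous_on {q. 0 \<le> Re q} H"
  defines "p \<equiv> \<lambda>x. \<i> * complex_of_real x"
  shows "Im (contour_integral (linepath (p x) (p y)) H) =
           (y - x) * integral {0..1} (\<lambda>t. Re (H (p (x + t * (y - x)))))"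
proof -
  have lp: "linepath (p x) (p y) t = p (x + t * (y - x))" for t
    by (simp add: linepath_def p_def scaleR_conv_of_real algebra_simps)
  have seg: "closed_segment (p x) (p y) \<subseteq> {q. 0 \<le> Re q}"
    by (rule closed_segment_subset) (auto simp: p_def convex_halfspace_Re_ge)
  have "(H has_contour_integral contour_integral (linepath (p x) (p y)) H) (linepath (p x) (p y))"
    by (intro has_contour_integral_integral contour_integrable_continuous_linepath
      continuous_on_subset[OF cont seg])
  hence "((\<lambda>t. H (p (x + t * (y - x))) * (p y - p x)) has_integral
      contour_integral (linepath (p x) (p y)) H) {0..1}"
    by (simp add: has_contour_integral_linepath lp)
  from has_integral_linear[OF this bounded_linear_Im]
  have 1: "((\<lambda>t. Re (H (p (x + t * (y - x)))) * (y - x)) has_integral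
      Im (contour_integral (linepath (p x) (p y)) H)) {0..1}"
    by (simp add: o_def p_def)
  have "continuous_on {0..1} (\<lambda>t. Re (H (p (x + t * (y - x)))))"
    by (intro continuous_intros continuous_on_compose2[OF cont]) (auto simp: p_def intro!: continuous_intros)
  hence "((\<lambda>t. Re (H (p (x + t * (y - x))))) has_integral
      integral {0..1} (\<lambda>t. Re (H (p (x + t * (y - x)))))) {0..1}"
    by (intro integrable_integral integrable_continuous_real)
  from has_integral_mult_left[OF this, of "y - x"] 1 show ?thesis
    by (metis has_integral_unique mult.commute)
qed

lemma Re_zero_on_imaginary_axis:
  assumes cont: "continuous_on {q. 0 \<le> Re q} H"
    and fin: "finite S"
    and diff: "\<And>q. 0 < Re q \<Longrightarrow> q \<notin> S \<Longrightarrow> H field_differentiable (at q)"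
    and decay: "\<And>q. 0 \<le> Re q \<Longrightarrow> R0 \<le> norm q \<Longrightarrow> norm (H q) \<le> C / (norm q)\<^sup>2"
    and pos: "\<And>y. 0 \<le> Re (H (\<i> * of_real y))"
  shows "Re (H (\<i> * of_real y)) = 0"
proof -
  define p where "p x = \<i> * complex_of_real x" for x
  define J where "J x y = Im (contour_integral (linepath (p x) (p y)) H)" for x y
  have J: "J x y = (y - x) * integral {0..1} (\<lambda>t. Re (H (p (x + t * (y - x)))))" for x y
    unfolding J_def p_def by (rule Im_contour_integral_vertical[OF cont])
  have posp: "0 \<le> Re (H (p x))" for x using pos by (simp add: p_def)
  have cu: "continuous_on {0..1} (\<lambda>t. Re (H (p (x + t * (y - x)))))" for x y
    by (intro continuous_intros continuous_on_compose2[OF cont]) (auto simp: p_def intro!: continuous_intros)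
  have Jpos: "0 \<le> J x y" if "x \<le> y" for x y
    unfolding J using that
    by (intro mult_nonneg_nonneg Henstock_Kurzweil_Integration.integral_nonneg
      integrable_continuous_real cu posp) auto
  have cseg: "continuous_on (closed_segment (p x) (p y)) H" for x y
    by (rule continuous_on_subset[OF cont], rule closed_segment_subset)
      (auto simp: p_def convex_halfspace_Re_ge)
  have split: "J x z = J x y + J y z" if "x \<le> y" "y \<le> z" for x y z
  proof -
    have "y \<in> closed_segment x z" using that by (simp add: closed_segment_eq_real_ivl)
    then obtain u where "0 \<le> u" "u \<le> 1" "y = (1 - u) * x + u * z"
      by (auto simp: in_segment)
    hence "p y \<in> closed_segment (p x) (p z)"
      unfolding in_segment by (intro exI[of _ u]) (simp add: p_def complex_eq_iff)
    from contour_integral_split_linepath[OF cseg this] show ?thesis by (simp add: J_def)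
  qed
  have up: "J (- R) R \<le> 8 * \<bar>C\<bar> / R" if R: "0 < R" "2 * R0 \<le> R" for R
  proof -
    let ?a = "p (- R)" and ?b = "p R" and ?c = "complex_of_real R"
    have hull: "convex hull {?a, ?b, ?c} \<subseteq> {q. 0 \<le> Re q}"
      using R by (intro hull_minimal) (auto simp: p_def convex_halfspace_Re_ge)
    have "(H has_contour_integral 0) (linepath ?a ?b +++ linepath ?b ?c +++ linepath ?c ?a)"
    proof (rule Cauchy_theorem_triangle_cofinite[OF continuous_on_subset[OF cont hull] fin])
      fix q assume q: "q \<in> interior (convex hull {?a, ?b, ?c}) - S"
      obtain e where e: "0 < e" "ball q e \<subseteq> {q. 0 \<le> Re q}"
        using q hull mem_interior[of q "convex hull {?a, ?b, ?c}"] by (meson DiffD1 order_trans)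
      have "q - of_real (e / 2) \<in> ball q e" using e by (simp add: dist_norm)
      hence "0 \<le> Re (q - of_real (e / 2))" using e(2) by blast
      hence "0 < Re q" using e(1) by simp
      thus "H field_differentiable (at q)" using diff q by auto
    qed
    moreover have cs: "continuous_on (closed_segment ?a ?b) H" "continuous_on (closed_segment ?b ?c) H"
      "continuous_on (closed_segment ?c ?a) H"
      by (rule continuous_on_subset[OF cont], rule closed_segment_subset,
        use R in \<open>auto simp: p_def convex_halfspace_Re_ge\<close>)+
    ultimately have sum: "contour_integral (linepath ?a ?b) H =
        - contour_integral (linepath ?b ?c) H - contour_integral (linepath ?c ?a) H"
      by (drule_tac contour_integral_unique)
        (simp add: contour_integral_join contour_integrable_continuous_linepath
          contour_integrable_joinI valid_path_join algebra_simps add_eq_0_iff)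
    have side: "norm (contour_integral (linepath u v) H) \<le> 4 * \<bar>C\<bar> / R"
      if uv: "\<And>q. q \<in> closed_segment u v \<Longrightarrow> 0 \<le> Re q \<and> R = Re q + \<bar>Im q\<bar>" "norm (v - u) \<le> 2 * R"
        and c: "continuous_on (closed_segment u v) H" for u v
    proof -
      have "norm (contour_integral (linepath u v) H) \<le> (2 * \<bar>C\<bar> / R\<^sup>2) * norm (v - u)"
      proof (rule has_contour_integral_bound_linepath[OF has_contour_integral_integral
            [OF contour_integrable_continuous_linepath[OF c]]])
        fix q assume q: "q \<in> closed_segment u v"
        have Req: "0 \<le> Re q" "R = Re q + \<bar>Im q\<bar>" using uv(1)[OF q] by auto
        have "R\<^sup>2 \<le> 2 * (norm q)\<^sup>2"
          unfolding Req(2) cmod_power2 using sum_squares_bound[of "Re q" "\<bar>Im q\<bar>"]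
          by (simp add: power2_eq_square algebra_simps)
        moreover have "R \<le> 2 * norm q"
          unfolding Req(2) using abs_Re_le_cmod[of q] abs_Im_le_cmod[of q] Req(1) by linarith
        ultimately have n: "R0 \<le> norm q" "0 < norm q" "R\<^sup>2 / 2 \<le> (norm q)\<^sup>2" using R by auto
        have "norm (H q) \<le> C / (norm q)\<^sup>2" using decay n Req by auto
        also have "\<dots> \<le> \<bar>C\<bar> / (norm q)\<^sup>2" by (intro divide_right_mono) auto
        also have "\<dots> \<le> \<bar>C\<bar> / (R\<^sup>2 / 2)" using n R by (intro divide_left_mono) auto
        finally show "norm (H q) \<le> 2 * \<bar>C\<bar> / R\<^sup>2" by (simp add: mult.commute)
      qed simp
      also have "\<dots> \<le> (2 * \<bar>C\<bar> / R\<^sup>2) * (2 * R)" using uv(2) by (intro mult_left_mono) auto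
      also have "\<dots> = 4 * \<bar>C\<bar> / R" using R by (simp add: power2_eq_square)
      finally show ?thesis .
    qed
    have "norm (contour_integral (linepath ?b ?c) H) \<le> 4 * \<bar>C\<bar> / R"
    proof (rule side[OF _ _ cs(2)])
      fix q assume "q \<in> closed_segment ?b ?c"
      then obtain u where u: "0 \<le> u" "u \<le> 1" "q = (1 - u) *\<^sub>R ?b + u *\<^sub>R ?c" by (auto simp: in_segment)
      have nn: "0 \<le> u * R" "0 \<le> (1 - u) * R" "u * R + (1 - u) * R = R"
        using u(1,2) R(1) by (simp_all add: algebra_simps)
      have "Re q = u * R" "Im q = (1 - u) * R" by (simp_all add: u(3) p_def)
      thus "0 \<le> Re q \<and> R = Re q + \<bar>Im q\<bar>" using nn by linarith
    next
      have "norm (?c - ?b) \<le> norm ?c + norm ?b" by (rule norm_triangle_ineq4)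
      thus "norm (?c - ?b) \<le> 2 * R" using R by (simp add: p_def norm_mult)
    qed
    moreover have "norm (contour_integral (linepath ?c ?a) H) \<le> 4 * \<bar>C\<bar> / R"
    proof (rule side[OF _ _ cs(3)])
      fix q assume "q \<in> closed_segment ?c ?a"
      then obtain u where u: "0 \<le> u" "u \<le> 1" "q = (1 - u) *\<^sub>R ?c + u *\<^sub>R ?a" by (auto simp: in_segment)
      have nn: "0 \<le> u * R" "0 \<le> (1 - u) * R" "u * R + (1 - u) * R = R"
        using u(1,2) R(1) by (simp_all add: algebra_simps)
      have "Re q = (1 - u) * R" "Im q = - (u * R)" by (simp_all add: u(3) p_def)
      thus "0 \<le> Re q \<and> R = Re q + \<bar>Im q\<bar>" using nn by linarith
    next
      have "norm (?a - ?c) \<le> norm ?a + norm ?c" by (rule norm_triangle_ineq4)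
      thus "norm (?a - ?c) \<le> 2 * R" using R by (simp add: p_def norm_mult)
    qed
    ultimately have "norm (contour_integral (linepath ?a ?b) H) \<le> 8 * \<bar>C\<bar> / R"
      unfolding sum using norm_triangle_ineq4[of "- contour_integral (linepath ?b ?c) H"
          "contour_integral (linepath ?c ?a) H"] by simp
    thus ?thesis unfolding J_def using abs_Im_le_cmod[of "contour_integral (linepath ?a ?b) H"] by linarith
  qed
  define a where "a = \<bar>y\<bar> + 1"
  have a: "0 < a" by (simp add: a_def)
  have "J (- a) a \<le> 0"
  proof (rule field_le_epsilon)
    fix e :: real assume e: "0 < e"
    define R where "R = Max {a, 2 * R0, 8 * \<bar>C\<bar> / e}"
    have R: "a \<le> R" "2 * R0 \<le> R" "8 * \<bar>C\<bar> / e \<le> R" by (auto simp: R_def)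
    have "J (- R) R = J (- R) (- a) + (J (- a) a + J a R)"
      using split[of "- R" "- a" R] split[of "- a" a R] R a by auto
    hence "J (- a) a \<le> J (- R) R" using Jpos[of "- R" "- a"] Jpos[of a R] R by auto
    also have "\<dots> \<le> 8 * \<bar>C\<bar> / R" using up[of R] R a by auto
    also have "\<dots> \<le> e" using R e a by (simp add: field_simps)
    finally show "J (- a) a \<le> 0 + e" by simp
  qed
  hence "integral {0..1} (\<lambda>t. Re (H (p (- a + t * (a - - a))))) \<le> 0"
    using a by (simp add: J mult_le_0_iff)
  moreover have "0 \<le> integral {0..1} (\<lambda>t. Re (H (p (- a + t * (a - - a)))))"
    by (intro Henstock_Kurzweil_Integration.integral_nonneg integrable_continuous_real cu posp)
  ultimately have "integral {0..1} (\<lambda>t. Re (H (p (- a + t * (a - - a))))) = 0" by simp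
  hence "\<forall>t\<in>{0..1}. Re (H (p (- a + t * (a - - a)))) = 0"
    using posp by (subst (asm) integral_eq_0_iff[OF cu]) auto
  moreover have "(y + a) / (2 * a) \<in> {0..1}" using a by (auto simp: a_def field_simps)
  moreover have "- a + (y + a) / (2 * a) * (a - - a) = y" using a by (simp add: field_simps)
  ultimately show ?thesis unfolding p_def by metis
qed

lemma zero_if_zero_on_imaginary_axis:
  assumes hol: "f holomorphic_on {q. 0 < Re q}" and cont: "continuous_on {q. 0 \<le> Re q} f"
    and zero: "\<And>y. f (\<i> * of_real y) = 0" and q: "0 \<le> Re q"
  shows "f q = 0"
proof -
  define g where "g q = (if 0 \<le> Re q then f q else 0)" for q
  have cg: "continuous_on ({q. 0 \<le> Re q} \<union> {q. Re q \<le> 0}) g"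
    unfolding g_def
  proof (rule continuous_on_cases[OF closed_halfspace_Re_ge closed_halfspace_Re_le cont continuous_on_const])
    have "f x = 0" if "Re x = 0" for x
    proof -
      have "x = \<i> * of_real (Im x)" using that by (simp add: complex_eq_iff)
      thus ?thesis using zero by metis
    qed
    thus "\<forall>x. x \<in> {q. 0 \<le> Re q} \<and> \<not> 0 \<le> Re x \<or> x \<in> {q. Re q \<le> 0} \<and> 0 \<le> Re x \<longrightarrow> f x = 0" by auto
  qed
  moreover have "{q. 0 \<le> Re q} \<union> {q. Re q \<le> 0} = UNIV" by auto
  ultimately have cg: "continuous_on UNIV g" by simp
  have hg: "g holomorphic_on UNIV"
  proof (rule holomorphic_on_paste_across_line[of UNIV 1 g 0])
    have "g holomorphic_on {q. Re q < 0}"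
      by (rule holomorphic_transform[of "\<lambda>_. 0"]) (auto simp: g_def)
    thus "g holomorphic_on UNIV \<inter> {z. 1 \<bullet> z < 0}" by (simp add: inner_complex_def)
    have "g holomorphic_on {q. 0 < Re q}"
      by (rule holomorphic_transform[OF hol]) (auto simp: g_def)
    thus "g holomorphic_on UNIV \<inter> {z. 0 < 1 \<bullet> z}" by (simp add: inner_complex_def)
  qed (use cg in auto)
  have "g q = 0"
  proof (rule analytic_continuation[OF hg open_UNIV connected_UNIV, of "{q. Re q < 0}" "-1"])
    show "(-1) islimpt {q. Re q < 0}"
      by (rule interior_limit_point) (simp add: interior_open open_halfspace_Re_lt)
  qed (auto simp: g_def)
  thus ?thesis using q by (simp add: g_def)
qed

lemma energy_form_pos:
  fixes s1 s2 e1 e2 :: real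
  assumes r: "0 \<le> \<rho>1" "0 \<le> \<rho>2" "\<rho>1 * \<rho>2 < 1" and e: "0 < e1" "0 < e2"
  shows "0 < \<rho>2 * (s1\<^sup>2 + e1\<^sup>2) * e1 + (s1\<^sup>2 + e1\<^sup>2) * e2 + \<rho>1 * (s2\<^sup>2 + e2\<^sup>2) * e1
             - \<rho>1 * \<rho>2 * ((s1\<^sup>2 - e1\<^sup>2) * e2 + 2 * s1 * e1 * s2)"
proof -
  have r0: "0 \<le> \<rho>1 * \<rho>2" using r by simp
  have "0 < e2 * ((1 - \<rho>1 * \<rho>2) * s1\<^sup>2 + (1 + \<rho>1 * \<rho>2) * e1\<^sup>2)"
  proof -
    have "0 \<le> (1 - \<rho>1 * \<rho>2) * s1\<^sup>2" "0 < (1 + \<rho>1 * \<rho>2) * e1\<^sup>2"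
      using r e r0 by (simp_all add: add_pos_nonneg)
    thus ?thesis using e by simp
  qed
  moreover have "0 \<le> e1 * (\<rho>1 * (s2 - \<rho>2 * s1)\<^sup>2 + \<rho>2 * s1\<^sup>2 * (1 - \<rho>1 * \<rho>2))"
    using r e by (intro mult_nonneg_nonneg add_nonneg_nonneg) auto
  moreover have "0 \<le> e1 * (\<rho>2 * e1\<^sup>2 + \<rho>1 * e2\<^sup>2)"
    using r e by (intro mult_nonneg_nonneg add_nonneg_nonneg) auto
  ultimately have "0 < e2 * ((1 - \<rho>1 * \<rho>2) * s1\<^sup>2 + (1 + \<rho>1 * \<rho>2) * e1\<^sup>2)
      + e1 * (\<rho>1 * (s2 - \<rho>2 * s1)\<^sup>2 + \<rho>2 * s1\<^sup>2 * (1 - \<rho>1 * \<rho>2)) + e1 * (\<rho>2 * e1\<^sup>2 + \<rho>1 * e2\<^sup>2)"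
    by linarith
  thus ?thesis by (simp add: power2_eq_square algebra_simps)
qed

lemma energy_positive:
  fixes z1 z2 a b :: complex
  assumes r: "0 \<le> \<rho>1" "0 \<le> \<rho>2" "\<rho>1 * \<rho>2 < 1" and e: "0 < Im z1" "0 < Im z2"
    and eq: "(of_real \<rho>2 * z1 - cnj z2) * a = (z1 - of_real \<rho>1 * cnj z2) * b" and b: "b \<noteq> 0"
  shows "0 < Re (\<i> / z1 * a * cnj b)"
proof -
  define d where "d = of_real \<rho>2 * z1 - cnj z2"
  define n where "n = z1 - of_real \<rho>1 * cnj z2"
  have "0 < Im d" using r e by (simp add: d_def add_nonneg_pos)
  hence d0: "d \<noteq> 0" by auto
  have z0: "z1 \<noteq> 0" using e by auto
  have N: "0 < (norm d)\<^sup>2" "0 < (norm z1)\<^sup>2" "0 < (norm b)\<^sup>2" using d0 z0 b by auto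
  have "a = n * b / d" using eq d0 by (simp add: d_def n_def field_simps)
  hence "\<i> / z1 * a * cnj b = \<i> * n * (b * cnj b) / (d * z1)" by (simp add: mult_ac)
  also have "\<dots> = \<i> * n * (b * cnj b) * (cnj d * cnj z1) / ((d * cnj d) * (z1 * cnj z1))"
    using d0 z0 by (simp add: field_simps)
  also have "\<dots> = \<i> * n * of_real ((norm b)\<^sup>2) * (cnj d * cnj z1)
      / (of_real ((norm d)\<^sup>2) * of_real ((norm z1)\<^sup>2))"
    by (simp only: complex_norm_square)
  also have "\<dots> = (\<i> * n * cnj d * cnj z1) * of_real ((norm b)\<^sup>2 / ((norm d)\<^sup>2 * (norm z1)\<^sup>2))"
    by (simp add: mult_ac)
  finally have "Re (\<i> / z1 * a * cnj b) =
      Re (\<i> * n * cnj d * cnj z1) * ((norm b)\<^sup>2 / ((norm d)\<^sup>2 * (norm z1)\<^sup>2))"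
    by (simp only: Re_complex_of_real Im_complex_of_real times_complex.simps mult_zero_right diff_zero)
  moreover have "Re (\<i> * n * cnj d * cnj z1) =
      \<rho>2 * ((Re z1)\<^sup>2 + (Im z1)\<^sup>2) * Im z1 + ((Re z1)\<^sup>2 + (Im z1)\<^sup>2) * Im z2
      + \<rho>1 * ((Re z2)\<^sup>2 + (Im z2)\<^sup>2) * Im z1
      - \<rho>1 * \<rho>2 * (((Re z1)\<^sup>2 - (Im z1)\<^sup>2) * Im z2 + 2 * Re z1 * Im z1 * Re z2)"
    by (simp add: n_def d_def power2_eq_square algebra_simps)
  ultimately show ?thesis using energy_form_pos[OF r e, of "Re z1" "Re z2"] N by simp
qed

locale coupled_queues =
  Q1: queue_input c1 lam1 F1 + Q2: queue_input c2 lam2 F2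
  for c1 lam1 :: real and F1 :: "real measure" and c2 lam2 :: real and F2 :: "real measure"
begin

lemma wiener_hopf_trivial:
  assumes r: "0 \<le> \<rho>1" "0 \<le> \<rho>2" "\<rho>1 * \<rho>2 < 1"
    and hol: "A holomorphic_on {q. 0 < Re q}" "B holomorphic_on {q. 0 < Re q}"
    and cont: "continuous_on {q. 0 \<le> Re q} A" "continuous_on {q. 0 \<le> Re q} B"
    and bdd: "\<And>q. 0 \<le> Re q \<Longrightarrow> norm (A q) \<le> CA" "\<And>q. 0 \<le> Re q \<Longrightarrow> norm (B q) \<le> CB"
    and eq: "\<And>q. Re q = 0 \<Longrightarrow> (of_real \<rho>2 * Q1.\<Phi> q - cnj (Q2.\<Phi> q)) * A q =
                 (Q1.\<Phi> q - of_real \<rho>1 * cnj (Q2.\<Phi> q)) * cnj (B q)"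
    and A1: "A 1 = 0" and q: "0 \<le> Re q"
  shows "A q = 0"
proof -
  define D where "D q = (if q = 1 then deriv A 1 else A q / (q - 1))" for q
  define H where "H q = - (Q1.\<Psi> (Q1.\<Phi> q) * D q * B q / (1 + q))" for q
  have n1: "1 + q \<noteq> 0" if "0 \<le> Re q" for q :: complex
    using that by (metis add_nonneg_eq_0_iff one_complex.simps(1) plus_complex.simps(1) zero_complex.simps(1)
        zero_le_one zero_neq_one)
  have dA: "(A has_field_derivative deriv A 1) (at 1)"
    using hol(1) by (intro holomorphic_derivI[OF _ open_halfspace_Re_gt[of 0]]) auto
  have contD: "continuous_on {q. 0 \<le> Re q} D"
    unfolding continuous_on_eq_continuous_within
  proof
    fix x :: complex assume x: "x \<in> {q. 0 \<le> Re q}"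
    show "continuous (at x within {q. 0 \<le> Re q}) D"
    proof (cases "x = 1")
      case True
      have "((\<lambda>y. (A y - A 1) / (y - 1)) \<longlongrightarrow> deriv A 1) (at 1)"
        using dA by (simp add: has_field_derivative_iff)
      hence "(D \<longlongrightarrow> deriv A 1) (at 1)"
        by (rule Lim_transform_eventually) (auto simp: D_def A1 eventually_at_filter)
      hence "isCont D 1" by (simp add: isCont_def D_def)
      thus ?thesis using True by (simp add: continuous_at_imp_continuous_at_within)
    next
      case False
      have *: "continuous (at x within {q. 0 \<le> Re q}) (\<lambda>q. A q / (q - 1))"
        using cont(1) x False
        by (intro continuous_intros) (auto simp: continuous_on_eq_continuous_within)
      show ?thesis
        by (rule continuous_transform_within[OF *, of "dist x 1"]) (use x False in \<open>auto simp: D_def dist_commute\<close>)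
    qed
  qed
  have contH: "continuous_on {q. 0 \<le> Re q} H"
    unfolding H_def using n1
    by (intro continuous_intros contD cont Q1.continuous_on_Psi_Phi) auto
  have diffH: "H field_differentiable (at q)" if "0 < Re q" "q \<notin> {1}" for q
  proof -
    have o: "open ({q. 0 < Re q} - {1})" by (intro open_delete open_halfspace_Re_gt)
    have "D holomorphic_on ({q. 0 < Re q} - {1})"
      by (rule holomorphic_transform[of "\<lambda>q. A q / (q - 1)"])
        (auto simp: D_def intro!: holomorphic_intros intro: holomorphic_on_subset[OF hol(1)])
    hence "H holomorphic_on ({q. 0 < Re q} - {1})"
      unfolding H_def using n1
      by (intro holomorphic_intros holomorphic_on_subset[OF Q1.holomorphic_on_Psi_Phi]
        holomorphic_on_subset[OF hol(2)]) auto
    thus ?thesis using that o by (auto simp: holomorphic_on_def at_within_open[OF _ o])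
  qed
  define C where "C = (c1 + lam1 * Q1.m) * CA * CB * 4"
  have decay: "norm (H q) \<le> C / (norm q)\<^sup>2" if q: "0 \<le> Re q" "2 \<le> norm q" for q
  proof -
    have q1: "q \<noteq> 1" using q by auto
    have g: "norm (Q1.\<Psi> (Q1.\<Phi> q)) \<le> c1 + lam1 * Q1.m" using Q1.norm_Psi_le Q1.Re_Phi q by auto
    have "norm q \<le> norm (q - 1) + 1" using norm_triangle_ineq[of "q - 1" 1] by simp
    hence l1: "norm q / 2 \<le> norm (q - 1)" using q by linarith
    have "norm q \<le> norm (1 + q) + 1" using norm_triangle_ineq4[of "1 + q" 1] by simp
    hence l2: "norm q / 2 \<le> norm (1 + q)" using q by linarith
    have "(norm q / 2) * (norm q / 2) \<le> norm (q - 1) * norm (1 + q)"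
      using l1 l2 by (intro mult_mono) auto
    hence l: "(norm q)\<^sup>2 / 4 \<le> norm (q - 1) * norm (1 + q)" by (simp add: power2_eq_square)
    have "norm (H q) = norm (Q1.\<Psi> (Q1.\<Phi> q)) * norm (A q) * norm (B q) / (norm (q - 1) * norm (1 + q))"
      using q1 by (simp add: H_def D_def norm_mult norm_divide)
    also have "\<dots> \<le> (c1 + lam1 * Q1.m) * CA * CB / ((norm q)\<^sup>2 / 4)"
    proof (rule frac_le)
      have "0 \<le> c1 + lam1 * Q1.m" "0 \<le> CA"
        using g bdd(1)[OF q(1)] norm_ge_zero order_trans by blast+
      thus "norm (Q1.\<Psi> (Q1.\<Phi> q)) * norm (A q) * norm (B q) \<le> (c1 + lam1 * Q1.m) * CA * CB"
        using g bdd q by (intro mult_mono) auto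
      have "0 \<le> CB" using bdd(2)[OF q(1)] norm_ge_zero order_trans by blast
      thus "0 \<le> (c1 + lam1 * Q1.m) * CA * CB" using \<open>0 \<le> c1 + lam1 * Q1.m\<close> \<open>0 \<le> CA\<close> by simp
      have "norm q \<noteq> 0" using q by auto
      thus "0 < (norm q)\<^sup>2 / 4" by simp
    qed (use l in auto)
    also have "\<dots> = C / (norm q)\<^sup>2" by (simp add: C_def)
    finally show ?thesis .
  qed
  have strict: "0 < Re (H (\<i> * of_real y))" if y: "y \<noteq> 0" and B: "B (\<i> * of_real y) \<noteq> 0" for y :: real
  proof -
    define q where "q = \<i> * complex_of_real y"
    have q: "Re q = 0" "q \<noteq> 0" "q \<noteq> 1" using y by (auto simp: q_def complex_eq_iff)
    have den: "(q - 1) * (1 + q) = - of_real (1 + y\<^sup>2)" by (simp add: q_def algebra_simps power2_eq_square)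
    have "H q = - (q / Q1.\<Phi> q * A q * B q / ((q - 1) * (1 + q)))"
      using q Q1.Psi_Phi[of q] by (simp add: H_def D_def)
    also have "\<dots> = \<i> * of_real y / Q1.\<Phi> q * A q * cnj (cnj (B q)) * of_real (1 / (1 + y\<^sup>2))"
      unfolding den minus_divide_right[symmetric] minus_minus by (simp add: q_def)
    also have "\<dots> = (\<i> / Q1.\<Phi> q * A q * cnj (cnj (B q))) * of_real (y / (1 + y\<^sup>2))"
      by (simp add: field_simps)
    finally have H: "Re (H q) = Re (\<i> / Q1.\<Phi> q * A q * cnj (cnj (B q))) * (y / (1 + y\<^sup>2))"
      by (simp only: Re_complex_of_real Im_complex_of_real times_complex.simps mult_zero_right diff_zero)
    have y2: "0 < 1 + y\<^sup>2" by (simp add: add_pos_nonneg)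
    show ?thesis
    proof (cases "0 < y")
      case True
      have "0 < Re (\<i> / Q1.\<Phi> q * A q * cnj (cnj (B q)))"
        by (rule energy_positive[OF r _ _ eq[OF q(1)]])
          (use True B Q1.Im_Phi_pos Q2.Im_Phi_pos in \<open>auto simp: q_def\<close>)
      thus ?thesis using True H y2 by (simp add: q_def)
    next
      case False
      hence ny: "0 < - y" using y by simp
      have cq: "cnj q = \<i> * of_real (- y)" by (simp add: q_def)
      have P: "0 < Im (cnj (Q1.\<Phi> q))" "0 < Im (cnj (Q2.\<Phi> q))"
        using Q1.Im_Phi_pos[OF ny] Q2.Im_Phi_pos[OF ny] Q1.Phi_cnj[of q] Q2.Phi_cnj[of q] q
        unfolding cq[symmetric] by auto
      have eq': "(of_real \<rho>2 * cnj (Q1.\<Phi> q) - cnj (cnj (Q2.\<Phi> q))) * cnj (A q) =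
          (cnj (Q1.\<Phi> q) - of_real \<rho>1 * cnj (cnj (Q2.\<Phi> q))) * B q"
        using arg_cong[OF eq[OF q(1)], of cnj] by simp
      have "0 < Re (\<i> / cnj (Q1.\<Phi> q) * cnj (A q) * cnj (B q))"
        by (rule energy_positive[OF r P eq']) (use B in \<open>simp add: q_def\<close>)
      also have "\<i> / cnj (Q1.\<Phi> q) * cnj (A q) * cnj (B q) = - cnj (\<i> / Q1.\<Phi> q * A q * cnj (cnj (B q)))"
        by simp
      finally have "Re (\<i> / Q1.\<Phi> q * A q * cnj (cnj (B q))) < 0"
        by (simp only: uminus_complex.simps complex_cnj neg_0_less_iff_less cnj.simps)
      moreover have "y / (1 + y\<^sup>2) < 0" using ny y2 by (simp add: divide_neg_pos)
      ultimately show ?thesis unfolding q_def[symmetric] H by (rule mult_neg_neg)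
    qed
  qed
  have nonneg_off: "0 \<le> Re (H (\<i> * of_real y))" if "y \<noteq> 0" for y :: real
    using strict[OF that] by (cases "B (\<i> * of_real y) = 0") (auto simp: H_def)
  have nonneg: "0 \<le> Re (H (\<i> * of_real y))" for y :: real
  proof (cases "y = 0")
    case True
    have lim: "(\<lambda>n. Re (H (\<i> * of_real (1 / real (Suc n))))) \<longlonglongrightarrow> Re (H (\<i> * of_real 0))"
    proof (intro tendsto_Re continuous_on_tendsto_compose[OF contH])
      have "(\<lambda>n. 1 / real (Suc n)) \<longlonglongrightarrow> 0" using LIMSEQ_inverse_real_of_nat by (simp add: inverse_eq_divide)
      thus "(\<lambda>n. \<i> * complex_of_real (1 / real (Suc n))) \<longlonglongrightarrow> \<i> * of_real 0" by (intro tendsto_intros)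
    qed auto
    have "0 \<le> Re (H (\<i> * of_real (1 / real (Suc n))))" for n by (rule nonneg_off) simp
    hence "0 \<le> Re (H (\<i> * of_real 0))" by (intro LIMSEQ_le_const[OF lim]) blast
    thus ?thesis using True by simp
  qed (rule nonneg_off)
  have Hz: "Re (H (\<i> * of_real y)) = 0" for y
    by (rule Re_zero_on_imaginary_axis[OF contH, of "{1}" 2 C]) (use diffH decay nonneg in auto)
  have A_off: "A (\<i> * of_real y) = 0" if y: "y \<noteq> 0" for y :: real
  proof -
    define q where "q = \<i> * complex_of_real y"
    have q: "Re q = 0" by (simp add: q_def)
    have "B q = 0" using strict[OF y] Hz[of y] by (auto simp: q_def)
    hence e: "(of_real \<rho>2 * Q1.\<Phi> q - cnj (Q2.\<Phi> q)) * A q = 0" using eq[OF q] by simp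
    have "Im (of_real \<rho>2 * Q1.\<Phi> q - cnj (Q2.\<Phi> q)) \<noteq> 0"
    proof (cases "0 < y")
      case True
      thus ?thesis using Q1.Im_Phi_pos[OF True] Q2.Im_Phi_pos[OF True] r
        by (simp add: q_def add_nonneg_eq_0_iff)
    next
      case False
      hence ny: "0 < - y" using y by simp
      have cq: "cnj q = \<i> * of_real (- y)" by (simp add: q_def)
      have P: "Im (Q1.\<Phi> q) < 0" "Im (Q2.\<Phi> q) < 0"
        using Q1.Im_Phi_pos[OF ny] Q2.Im_Phi_pos[OF ny] Q1.Phi_cnj[of q] Q2.Phi_cnj[of q] q
        unfolding cq[symmetric] by auto
      have "\<rho>2 * Im (Q1.\<Phi> q) \<le> 0" using P r by (simp add: mult_nonneg_nonpos)
      thus ?thesis using P by simp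
    qed
    hence "of_real \<rho>2 * Q1.\<Phi> q - cnj (Q2.\<Phi> q) \<noteq> 0" by (metis zero_complex.simps(2))
    thus ?thesis using e by (simp add: q_def)
  qed
  have A0: "A (\<i> * of_real y) = 0" for y :: real
  proof (cases "y = 0")
    case True
    have "(\<lambda>n. A (\<i> * of_real (1 / real (Suc n)))) \<longlonglongrightarrow> A (\<i> * of_real 0)"
    proof (intro continuous_on_tendsto_compose[OF cont(1)])
      have "(\<lambda>n. 1 / real (Suc n)) \<longlonglongrightarrow> 0" using LIMSEQ_inverse_real_of_nat by (simp add: inverse_eq_divide)
      thus "(\<lambda>n. \<i> * complex_of_real (1 / real (Suc n))) \<longlonglongrightarrow> \<i> * of_real 0" by (intro tendsto_intros)
    qed auto
    moreover have "A (\<i> * of_real (1 / real (Suc n))) = 0" for n by (rule A_off) simp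
    ultimately have "(\<lambda>n::nat. 0) \<longlonglongrightarrow> A (\<i> * of_real 0)" by simp
    thus ?thesis using True by (simp add: LIMSEQ_const_iff)
  qed (rule A_off)
  show ?thesis by (rule zero_if_zero_on_imaginary_axis[OF hol(1) cont(1) A0 q])
qed

end

section \<open>The driving noise\<close>

lemma AE_pair_fst:
  assumes "prob_space N" "AE x in M. P x"
  shows "AE z in M \<Otimes>\<^sub>M N. P (fst z)"
proof -
  interpret N: prob_space N by fact
  show ?thesis
  proof (rule AE_distrD[of fst "M \<Otimes>\<^sub>M N" M])
    show "AE x in distr (M \<Otimes>\<^sub>M N) M fst. P x" unfolding N.distr_pair_fst by fact
  qed measurable
qed

lemma AE_pair_snd:
  assumes "prob_space M" "sigma_finite_measure N" "AE x in N. P x"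
  shows "AE z in M \<Otimes>\<^sub>M N. P (snd z)"
proof -
  interpret M: prob_space M by fact
  interpret N: sigma_finite_measure N by fact
  from assms(3) obtain S where S: "{x \<in> space N. \<not> P x} \<subseteq> S" "emeasure N S = 0" "S \<in> sets N"
    by (rule AE_E)
  show ?thesis
  proof (rule AE_I[of _ _ "space M \<times> S"])
    show "{z \<in> space (M \<Otimes>\<^sub>M N). \<not> P (snd z)} \<subseteq> space M \<times> S"
      using S by (auto simp: space_pair_measure)
    show "emeasure (M \<Otimes>\<^sub>M N) (space M \<times> S) = 0"
      using S by (simp add: N.emeasure_pair_measure_Times)
  qed (use S in auto)
qed

definition good_noise :: "(nat \<Rightarrow> real \<times> real) \<Rightarrow> bool" where
  "good_noise \<omega> \<longleftrightarrow> (\<forall>k. 0 < fst (\<omega> k) \<and> 0 < snd (\<omega> k)) \<and> (\<forall>t. finite {k. arrival_time \<omega> k \<le> t})"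

lemma arrival_time_mono:
  assumes "\<And>k. 0 < fst (\<omega> k)" "j \<le> k"
  shows "arrival_time \<omega> j \<le> arrival_time \<omega> k"
  unfolding arrival_time_def using assms by (intro sum_mono2) (auto intro: less_imp_le)

lemma finite_arrivals:
  assumes pos: "\<And>k. 0 < fst (\<omega> k)" and inf: "\<And>n. \<exists>k\<ge>n. 1 < fst (\<omega> k)"
  shows "finite {k. arrival_time \<omega> k \<le> t}"
proof (rule ccontr)
  assume I: "infinite {k. arrival_time \<omega> k \<le> t}"
  have "arrival_time \<omega> k \<le> t" for k
  proof -
    obtain j where "k \<le> j" "arrival_time \<omega> j \<le> t"
      using I unfolding infinite_nat_iff_unbounded_le by blast
    thus ?thesis using arrival_time_mono[of \<omega> k j] pos by simp
  qed
  hence "summable (\<lambda>k. fst (\<omega> k))"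
    using pos by (intro bounded_imp_summable[where B=t]) (auto simp: arrival_time_def intro: less_imp_le)
  hence "(\<lambda>k. fst (\<omega> k)) \<longlonglongrightarrow> 0" by (rule summable_LIMSEQ_zero)
  hence "eventually (\<lambda>k. fst (\<omega> k) < 1) sequentially" by (rule order_tendstoD) simp
  then obtain n where "\<And>k. n \<le> k \<Longrightarrow> fst (\<omega> k) < 1" by (auto simp: eventually_sequentially)
  with inf[of n] show False by force
qed

lemma cp_path_0: "good_noise \<omega> \<Longrightarrow> cp_path c \<omega> 0 = 0"
proof -
  assume g: "good_noise \<omega>"
  have "0 < arrival_time \<omega> k" for k
    unfolding arrival_time_def using g by (intro sum_pos) (auto simp: good_noise_def)
  hence "{k. arrival_time \<omega> k \<le> 0} = {}" by (auto simp: not_le)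
  thus ?thesis by (simp only: cp_path_def) simp
qed

lemma cp_path_upper_lipschitz:
  assumes "good_noise \<omega>" "s \<le> t"
  shows "cp_path c \<omega> t - cp_path c \<omega> s \<le> c * (t - s)"
proof -
  have "(\<Sum>k | arrival_time \<omega> k \<le> s. snd (\<omega> k)) \<le> (\<Sum>k | arrival_time \<omega> k \<le> t. snd (\<omega> k))"
    using assms by (intro sum_mono2) (auto simp: good_noise_def intro: less_imp_le)
  thus ?thesis by (simp add: cp_path_def algebra_simps)
qed

lemma cp_path_no_arrival:
  assumes g: "good_noise \<omega>" and "t < fst (\<omega> 0)"
  shows "cp_path c \<omega> t = c * t"
proof -
  have "t < arrival_time \<omega> k" for k
    using arrival_time_mono[of \<omega> 0 k] assms by (auto simp: good_noise_def arrival_time_def)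
  hence "{k. arrival_time \<omega> k \<le> t} = {}" by (auto simp: not_le)
  thus ?thesis by (simp only: cp_path_def) simp
qed

lemma cp_path_one_arrival:
  assumes g: "good_noise \<omega>" and "fst (\<omega> 0) \<le> t" "t < fst (\<omega> 1)"
  shows "cp_path c \<omega> t = c * t - snd (\<omega> 0)"
proof -
  have "t < arrival_time \<omega> k" if "k \<noteq> 0" for k
  proof -
    have "0 < fst (\<omega> 0)" using g by (simp add: good_noise_def)
    hence "t < arrival_time \<omega> 1" using assms by (simp add: arrival_time_def)
    also have "\<dots> \<le> arrival_time \<omega> k" using g that
      by (intro arrival_time_mono) (auto simp: good_noise_def)
    finally show ?thesis .
  qed
  moreover have "arrival_time \<omega> 0 = fst (\<omega> 0)" by (simp add: arrival_time_def)
  ultimately have "arrival_time \<omega> k \<le> t \<longleftrightarrow> k = 0" for k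
    using assms by (cases "k = 0") (simp_all add: not_le)
  hence "{k. arrival_time \<omega> k \<le> t} = {0}" by simp
  thus ?thesis by (simp only: cp_path_def) simp
qed

definition early :: "real \<Rightarrow> nat \<Rightarrow> (nat \<Rightarrow> real \<times> real) \<Rightarrow> real" where
  "early t k \<omega> = (if fst (\<omega> k) \<le> t then 1 else 0)"

context queue_input
begin

abbreviation "noise \<equiv> cp_noise lam F"
abbreviation "gap \<equiv> density lborel (exponential_density lam)"

lemma prob_space_gap: "prob_space gap"
  by (rule prob_space_exponential_density[OF lam_pos])

lemma prob_space_mark: "prob_space (gap \<Otimes>\<^sub>M F)"
proof -
  interpret G: prob_space gap by (rule prob_space_gap)
  interpret pair_prob_space gap F by unfold_locales
  show ?thesis by unfold_locales
qed

lemma prob_space_noise: "prob_space noise"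
  unfolding cp_noise_def by (intro prob_space_PiM prob_space_mark)

lemma space_F: "space F = UNIV"
  using sets_eq_imp_space_eq[OF sets_F] by simp

lemma space_mark: "space (gap \<Otimes>\<^sub>M F) = UNIV"
  by (simp add: space_pair_measure space_F)

lemma space_noise: "space noise = UNIV"
  by (simp add: cp_noise_def space_PiM space_mark del: space_pair_measure)

lemma sets_mark[measurable_cong]: "sets (gap \<Otimes>\<^sub>M F) = sets (borel \<Otimes>\<^sub>M borel)"
  by (intro sets_pair_measure_cong) (auto simp: sets_F)

lemma measurable_mark[measurable]: "(\<lambda>\<omega>. \<omega> k) \<in> measurable noise (borel \<Otimes>\<^sub>M borel)"
proof -
  have "(\<lambda>\<omega>. \<omega> k) \<in> measurable noise (gap \<Otimes>\<^sub>M F)" unfolding cp_noise_def by measurable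
  thus ?thesis using measurable_cong_sets[OF refl sets_mark] by blast
qed

lemma gap_le:
  assumes "0 \<le> t"
  shows "measure gap {..t} = 1 - exp (- t * lam)"
  using emeasure_erlang_density[OF lam_pos, of 0 t] assms
  by (simp add: erlang_CDF_0 measure_def mult.commute enn2real_ennreal lam_pos less_imp_le)

lemma mark_fst_le:
  assumes "0 \<le> t"
  shows "emeasure (gap \<Otimes>\<^sub>M F) ({..t} \<times> UNIV) = ennreal (1 - exp (- t * lam))"
proof -
  interpret G: prob_space gap by (rule prob_space_gap)
  have "emeasure (gap \<Otimes>\<^sub>M F) ({..t} \<times> space F) = emeasure gap {..t} * emeasure F (space F)"
    by (rule F.emeasure_pair_measure_Times) (auto simp: space_F)
  thus ?thesis using gap_le[OF assms] by (simp add: space_F F.emeasure_space_1[unfolded space_F] G.emeasure_eq_measure)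
qed

lemma noise_first_gaps:
  assumes "finite J" "0 \<le> t"
  shows "emeasure noise {\<omega>. \<forall>k\<in>J. fst (\<omega> k) \<le> t} = ennreal (1 - exp (- t * lam)) ^ card J"
proof -
  have "{\<omega>. \<forall>k\<in>J. fst (\<omega> k) \<le> t} =
      prod_emb UNIV (\<lambda>_. gap \<Otimes>\<^sub>M F) J (\<Pi>\<^sub>E k\<in>J. {..t} \<times> UNIV)"
    by (auto simp: prod_emb_def space_mark PiE_iff restrict_def mem_Times_iff simp del: space_pair_measure)
  hence "emeasure noise {\<omega>. \<forall>k\<in>J. fst (\<omega> k) \<le> t} =
      (\<Prod>k\<in>J. emeasure (gap \<Otimes>\<^sub>M F) ({..t} \<times> UNIV))"
    unfolding cp_noise_def
    by (simp only:) (intro emeasure_PiM_emb prob_space_mark, use assms space_F in \<open>auto simp: sets_mark\<close>)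
  thus ?thesis by (simp add: mark_fst_le[OF assms(2)])
qed

lemma AE_noise_large_gap: "AE \<omega> in noise. \<exists>k\<ge>n. 1 < fst (\<omega> k)"
proof -
  interpret N: prob_space noise by (rule prob_space_noise)
  define B where "B = {\<omega> \<in> space noise. \<forall>k\<ge>n. fst (\<omega> k) \<le> 1}"
  have B[measurable]: "B \<in> sets noise" unfolding B_def by measurable
  define q where "q = 1 - exp (- lam)"
  have q: "0 \<le> q" "q < 1" using lam_pos by (auto simp: q_def)
  have "N.prob B \<le> q ^ j" for j
  proof -
    have "emeasure noise B \<le> emeasure noise {\<omega>. \<forall>k\<in>{n..<n+j}. fst (\<omega> k) \<le> 1}"
    proof (rule emeasure_mono)
      have "{\<omega> \<in> space noise. \<forall>k\<in>{n..<n+j}. fst (\<omega> k) \<le> 1} \<in> sets noise" by measurable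
      thus "{\<omega>. \<forall>k\<in>{n..<n+j}. fst (\<omega> k) \<le> 1} \<in> sets noise" by (simp add: space_noise)
    qed (auto simp: B_def)
    also have "\<dots> = ennreal (q ^ j)"
      using noise_first_gaps[of "{n..<n+j}" 1] q by (simp add: q_def ennreal_power)
    finally show ?thesis using q by (simp add: N.emeasure_eq_measure ennreal_le_iff)
  qed
  moreover have "(\<lambda>j. q ^ j) \<longlonglongrightarrow> 0" using q by (intro LIMSEQ_realpow_zero)
  ultimately have "N.prob B \<le> 0" by (intro LIMSEQ_le_const) auto
  hence "emeasure noise B = 0" by (simp add: N.emeasure_eq_measure measure_le_0_iff)
  thus ?thesis by (intro AE_I[of _ _ B]) (auto simp: B_def not_less)
qed

lemma AE_good_noise: "AE \<omega> in noise. good_noise \<omega>"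
proof -
  interpret G: prob_space gap by (rule prob_space_gap)
  interpret N: prob_space noise by (rule prob_space_noise)
  have "AE x in lborel. 0 < ennreal (exponential_density lam x) \<longrightarrow> 0 < x"
    using AE_lborel_singleton[of "0::real"]
    by eventually_elim (auto simp: exponential_density_def not_less order_less_le)
  hence "AE x in gap. 0 < x" by (subst AE_density) auto
  hence "AE x in gap \<Otimes>\<^sub>M F. 0 < fst x" by (rule AE_pair_fst[OF prob_F])
  moreover have "AE x in gap \<Otimes>\<^sub>M F. 0 < snd x"
    by (rule AE_pair_snd[OF prob_space_gap F.sigma_finite_measure_axioms F_positive])
  ultimately have mark: "AE x in gap \<Otimes>\<^sub>M F. 0 < fst x \<and> 0 < snd x" by eventually_elim simp
  have "AE \<omega> in noise. 0 < fst (\<omega> k) \<and> 0 < snd (\<omega> k)" for k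
    unfolding cp_noise_def by (rule AE_PiM_component[OF prob_space_mark _ mark]) auto
  hence "AE \<omega> in noise. \<forall>k. 0 < fst (\<omega> k) \<and> 0 < snd (\<omega> k)" by (simp add: AE_all_countable)
  moreover have "AE \<omega> in noise. \<forall>n. \<exists>k\<ge>n. 1 < fst (\<omega> k)"
    using AE_noise_large_gap by (simp add: AE_all_countable)
  ultimately show ?thesis
    by eventually_elim (auto simp: good_noise_def intro!: finite_arrivals)
qed

lemma measurable_early[measurable]: "early t k \<in> borel_measurable noise"
  unfolding early_def by measurable

lemma integrable_early: "integrable noise (early t 0)" "integrable noise (\<lambda>\<omega>. early t 0 \<omega> * early t 1 \<omega>)"
proof -
  interpret N: prob_space noise by (rule prob_space_noise)
  show "integrable noise (early t 0)"
    by (rule N.integrable_const_bound[where B=1]) (auto simp: early_def)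
  show "integrable noise (\<lambda>\<omega>. early t 0 \<omega> * early t 1 \<omega>)"
    by (rule N.integrable_const_bound[where B=1]) (auto simp: early_def)
qed

lemma integral_early:
  assumes "0 \<le> t"
  shows "(LINT \<omega>|noise. early t 0 \<omega>) = 1 - exp (- t * lam)"
    and "(LINT \<omega>|noise. early t 0 \<omega> * early t 1 \<omega>) = (1 - exp (- t * lam))\<^sup>2"
proof -
  interpret N: prob_space noise by (rule prob_space_noise)
  have nn: "0 \<le> 1 - exp (- t * lam)" using assms lam_pos by simp
  have ind: "(LINT \<omega>|noise. indicator {\<omega>. \<forall>k\<in>J. fst (\<omega> k) \<le> t} \<omega>) = (1 - exp (- t * lam)) ^ card J"
    if "finite J" for J
  proof -
    have "(LINT \<omega>|noise. indicator {\<omega>. \<forall>k\<in>J. fst (\<omega> k) \<le> t} \<omega>) = N.prob {\<omega>. \<forall>k\<in>J. fst (\<omega> k) \<le> t}"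
      by (simp add: space_noise)
    also have "\<dots> = (1 - exp (- t * lam)) ^ card J"
      using noise_first_gaps[OF that assms] nn
      by (simp only: ennreal_power measure_def) (simp add: enn2real_ennreal)
    finally show ?thesis .
  qed
  have "early t 0 = indicator {\<omega>. \<forall>k\<in>{0}. fst (\<omega> k) \<le> t}"
    by (auto simp: early_def fun_eq_iff indicator_def)
  thus "(LINT \<omega>|noise. early t 0 \<omega>) = 1 - exp (- t * lam)" using ind[of "{0}"] by simp
  have "(\<lambda>\<omega>. early t 0 \<omega> * early t 1 \<omega>) = indicator {\<omega>. \<forall>k\<in>{0, 1}. fst (\<omega> k) \<le> t}"
    by (auto simp: early_def fun_eq_iff indicator_def)
  thus "(LINT \<omega>|noise. early t 0 \<omega> * early t 1 \<omega>) = (1 - exp (- t * lam))\<^sup>2"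
    using ind[of "{0, 1}"] by (simp add: power2_eq_square)
qed

lemma integral_early_jump:
  assumes t: "0 \<le> t" and s: "0 \<le> Re s"
  shows "integrable noise (\<lambda>\<omega>. of_real (early t 0 \<omega>) * (exp (- s * of_real (snd (\<omega> 0))) - 1))" (is ?I)
    and "(LINT \<omega>|noise. of_real (early t 0 \<omega>) * (exp (- s * of_real (snd (\<omega> 0))) - 1)) =
           of_real (1 - exp (- t * lam)) * (laplace F s - 1)" (is ?E)
proof -
  interpret G: prob_space gap by (rule prob_space_gap)
  define h where "h x = (if x \<le> t then 1 else 0 :: complex)" for x :: real
  define g where "g y = exp (- s * of_real y) - 1" for y :: real
  have h_eq: "h = (\<lambda>x. complex_of_real (indicator {..t} x))" by (auto simp: h_def indicator_def)
  have hi: "integrable gap h" unfolding h_eq by (intro integrable_of_real integrable_real_indicator) (auto simp: less_top[symmetric])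
  have gi: "integrable F g" unfolding g_def using F.integrable_exp_laplace[OF s] by auto
  have H: "(LINT x|gap. h x) = of_real (1 - exp (- t * lam))"
  proof -
    have "(LINT x|gap. h x) = of_real (LINT x|gap. indicator {..t} x)" unfolding h_eq by (rule integral_complex_of_real)
    thus ?thesis using gap_le[OF t] by simp
  qed
  have Gi: "(LINT y|F. g y) = laplace F s - 1"
    unfolding g_def laplace_def using F.integrable_exp_laplace[OF s] by (simp add: F.prob_space)
  note P = integral_pair_mult[OF G.sigma_finite_measure_axioms F.sigma_finite_measure_axioms hi gi]
  have D: "distr noise (gap \<Otimes>\<^sub>M F) (\<lambda>\<omega>. \<omega> 0) = gap \<Otimes>\<^sub>M F"
    unfolding cp_noise_def using distr_PiM_component[of UNIV "\<lambda>_. gap \<Otimes>\<^sub>M F" 0] prob_space_mark by simp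
  have m0: "(\<lambda>\<omega>. \<omega> 0) \<in> measurable noise (gap \<Otimes>\<^sub>M F)" unfolding cp_noise_def by measurable
  have eq: "of_real (early t 0 \<omega>) * (exp (- s * of_real (snd (\<omega> 0))) - 1) = h (fst (\<omega> 0)) * g (snd (\<omega> 0))" for \<omega>
    by (simp add: h_def g_def early_def)
  show ?I unfolding eq
    using integrable_distr[OF m0, of "\<lambda>z. h (fst z) * g (snd z)"] P(1) D by simp
  have "(LINT \<omega>|noise. h (fst (\<omega> 0)) * g (snd (\<omega> 0))) = (LINT z|(gap \<Otimes>\<^sub>M F). h (fst z) * g (snd z))"
    using integral_distr[OF m0, of "\<lambda>z. h (fst z) * g (snd z)"] borel_measurable_integrable[OF P(1)] D by simp
  thus ?E unfolding eq using P(2) H Gi by simp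
qed

end

section \<open>The kernel equation of a stationary distribution\<close>

lemma triple_integral:
  fixes h :: "'a \<Rightarrow> 'd::{real_normed_field, banach, second_countable_topology}" and k :: "'b \<Rightarrow> 'd" and l :: "'c \<Rightarrow> 'd"
  assumes "prob_space M" "prob_space N1" "prob_space N2"
    and h: "integrable M h" and k: "integrable N1 k" and l: "integrable N2 l"
  shows "integrable (M \<Otimes>\<^sub>M (N1 \<Otimes>\<^sub>M N2)) (\<lambda>x. h (fst x) * (k (fst (snd x)) * l (snd (snd x))))"
    and "(LINT x|(M \<Otimes>\<^sub>M (N1 \<Otimes>\<^sub>M N2)). h (fst x) * (k (fst (snd x)) * l (snd (snd x)))) =
           (LINT x|M. h x) * ((LINT x|N1. k x) * (LINT x|N2. l x))"
proof -
  interpret M: prob_space M by fact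
  interpret N1: prob_space N1 by fact
  interpret N2: prob_space N2 by fact
  interpret P: pair_prob_space N1 N2 by unfold_locales
  note a = integral_pair_mult[OF N1.sigma_finite_measure_axioms N2.sigma_finite_measure_axioms k l]
  note b = integral_pair_mult[OF M.sigma_finite_measure_axioms P.sigma_finite_measure_axioms h a(1)]
  show "integrable (M \<Otimes>\<^sub>M (N1 \<Otimes>\<^sub>M N2)) (\<lambda>x. h (fst x) * (k (fst (snd x)) * l (snd (snd x))))"
    by (rule b(1))
  show "(LINT x|(M \<Otimes>\<^sub>M (N1 \<Otimes>\<^sub>M N2)). h (fst x) * (k (fst (snd x)) * l (snd (snd x)))) =
           (LINT x|M. h x) * ((LINT x|N1. k x) * (LINT x|N2. l x))"
    unfolding b(2) a(2) ..
qed

definition exp2 :: "complex \<Rightarrow> complex \<Rightarrow> real \<times> real \<Rightarrow> complex" where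
  "exp2 s1 s2 w = exp (- (s1 * of_real (fst w) + s2 * of_real (snd w)))"

lemma measurable_exp2[measurable]: "exp2 s1 s2 \<in> borel_measurable borel"
  unfolding exp2_def borel_prod[symmetric] by measurable

lemma norm_exp2_le_one:
  assumes "0 \<le> Re s1" "0 \<le> Re s2" "0 \<le> fst w" "0 \<le> snd w"
  shows "norm (exp2 s1 s2 w) \<le> 1"
proof -
  have "0 \<le> Re s1 * fst w" "0 \<le> Re s2 * snd w" using assms by auto
  thus ?thesis by (simp add: exp2_def)
qed

lemma exp2_diff_le:
  assumes s: "0 \<le> Re s1" "0 \<le> Re s2" and "0 \<le> fst x" "0 \<le> snd x" "0 \<le> fst y" "0 \<le> snd y"
  shows "norm (exp2 s1 s2 x - exp2 s1 s2 y) \<le> norm s1 * \<bar>fst x - fst y\<bar> + norm s2 * \<bar>snd x - snd y\<bar>"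
proof -
  have "norm (exp2 s1 s2 x - exp2 s1 s2 y) \<le>
      norm ((s1 * of_real (fst x) + s2 * of_real (snd x)) - (s1 * of_real (fst y) + s2 * of_real (snd y)))"
    using norm_exp_diff_le[of 0 "s1 * of_real (fst x) + s2 * of_real (snd x)"
        "s1 * of_real (fst y) + s2 * of_real (snd y)" 1] assms by (simp add: exp2_def)
  also have "(s1 * of_real (fst x) + s2 * of_real (snd x)) - (s1 * of_real (fst y) + s2 * of_real (snd y))
      = s1 * of_real (fst x - fst y) + s2 * of_real (snd x - snd y)" by (simp add: algebra_simps)
  also have "norm \<dots> \<le> norm (s1 * of_real (fst x - fst y)) + norm (s2 * of_real (snd x - snd y))"
    by (rule norm_triangle_ineq)
  also have "\<dots> = norm s1 * \<bar>fst x - fst y\<bar> + norm s2 * \<bar>snd x - snd y\<bar>"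
    by (simp only: norm_mult norm_of_real)
  finally show ?thesis .
qed

lemma norm_exp_minus_linear_le: "norm (exp z - 1 - z) \<le> exp (norm z) * (norm z)\<^sup>2" for z :: complex
  using Taylor_exp_field[of z 1] by (simp add: atMost_Suc algebra_simps power2_eq_square)

locale coupled_model = coupled_queues +
  fixes \<rho>1 \<rho>2 :: real
  assumes rho: "0 \<le> \<rho>1" "0 \<le> \<rho>2" "\<rho>1 * \<rho>2 < 1"
begin

abbreviation "K1 \<equiv> max_rate \<rho>1 \<rho>2 c1 c2"
abbreviation "K2 \<equiv> max_rate \<rho>2 \<rho>1 c2 c1"

definition "g1 w = idle_rate \<rho>1 \<rho>2 c1 c2 w"
definition "g2 w = idle_rate \<rho>2 \<rho>1 c2 c1 (prod.swap w)"
definition "v1 w = c1 - g1 w + \<rho>2 * g2 w"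
definition "v2 w = c2 - g2 w + \<rho>1 * g1 w"

definition drift :: "complex \<Rightarrow> complex \<Rightarrow> real \<times> real \<Rightarrow> complex" where
  "drift s1 s2 w = exp2 s1 s2 w * (s1 * of_real (v1 w) + s2 * of_real (v2 w))"

definition near_boundary :: "real \<Rightarrow> real \<times> real \<Rightarrow> real" where
  "near_boundary t w =
     (if (0 < fst w \<and> fst w \<le> K1 * t) \<or> (0 < snd w \<and> snd w \<le> K2 * t) then 1 else 0)"

lemma K1_eq: "K1 = c1 + \<rho>2 * K2" and K2_eq: "K2 = c2 + \<rho>1 * K1"
  using rho by (auto intro!: max_rate_eq simp: mult.commute)

lemma K_nonneg: "0 \<le> K1" "0 \<le> K2"
  using rho Q1.c_pos Q2.c_pos by (auto intro!: max_rate_nonneg simp: mult.commute)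

lemma c_le_K: "c1 \<le> K1" "c2 \<le> K2"
  using K1_eq K2_eq mult_nonneg_nonneg[OF rho(1) K_nonneg(1)] mult_nonneg_nonneg[OF rho(2) K_nonneg(2)]
  by linarith+

lemma g_bounds: "0 \<le> g1 w" "g1 w \<le> K1" "0 \<le> g2 w" "g2 w \<le> K2"
  using K_nonneg c_le_K Q1.c_pos Q2.c_pos by (auto simp: g1_def g2_def idle_rate_def)

lemma v_bounds: "\<bar>v1 w\<bar> \<le> K1" "\<bar>v2 w\<bar> \<le> K2"
proof -
  have "\<rho>2 * g2 w \<le> \<rho>2 * K2" "\<rho>1 * g1 w \<le> \<rho>1 * K1" "0 \<le> \<rho>2 * g2 w" "0 \<le> \<rho>1 * g1 w"
    using g_bounds[of w] rho by (auto intro: mult_left_mono)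
  thus "\<bar>v1 w\<bar> \<le> K1" "\<bar>v2 w\<bar> \<le> K2"
    unfolding v1_def v2_def abs_le_iff using g_bounds[of w] K1_eq K2_eq Q1.c_pos Q2.c_pos by linarith+
qed

lemma measurable_rates[measurable]:
  "g1 \<in> borel_measurable borel" "g2 \<in> borel_measurable borel"
  unfolding g1_def[abs_def] g2_def[abs_def] idle_rate_def fst_swap snd_swap borel_prod[symmetric] by measurable

lemma measurable_drift[measurable]: "drift s1 s2 \<in> borel_measurable borel"
  unfolding drift_def v1_def v2_def by measurable

lemma measurable_near_boundary[measurable]: "near_boundary t \<in> borel_measurable borel"
  unfolding near_boundary_def borel_prod[symmetric] by measurable

definition speed :: "complex \<Rightarrow> complex \<Rightarrow> real" where
  "speed s1 s2 = norm s1 * K1 + norm s2 * K2"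

lemma speed_nonneg: "0 \<le> speed s1 s2"
  using K_nonneg by (simp add: speed_def)

lemma norm_velocity_le: "norm (s1 * of_real (v1 w) + s2 * of_real (v2 w)) \<le> speed s1 s2"
proof -
  have "norm (s1 * of_real (v1 w) + s2 * of_real (v2 w)) \<le> norm s1 * \<bar>v1 w\<bar> + norm s2 * \<bar>v2 w\<bar>"
    using norm_triangle_ineq[of "s1 * of_real (v1 w)" "s2 * of_real (v2 w)"] by (simp add: norm_mult)
  also have "\<dots> \<le> speed s1 s2"
    unfolding speed_def using v_bounds by (intro add_mono mult_left_mono) auto
  finally show ?thesis .
qed

lemma norm_drift_le:
  assumes "0 \<le> Re s1" "0 \<le> Re s2" "0 \<le> fst w" "0 \<le> snd w"
  shows "norm (drift s1 s2 w) \<le> speed s1 s2"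
  using mult_mono[OF norm_exp2_le_one[OF assms] norm_velocity_le[of s1 w s2]]
  by (simp add: drift_def norm_mult)

text \<open>Over a short time \<open>t\<close> the process moves along the drift, or exactly one customer arrives;
  every other scenario has probability \<open>o(t)\<close>.\<close>

lemma one_step_bound:
  assumes s: "0 \<le> Re s1" "0 \<le> Re s2" and w: "0 \<le> fst w" "0 \<le> snd w"
    and om: "good_noise om1" "good_noise om2" and t: "0 < t" "t \<le> 1"
  defines "e1 \<equiv> early t 0 om1" and "e2 \<equiv> early t 0 om2"
  shows "norm (exp2 s1 s2 (model_state \<rho>1 \<rho>2 c1 c2 t (w, om1, om2)) - exp2 s1 s2 w
            - of_real t * drift s1 s2 w
            - exp2 s1 s2 w * (of_real e1 * (exp (- s1 * of_real (snd (om1 0))) - 1))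
            - exp2 s1 s2 w * (of_real e2 * (exp (- s2 * of_real (snd (om2 0))) - 1)))
         \<le> (exp (speed s1 s2) * (speed s1 s2)\<^sup>2 + 3 * speed s1 s2 + 6) *
            (t\<^sup>2 + t * near_boundary t w + t * e1 + t * e2 + e1 * e2
              + e1 * early t 1 om1 + e2 * early t 1 om2)" (is "norm ?G \<le> ?C * ?B")
proof -
  let ?f = "exp2 s1 s2"
  define S where "S = speed s1 s2"
  define W where "W = model_state \<rho>1 \<rho>2 c1 c2 t (w, om1, om2)"
  interpret sk: skorokhod_input \<rho>1 \<rho>2 c1 c2 "cp_path c1 om1" "cp_path c2 om2" w
    by unfold_locales (use rho Q1.c_pos Q2.c_pos om w cp_path_0 cp_path_upper_lipschitz in auto)
  have W_eq: "W = refl_workload \<rho>1 \<rho>2 (\<lambda>s. - cp_path c1 om1 s) (\<lambda>s. - cp_path c2 om2 s) w t"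
    by (simp add: W_def model_state_def)
  have S0: "0 \<le> S" unfolding S_def by (rule speed_nonneg)
  define C where "C = exp S * S\<^sup>2 + 3 * S + 6"
  define J1 where "J1 = c1 * t - cp_path c1 om1 t"
  define J2 where "J2 = c2 * t - cp_path c2 om2 t"
  obtain l1 l2 where l: "0 \<le> l1" "l1 \<le> K1 * t" "0 \<le> l2" "l2 \<le> K2 * t"
    and Wl: "W = (fst w - cp_path c1 om1 t + l1 - \<rho>2 * l2, snd w - cp_path c2 om2 t + l2 - \<rho>1 * l1)"
    and Wpos: "0 \<le> fst W" "0 \<le> snd W"
    using sk.workload_representation[of t] t W_eq by (metis fst_conv less_imp_le snd_conv)
  have rl: "0 \<le> \<rho>2 * l2" "\<rho>2 * l2 \<le> \<rho>2 * (K2 * t)" "0 \<le> \<rho>1 * l1" "\<rho>1 * l1 \<le> \<rho>1 * (K1 * t)"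
    using l rho by (auto intro: mult_left_mono)
  have Kt: "K1 * t = c1 * t + \<rho>2 * (K2 * t)" "K2 * t = c2 * t + \<rho>1 * (K1 * t)"
    by (subst K1_eq, simp add: algebra_simps) (subst K2_eq, simp add: algebra_simps)
  have ct: "0 \<le> c1 * t" "0 \<le> c2 * t" using Q1.c_pos Q2.c_pos t by auto
  have disp: "\<bar>fst W - (fst w + J1)\<bar> \<le> K1 * t" "\<bar>snd W - (snd w + J2)\<bar> \<le> K2 * t"
    unfolding Wl fst_conv snd_conv J1_def J2_def abs_le_iff using l rl Kt ct by linarith+
  have near: "norm (?f W - ?f (fst w + J1, snd w + J2)) \<le> S * t" if "0 \<le> J1" "0 \<le> J2"
  proof -
    have "norm (?f W - ?f (fst w + J1, snd w + J2)) \<le>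
        norm s1 * \<bar>fst W - (fst w + J1)\<bar> + norm s2 * \<bar>snd W - (snd w + J2)\<bar>"
      using exp2_diff_le[OF s Wpos, of "(fst w + J1, snd w + J2)"] w that by simp
    also have "\<dots> \<le> norm s1 * (K1 * t) + norm s2 * (K2 * t)"
      using disp by (intro add_mono mult_left_mono) auto
    finally show ?thesis by (simp add: S_def speed_def algebra_simps)
  qed
  have tD: "norm (of_real t * drift s1 s2 w) \<le> S * t"
    using mult_left_mono[OF norm_drift_le[OF s w], of t] t by (simp add: norm_mult S_def mult.commute)
  have St: "S * t \<le> S" using S0 t mult_left_mono[of t 1 S] by simp
  have fw: "norm (?f w) \<le> 1" "norm (?f W) \<le> 1" using norm_exp2_le_one[OF s] w Wpos by auto
  have e01: "0 \<le> early t k \<omega>" "early t k \<omega> \<le> 1" for k \<omega> by (auto simp: early_def)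
  have b01: "0 \<le> near_boundary t w" by (simp add: near_boundary_def)
  have B0: "0 \<le> t\<^sup>2" "0 \<le> t * near_boundary t w" "0 \<le> t * e1" "0 \<le> t * e2" "0 \<le> e1 * e2"
    "0 \<le> e1 * early t 1 om1" "0 \<le> e2 * early t 1 om2"
    using t e01 b01 by (auto simp: e1_def e2_def)
  have C0: "exp S * S\<^sup>2 \<le> C" "2 * S \<le> C" "S + 6 \<le> C" "0 \<le> C" using S0 by (auto simp: C_def)
  have CB: "C * x \<le> C * ?B" if "x \<le> ?B" for x using that C0 by (intro mult_left_mono)
  have jump1: "?f (fst w + x, snd w + 0) = ?f w * exp (- s1 * of_real x)" for x
    by (simp add: exp2_def algebra_simps flip: exp_add)
  have jump2: "?f (fst w + 0, snd w + x) = ?f w * exp (- s2 * of_real x)" for x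
    by (simp add: exp2_def algebra_simps flip: exp_add)
  have "norm ?G \<le> C * ?B"
  proof -
    have term_le: "norm (?f w * (of_real (early t 0 \<omega>) * (exp (- z * of_real (snd (\<omega> 0))) - 1))) \<le> 2"
      if "0 \<le> Re z" "good_noise \<omega>" for z \<omega>
    proof -
      have "norm (exp (- z * of_real (snd (\<omega> 0)))) \<le> 1"
        using that by (intro norm_exp_minus_mult_le_one) (auto simp: good_noise_def intro: less_imp_le)
      hence "norm (exp (- z * of_real (snd (\<omega> 0))) - 1) \<le> 2"
        using norm_triangle_ineq4[of "exp (- z * of_real (snd (\<omega> 0)))" 1] norm_one[where 'a=complex]
        by linarith
      hence "norm (?f w) * (early t 0 \<omega> * norm (exp (- z * of_real (snd (\<omega> 0))) - 1)) \<le> 1 * (1 * 2)"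
        using fw e01 by (intro mult_mono mult_nonneg_nonneg norm_ge_zero) auto
      thus ?thesis using e01[of 0 \<omega>] by (simp add: norm_mult)
    qed
    have ev: "early t k \<omega> = 0 \<or> early t k \<omega> = 1" for k \<omega> by (simp add: early_def)
    consider (many) "e1 * e2 = 1 \<or> e1 * early t 1 om1 = 1 \<or> e2 * early t 1 om2 = 1"
      | (none) "e1 = 0" "e2 = 0" | (first) "e1 = 1" "e2 = 0" "early t 1 om1 = 0"
      | (second) "e1 = 0" "e2 = 1" "early t 1 om2 = 0"
      using ev[of 0 om1] ev[of 0 om2] ev[of 1 om1] ev[of 1 om2] unfolding e1_def e2_def
      by (metis mult_1)
    thus ?thesis
    proof cases
      case many
      hence "1 \<le> ?B" using B0 by linarith
      have "norm ?G \<le> 1 + 1 + S + 2 + 2"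
        unfolding W_def[symmetric]
        using term_le[OF s(1) om(1)] term_le[OF s(2) om(2)] fw tD St unfolding e1_def e2_def
        by (intro norm_triangle_le_diff add_mono) auto
      also have "\<dots> \<le> C * 1" using C0 by simp
      also have "\<dots> \<le> C * ?B" by (rule CB) fact
      finally show ?thesis .
    next
      case none
      have lt: "t < fst (om1 0)" "t < fst (om2 0)"
        using none by (auto simp: e1_def e2_def early_def split: if_splits)
      have X: "cp_path c1 om1 u = c1 * u" "cp_path c2 om2 u = c2 * u" if "u \<le> t" for u
        using cp_path_no_arrival om lt that by auto
      show ?thesis
      proof (cases "near_boundary t w = 0")
        case True
        hence far: "fst w = 0 \<or> K1 * t < fst w" "snd w = 0 \<or> K2 * t < snd w"
          using w by (auto simp: near_boundary_def split: if_splits)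
        have W': "W = (fst w - t * v1 w, snd w - t * v2 w)"
          unfolding W_eq v1_def v2_def g1_def g2_def
          by (rule sk.workload_small_time) (use t X far in auto)
        define z where "z = of_real t * (s1 * of_real (v1 w) + s2 * of_real (v2 w))"
        have "?f W = ?f w * exp z"
          unfolding W' z_def by (simp add: exp2_def algebra_simps flip: exp_add)
        hence "?G = ?f w * (exp z - 1 - z)"
          unfolding W_def[symmetric] using none by (simp add: z_def drift_def algebra_simps)
        hence "norm ?G \<le> 1 * (exp (norm z) * (norm z)\<^sup>2)"
          unfolding norm_mult using fw norm_exp_minus_linear_le[of z]
          by (simp only: norm_mult) (intro mult_mono, auto)
        also have "\<dots> \<le> 1 * (exp S * (S * t)\<^sup>2)"
        proof -
          have "norm z \<le> S * t"
            using mult_left_mono[OF norm_velocity_le[of s1 w s2], of t] t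
            by (simp add: z_def norm_mult S_def mult.commute)
          moreover from this have "norm z \<le> S" using St by simp
          ultimately show ?thesis by (intro mult_mono power_mono) auto
        qed
        also have "\<dots> = (exp S * S\<^sup>2) * t\<^sup>2" by (simp add: power_mult_distrib)
        also have "\<dots> \<le> C * t\<^sup>2" using C0 by (intro mult_right_mono) auto
        also have "\<dots> \<le> C * ?B" using B0 by (intro CB) linarith
        finally show ?thesis .
      next
        case False
        hence b: "near_boundary t w = 1" by (simp add: near_boundary_def split: if_splits)
        have "J1 = 0" "J2 = 0" using X[of t] by (auto simp: J1_def J2_def)
        hence "norm (?f W - ?f w) \<le> S * t" using near by simp
        hence "norm ?G \<le> S * t + S * t"
          unfolding W_def[symmetric] using none tD by simp (intro norm_triangle_le_diff, auto)
        also have "\<dots> \<le> C * t" using C0 t mult_right_mono[of "2 * S" C t] by simp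
        also have "\<dots> \<le> C * ?B" using B0 b by (intro CB) simp
        finally show ?thesis .
      qed
    next
      case first
      have lt: "fst (om1 0) \<le> t" "t < fst (om1 1)" "t < fst (om2 0)"
        using first by (auto simp: e1_def e2_def early_def split: if_splits)
      have J: "J1 = snd (om1 0)" "J2 = 0"
        using cp_path_one_arrival[OF om(1) lt(1,2), of c1] cp_path_no_arrival[OF om(2) lt(3), of c2]
        by (auto simp: J1_def J2_def)
      have "0 \<le> J1" using om(1) by (auto simp: J good_noise_def intro: less_imp_le)
      hence "norm (?f W - ?f w * exp (- s1 * of_real (snd (om1 0)))) \<le> S * t"
        using near J jump1 by simp
      moreover have "?G = (?f W - ?f w * exp (- s1 * of_real (snd (om1 0)))) - of_real t * drift s1 s2 w"
        unfolding W_def[symmetric] using first by (simp add: algebra_simps)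
      ultimately have "norm ?G \<le> S * t + S * t"
        using tD by (simp only:) (intro norm_triangle_le_diff, auto)
      also have "\<dots> \<le> C * t" using C0 t mult_right_mono[of "2 * S" C t] by simp
      also have "\<dots> \<le> C * ?B" using B0 first by (intro CB) simp
      finally show ?thesis .
    next
      case second
      have lt: "fst (om2 0) \<le> t" "t < fst (om2 1)" "t < fst (om1 0)"
        using second by (auto simp: e1_def e2_def early_def split: if_splits)
      have J: "J2 = snd (om2 0)" "J1 = 0"
        using cp_path_one_arrival[OF om(2) lt(1,2), of c2] cp_path_no_arrival[OF om(1) lt(3), of c1]
        by (auto simp: J1_def J2_def)
      have "0 \<le> J2" using om(2) by (auto simp: J good_noise_def intro: less_imp_le)
      hence "norm (?f W - ?f w * exp (- s2 * of_real (snd (om2 0)))) \<le> S * t"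
        using near J jump2 by simp
      moreover have "?G = (?f W - ?f w * exp (- s2 * of_real (snd (om2 0)))) - of_real t * drift s1 s2 w"
        unfolding W_def[symmetric] using second by (simp add: algebra_simps)
      ultimately have "norm ?G \<le> S * t + S * t"
        using tD by (simp only:) (intro norm_triangle_le_diff, auto)
      also have "\<dots> \<le> C * t" using C0 t mult_right_mono[of "2 * S" C t] by simp
      also have "\<dots> \<le> C * ?B" using B0 second by (intro CB) simp
      finally show ?thesis .
    qed
  qed
  thus ?thesis by (simp add: C_def S_def)
qed

end

locale stationary_model = coupled_model +
  fixes p :: "(real \<times> real) measure"
  assumes stationary: "stationary_dist \<rho>1 \<rho>2 c1 c2 lam1 lam2 F1 F2 p"
begin

lemma prob_p: "prob_space p" and sets_p[measurable_cong]: "sets p = sets borel"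
  using stationary by (auto simp: stationary_dist_def)

lemma space_p: "space p = UNIV"
  using sets_eq_imp_space_eq[OF sets_p] by simp

sublocale p: prob_space p by (rule prob_p)

lemma p_nonneg: "AE w in p. 0 \<le> fst w \<and> 0 \<le> snd w"
proof -
  have "emeasure p ({0..} \<times> {0..}) = 1" using stationary by (simp add: stationary_dist_def)
  hence "p.prob ({0..} \<times> {0..}) = 1" by (simp add: p.emeasure_eq_measure)
  hence "AE w in p. w \<in> {0..} \<times> {0..}" by (rule p.AE_prob_1)
  thus ?thesis by eventually_elim auto
qed

lemma integrable_exp2:
  assumes "0 \<le> Re s1" "0 \<le> Re s2"
  shows "integrable p (exp2 s1 s2)"
proof (rule p.integrable_const_bound[where B=1])
  show "AE w in p. norm (exp2 s1 s2 w) \<le> 1"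
    using p_nonneg by eventually_elim (use norm_exp2_le_one assms in auto)
qed measurable

lemma integrable_drift:
  assumes "0 \<le> Re s1" "0 \<le> Re s2"
  shows "integrable p (drift s1 s2)"
proof (rule p.integrable_const_bound[where B="speed s1 s2"])
  show "AE w in p. norm (drift s1 s2 w) \<le> speed s1 s2"
    using p_nonneg by eventually_elim (use norm_drift_le assms in auto)
qed measurable

lemma integrable_near_boundary: "integrable p (near_boundary t)"
  by (rule p.integrable_const_bound[where B=1]) (auto simp: near_boundary_def)

lemma integral_near_boundary_tendsto: "(\<lambda>n. LINT w|p. near_boundary (1 / real (Suc n)) w) \<longlonglongrightarrow> 0"
proof -
  have "(\<lambda>n. LINT w|p. near_boundary (1 / real (Suc n)) w) \<longlonglongrightarrow> (LINT w|p. 0)"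
  proof (rule integral_dominated_convergence[where w="\<lambda>_. 1"])
    show "AE w in p. (\<lambda>n. near_boundary (1 / real (Suc n)) w) \<longlonglongrightarrow> 0"
    proof (rule AE_I2)
      fix w :: "real \<times> real"
      have ev: "eventually (\<lambda>n. \<not> (0 < x \<and> x \<le> K * (1 / real (Suc n)))) sequentially" for x K :: real
      proof (cases "0 < x")
        case True
        have "(\<lambda>n. K * (1 / real (Suc n))) \<longlonglongrightarrow> K * 0"
          by (intro tendsto_intros, use LIMSEQ_inverse_real_of_nat in \<open>simp add: inverse_eq_divide\<close>)
        hence "eventually (\<lambda>n. K * (1 / real (Suc n)) < x) sequentially"
          using True by (intro order_tendstoD) auto
        thus ?thesis by eventually_elim auto
      qed simp
      have "eventually (\<lambda>n. near_boundary (1 / real (Suc n)) w = 0) sequentially"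
        using ev[of "fst w" K1] ev[of "snd w" K2] by eventually_elim (simp add: near_boundary_def)
      thus "(\<lambda>n. near_boundary (1 / real (Suc n)) w) \<longlonglongrightarrow> 0" by (rule tendsto_eventually)
    qed
    show "AE w in p. norm (near_boundary (1 / real (Suc n)) w) \<le> 1" for n
      by (simp add: near_boundary_def)
  qed auto
  thus ?thesis by simp
qed

abbreviation "M \<equiv> p \<Otimes>\<^sub>M (Q1.noise \<Otimes>\<^sub>M Q2.noise)"

lemma prob_noises: "prob_space (Q1.noise \<Otimes>\<^sub>M Q2.noise)"
proof -
  interpret N1: prob_space Q1.noise by (rule Q1.prob_space_noise)
  interpret N2: prob_space Q2.noise by (rule Q2.prob_space_noise)
  interpret P: pair_prob_space Q1.noise Q2.noise by unfold_locales
  show ?thesis by unfold_locales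
qed

lemma AE_M_good:
  "AE x in M. (0 \<le> fst (fst x) \<and> 0 \<le> snd (fst x)) \<and> good_noise (fst (snd x)) \<and> good_noise (snd (snd x))"
proof -
  have 1: "AE x in M. 0 \<le> fst (fst x) \<and> 0 \<le> snd (fst x)"
    by (rule AE_pair_fst[OF prob_noises p_nonneg])
  have sf: "sigma_finite_measure (Q1.noise \<Otimes>\<^sub>M Q2.noise)" "sigma_finite_measure Q2.noise"
    using prob_noises Q2.prob_space_noise prob_space_imp_sigma_finite by blast+
  have 2: "AE x in M. good_noise (fst (snd x))"
    by (rule AE_pair_snd[OF prob_p sf(1) AE_pair_fst[OF Q2.prob_space_noise Q1.AE_good_noise]])
  have 3: "AE x in M. good_noise (snd (snd x))"
    by (rule AE_pair_snd[OF prob_p sf(1) AE_pair_snd[OF Q1.prob_space_noise sf(2) Q2.AE_good_noise]])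
  from 1 2 3 show ?thesis by eventually_elim auto
qed

lemma integral_step_bound:
  assumes s: "0 \<le> Re s1" "0 \<le> Re s2" and t: "0 < t" "t \<le> 1"
  defines "\<pi>1 \<equiv> 1 - exp (- t * lam1)" and "\<pi>2 \<equiv> 1 - exp (- t * lam2)"
  defines "C \<equiv> exp (speed s1 s2) * (speed s1 s2)\<^sup>2 + 3 * speed s1 s2 + 6"
  shows "norm (of_real t * (LINT w|p. drift s1 s2 w)
            + (LINT w|p. exp2 s1 s2 w) * (of_real \<pi>1 * (laplace F1 s1 - 1))
            + (LINT w|p. exp2 s1 s2 w) * (of_real \<pi>2 * (laplace F2 s2 - 1)))
         \<le> C * (t\<^sup>2 + t * (LINT w|p. near_boundary t w) + t * \<pi>1 + t * \<pi>2 + \<pi>1 * \<pi>2 + \<pi>1\<^sup>2 + \<pi>2\<^sup>2)"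
proof -
  interpret N1: prob_space Q1.noise by (rule Q1.prob_space_noise)
  interpret N2: prob_space Q2.noise by (rule Q2.prob_space_noise)
  interpret N: prob_space "Q1.noise \<Otimes>\<^sub>M Q2.noise" by (rule prob_noises)
  interpret PM: pair_prob_space p "Q1.noise \<Otimes>\<^sub>M Q2.noise" by unfold_locales
  let ?st = "model_state \<rho>1 \<rho>2 c1 c2 t"
  have t0: "0 \<le> t" using t by simp
  have st_meas: "?st \<in> measurable M borel" and st_distr: "distr M borel ?st = p"
    using stationary t0 by (auto simp: stationary_dist_def)
  note T = triple_integral[OF prob_p Q1.prob_space_noise Q2.prob_space_noise]
  let ?f = "exp2 s1 s2"
  note f_int = integrable_exp2[OF s]
  have one1: "integrable Q1.noise (\<lambda>_. 1::complex)" "integrable Q1.noise (\<lambda>_. 1::real)"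
    and one2: "integrable Q2.noise (\<lambda>_. 1::complex)" "integrable Q2.noise (\<lambda>_. 1::real)"
    and onep: "integrable p (\<lambda>_. 1::real)" by auto
  have i0: "integrable M (\<lambda>x. ?f (?st x))" "(LINT x|M. ?f (?st x)) = (LINT w|p. ?f w)"
  proof -
    have "integrable (distr M borel ?st) ?f" unfolding st_distr by (rule f_int)
    thus "integrable M (\<lambda>x. ?f (?st x))" by (rule integrable_distr[OF st_meas])
    have "(LINT w|distr M borel ?st. ?f w) = (LINT x|M. ?f (?st x))"
      by (rule integral_distr[OF st_meas]) measurable
    thus "(LINT x|M. ?f (?st x)) = (LINT w|p. ?f w)" unfolding st_distr by simp
  qed
  have i1: "integrable M (\<lambda>x. ?f (fst x))" "(LINT x|M. ?f (fst x)) = (LINT w|p. ?f w)"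
    using T[OF f_int one1(1) one2(1)] by (simp_all add: N1.prob_space N2.prob_space)
  have i2: "integrable M (\<lambda>x. drift s1 s2 (fst x))" "(LINT x|M. drift s1 s2 (fst x)) = (LINT w|p. drift s1 s2 w)"
    using T[OF integrable_drift[OF s] one1(1) one2(1)] by (simp_all add: N1.prob_space N2.prob_space)
  let ?j1 = "\<lambda>\<omega>. of_real (early t 0 \<omega>) * (exp (- s1 * of_real (snd (\<omega> 0))) - 1) :: complex"
  let ?j2 = "\<lambda>\<omega>. of_real (early t 0 \<omega>) * (exp (- s2 * of_real (snd (\<omega> 0))) - 1) :: complex"
  note J1 = Q1.integral_early_jump[OF t0 s(1)]
  note J2 = Q2.integral_early_jump[OF t0 s(2)]
  have i3: "integrable M (\<lambda>x. ?f (fst x) * ?j1 (fst (snd x)))"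
    "(LINT x|M. ?f (fst x) * ?j1 (fst (snd x))) = (LINT w|p. ?f w) * (of_real \<pi>1 * (laplace F1 s1 - 1))"
    using T[OF f_int J1(1) one2(1)] unfolding J1(2) \<pi>1_def by (simp_all only: mult_1_right N2.prob_space
      lebesgue_integral_const scaleR_one)
  have i4: "integrable M (\<lambda>x. ?f (fst x) * ?j2 (snd (snd x)))"
    "(LINT x|M. ?f (fst x) * ?j2 (snd (snd x))) = (LINT w|p. ?f w) * (of_real \<pi>2 * (laplace F2 s2 - 1))"
    using T[OF f_int one1(1) J2(1)] unfolding J2(2) \<pi>2_def by (simp_all only: mult_1_left N1.prob_space
      lebesgue_integral_const scaleR_one)
  define G where "G x = ?f (?st x) - ?f (fst x) - of_real t * drift s1 s2 (fst x)
      - ?f (fst x) * ?j1 (fst (snd x)) - ?f (fst x) * ?j2 (snd (snd x))" for x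
  define B where "B x = t\<^sup>2 + t * near_boundary t (fst x) + t * early t 0 (fst (snd x))
      + t * early t 0 (snd (snd x)) + early t 0 (fst (snd x)) * early t 0 (snd (snd x))
      + early t 0 (fst (snd x)) * early t 1 (fst (snd x)) + early t 0 (snd (snd x)) * early t 1 (snd (snd x))"
    for x :: "(real \<times> real) \<times> (nat \<Rightarrow> real \<times> real) \<times> (nat \<Rightarrow> real \<times> real)"
  have Gi: "integrable M G"
    unfolding G_def by (intro Bochner_Integration.integrable_diff i0 i1 i3 i4 integrable_mult_right i2)
  have GI: "(LINT x|M. G x) = - (of_real t * (LINT w|p. drift s1 s2 w)
            + (LINT w|p. exp2 s1 s2 w) * (of_real \<pi>1 * (laplace F1 s1 - 1))
            + (LINT w|p. exp2 s1 s2 w) * (of_real \<pi>2 * (laplace F2 s2 - 1)))"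
  proof -
    have "(LINT x|M. G x) = (LINT x|M. ?f (?st x)) - (LINT x|M. ?f (fst x))
        - (LINT x|M. of_real t * drift s1 s2 (fst x))
        - (LINT x|M. ?f (fst x) * ?j1 (fst (snd x))) - (LINT x|M. ?f (fst x) * ?j2 (snd (snd x)))"
      unfolding G_def
      by (subst Bochner_Integration.integral_diff; (intro Bochner_Integration.integrable_diff i0 i1 i3 i4 integrable_mult_right i2)?)+
         (rule refl)
    also have "(LINT x|M. of_real t * drift s1 s2 (fst x)) = of_real t * (LINT w|p. drift s1 s2 w)"
      using i2 by simp
    finally show ?thesis unfolding i0 i1 i3 i4 by (simp add: algebra_simps)
  qed
  have b1: "integrable M (\<lambda>x. near_boundary t (fst x))" "(LINT x|M. near_boundary t (fst x)) = (LINT w|p. near_boundary t w)"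
    using T[OF integrable_near_boundary one1(2) one2(2)] by (simp_all add: N1.prob_space N2.prob_space)
  note E1 = Q1.integral_early[OF t0, folded \<pi>1_def]
  note E2 = Q2.integral_early[OF t0, folded \<pi>2_def]
  have b2: "integrable M (\<lambda>x. early t 0 (fst (snd x)))" "(LINT x|M. early t 0 (fst (snd x))) = \<pi>1"
    using T[OF onep Q1.integrable_early(1) one2(2)] E1 by (simp_all add: N2.prob_space p.prob_space)
  have b3: "integrable M (\<lambda>x. early t 0 (snd (snd x)))" "(LINT x|M. early t 0 (snd (snd x))) = \<pi>2"
    using T[OF onep one1(2) Q2.integrable_early(1)] E2 by (simp_all add: N1.prob_space p.prob_space)
  have b4: "integrable M (\<lambda>x. early t 0 (fst (snd x)) * early t 0 (snd (snd x)))"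
    "(LINT x|M. early t 0 (fst (snd x)) * early t 0 (snd (snd x))) = \<pi>1 * \<pi>2"
    using T[OF onep Q1.integrable_early(1) Q2.integrable_early(1)] E1 E2 by (simp_all add: p.prob_space)
  have b5: "integrable M (\<lambda>x. early t 0 (fst (snd x)) * early t 1 (fst (snd x)))"
    "(LINT x|M. early t 0 (fst (snd x)) * early t 1 (fst (snd x))) = \<pi>1\<^sup>2"
    using T[OF onep Q1.integrable_early(2) one2(2)] E1 by (simp_all add: N2.prob_space p.prob_space)
  have b6: "integrable M (\<lambda>x. early t 0 (snd (snd x)) * early t 1 (snd (snd x)))"
    "(LINT x|M. early t 0 (snd (snd x)) * early t 1 (snd (snd x))) = \<pi>2\<^sup>2"
    using T[OF onep one1(2) Q2.integrable_early(2)] E2 by (simp_all add: N1.prob_space p.prob_space)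
  have Bi: "integrable M B"
    unfolding B_def
    by (intro Bochner_Integration.integrable_add integrable_mult_right b1(1) b2(1) b3(1) b4(1) b5(1) b6(1)) auto
  have BI: "(LINT x|M. B x) = t\<^sup>2 + t * (LINT w|p. near_boundary t w) + t * \<pi>1 + t * \<pi>2 + \<pi>1 * \<pi>2 + \<pi>1\<^sup>2 + \<pi>2\<^sup>2"
  proof -
    have "(LINT x|M. B x) = (LINT x|M. t\<^sup>2) + (LINT x|M. t * near_boundary t (fst x))
        + (LINT x|M. t * early t 0 (fst (snd x))) + (LINT x|M. t * early t 0 (snd (snd x)))
        + (LINT x|M. early t 0 (fst (snd x)) * early t 0 (snd (snd x)))
        + (LINT x|M. early t 0 (fst (snd x)) * early t 1 (fst (snd x)))
        + (LINT x|M. early t 0 (snd (snd x)) * early t 1 (snd (snd x)))"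
      unfolding B_def
      by (subst Bochner_Integration.integral_add; (intro Bochner_Integration.integrable_add integrable_mult_right
          b1(1) b2(1) b3(1) b4(1) b5(1) b6(1) PM.integrable_const)?)+ (rule refl)
    thus ?thesis by (simp only: b4 b5 b6) (simp add: b1 b2 b3 PM.prob_space)
  qed
  have C0: "0 \<le> C" using speed_nonneg[of s1 s2] by (simp add: C_def)
  have "AE x in M. norm (G x) \<le> C * B x"
    using AE_M_good
  proof eventually_elim
    fix x :: "(real \<times> real) \<times> (nat \<Rightarrow> real \<times> real) \<times> (nat \<Rightarrow> real \<times> real)"
    assume "(0 \<le> fst (fst x) \<and> 0 \<le> snd (fst x)) \<and> good_noise (fst (snd x)) \<and> good_noise (snd (snd x))"
    thus "norm (G x) \<le> C * B x"
      using one_step_bound[OF s _ _ _ _ t, of "fst x" "fst (snd x)" "snd (snd x)"]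
      unfolding G_def B_def C_def by simp
  qed
  hence "(LINT x|M. norm (G x)) \<le> (LINT x|M. C * B x)"
    using Gi Bi by (intro integral_mono_AE) auto
  hence "norm (LINT x|M. G x) \<le> (LINT x|M. C * B x)"
    using integral_norm_bound[of M G] by linarith
  also have "\<dots> = C * (LINT x|M. B x)" by simp
  finally show ?thesis unfolding GI BI by (simp only: norm_minus_cancel)
qed

lemma generator_equation:
  assumes s: "0 \<le> Re s1" "0 \<le> Re s2"
  shows "(LINT w|p. drift s1 s2 w) + (LINT w|p. exp2 s1 s2 w) *
           (of_real lam1 * (laplace F1 s1 - 1) + of_real lam2 * (laplace F2 s2 - 1)) = 0"
proof -
  define D where "D = (LINT w|p. drift s1 s2 w)"
  define E where "E = (LINT w|p. exp2 s1 s2 w)"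
  define t where "t n = 1 / real (Suc n)" for n
  define r1 where "r1 n = (1 - exp (- t n * lam1)) / t n" for n
  define r2 where "r2 n = (1 - exp (- t n * lam2)) / t n" for n
  define b where "b n = (LINT w|p. near_boundary (t n) w)" for n
  define C where "C = exp (speed s1 s2) * (speed s1 s2)\<^sup>2 + 3 * speed s1 s2 + 6"
  define z where "z n = D + E * (of_real (r1 n) * (laplace F1 s1 - 1) + of_real (r2 n) * (laplace F2 s2 - 1))" for n
  have t: "0 < t n" "t n \<le> 1" for n by (auto simp: t_def)
  have t0: "t \<longlonglongrightarrow> 0" unfolding t_def by real_asymp
  have r1: "r1 \<longlonglongrightarrow> lam1" unfolding r1_def t_def by real_asymp
  have r2: "r2 \<longlonglongrightarrow> lam2" unfolding r2_def t_def by real_asymp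
  have b0: "b \<longlonglongrightarrow> 0" unfolding b_def t_def by (rule integral_near_boundary_tendsto)
  have "z \<longlonglongrightarrow> D + E * (of_real lam1 * (laplace F1 s1 - 1) + of_real lam2 * (laplace F2 s2 - 1))"
    unfolding z_def by (intro tendsto_intros r1 r2)
  moreover have "z \<longlonglongrightarrow> 0"
  proof (rule Lim_null_comparison)
    show "eventually (\<lambda>n. norm (z n) \<le> C * (t n + b n + t n * r1 n + t n * r2 n
        + t n * (r1 n * r2 n) + t n * (r1 n)\<^sup>2 + t n * (r2 n)\<^sup>2)) sequentially"
    proof (rule always_eventually, rule allI)
      fix n
      have pi: "1 - exp (- t n * lam1) = t n * r1 n" "1 - exp (- t n * lam2) = t n * r2 n"
        using t[of n] by (auto simp: r1_def r2_def)
      have "norm (of_real (t n) * z n) \<le> C * ((t n)\<^sup>2 + t n * b n + t n * (t n * r1 n) + t n * (t n * r2 n)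
          + (t n * r1 n) * (t n * r2 n) + (t n * r1 n)\<^sup>2 + (t n * r2 n)\<^sup>2)"
        using integral_step_bound[OF s t[of n]] unfolding pi
        by (simp add: z_def D_def E_def C_def b_def algebra_simps)
      also have "\<dots> = t n * (C * (t n + b n + t n * r1 n + t n * r2 n
        + t n * (r1 n * r2 n) + t n * (r1 n)\<^sup>2 + t n * (r2 n)\<^sup>2))"
        by (simp add: power2_eq_square algebra_simps)
      finally have "t n * norm (z n) \<le> t n * (C * (t n + b n + t n * r1 n + t n * r2 n
        + t n * (r1 n * r2 n) + t n * (r1 n)\<^sup>2 + t n * (r2 n)\<^sup>2))"
        using t[of n] by (simp add: norm_mult)
      thus "norm (z n) \<le> C * (t n + b n + t n * r1 n + t n * r2 n
        + t n * (r1 n * r2 n) + t n * (r1 n)\<^sup>2 + t n * (r2 n)\<^sup>2)"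
        using t(1)[of n] by (rule mult_left_le_imp_le)
    qed
    have "(\<lambda>n. C * (t n + b n + t n * r1 n + t n * r2 n
        + t n * (r1 n * r2 n) + t n * (r1 n)\<^sup>2 + t n * (r2 n)\<^sup>2)) \<longlonglongrightarrow>
      C * (0 + 0 + 0 * lam1 + 0 * lam2 + 0 * (lam1 * lam2) + 0 * lam1\<^sup>2 + 0 * lam2\<^sup>2)"
      by (intro tendsto_intros t0 r1 r2 b0)
    thus "(\<lambda>n. C * (t n + b n + t n * r1 n + t n * r2 n
        + t n * (r1 n * r2 n) + t n * (r1 n)\<^sup>2 + t n * (r2 n)\<^sup>2)) \<longlonglongrightarrow> 0" by simp
  qed
  ultimately show ?thesis unfolding D_def E_def by (rule LIMSEQ_unique)
qed

definition N1 :: "real measure" where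
  "N1 = distr (density p (\<lambda>w. ennreal (g1 w))) borel snd"

definition N2 :: "real measure" where
  "N2 = distr (density p (\<lambda>w. ennreal (g2 w))) borel fst"

lemma measurable_coords[measurable]:
  "fst \<in> measurable p borel" "snd \<in> measurable p borel"
  "fst \<in> measurable (density p h) borel" "snd \<in> measurable (density p h) borel"
  unfolding measurable_density_eq1 measurable_cong_sets[OF sets_p refl] borel_prod[symmetric] by measurable

lemma finite_density:
  assumes [measurable]: "g \<in> borel_measurable borel" and "\<And>w. g w \<le> K"
  shows "finite_measure (density p (\<lambda>w. ennreal (g w)))"
proof
  have "emeasure (density p (\<lambda>w. ennreal (g w))) (space p) = (\<integral>\<^sup>+w. ennreal (g w) \<partial>p)"
    by (subst emeasure_density) (auto intro!: nn_integral_cong)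
  also have "\<dots> \<le> (\<integral>\<^sup>+w. ennreal K \<partial>p)"
    using assms by (intro nn_integral_mono) (auto intro: ennreal_leI)
  also have "\<dots> < \<infinity>" by (simp add: p.emeasure_space_1)
  finally show "emeasure (density p (\<lambda>w. ennreal (g w))) (space (density p (\<lambda>w. ennreal (g w)))) \<noteq> \<infinity>" by simp
qed

lemma nonneg_N: "nonneg_measure N1" "nonneg_measure N2"
proof -
  have "finite_measure N1" unfolding N1_def
    by (rule finite_measure.finite_measure_distr[OF finite_density[of g1 K1]]) (auto simp: g_bounds)
  moreover have "AE x in N1. 0 \<le> x" unfolding N1_def
    by (subst AE_distr_iff) (use p_nonneg in \<open>auto simp: AE_density\<close>)
  ultimately show "nonneg_measure N1"
    by (intro nonneg_measure.intro nonneg_measure_axioms.intro) (simp_all add: N1_def)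
  have "finite_measure N2" unfolding N2_def
    by (rule finite_measure.finite_measure_distr[OF finite_density[of g2 K2]]) (auto simp: g_bounds)
  moreover have "AE x in N2. 0 \<le> x" unfolding N2_def
    by (subst AE_distr_iff) (use p_nonneg in \<open>auto simp: AE_density\<close>)
  ultimately show "nonneg_measure N2"
    by (intro nonneg_measure.intro nonneg_measure_axioms.intro) (simp_all add: N2_def)
qed

lemma laplace_N1: "laplace N1 s = (LINT w|p. of_real (g1 w) * exp (- s * of_real (snd w)))"
  unfolding laplace_def N1_def
  by (subst integral_distr, simp, simp, subst integral_density) (auto simp: g_bounds scaleR_conv_of_real)

lemma laplace_N2: "laplace N2 s = (LINT w|p. of_real (g2 w) * exp (- s * of_real (fst w)))"
  unfolding laplace_def N2_def
  by (subst integral_distr, simp, simp, subst integral_density) (auto simp: g_bounds scaleR_conv_of_real)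

lemma g1_exp2: "of_real (g1 w) * exp2 s1 s2 w = of_real (g1 w) * exp (- s2 * of_real (snd w))"
  by (simp add: exp2_def g1_def idle_rate_def)

lemma g2_exp2: "of_real (g2 w) * exp2 s1 s2 w = of_real (g2 w) * exp (- s1 * of_real (fst w))"
  by (simp add: exp2_def g2_def idle_rate_def)

lemma kernel_equation:
  assumes s: "0 \<le> Re s1" "0 \<le> Re s2"
  shows "(Q1.\<psi> s1 + Q2.\<psi> s2) * (LINT w|p. exp2 s1 s2 w) =
           (s1 - of_real \<rho>1 * s2) * laplace N1 s2 + (s2 - of_real \<rho>2 * s1) * laplace N2 s1"
proof -
  note f_int = integrable_exp2[OF s]
  have bound: "integrable p (\<lambda>w. of_real (g w) * exp2 s1 s2 w)"
    if [measurable]: "g \<in> borel_measurable borel" and g: "\<And>w. 0 \<le> g w" "\<And>w. g w \<le> K" for g K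
  proof (rule p.integrable_const_bound[where B=K])
    show "AE w in p. norm (of_real (g w) * exp2 s1 s2 w) \<le> K"
      using p_nonneg
    proof eventually_elim
      fix w :: "real \<times> real" assume "0 \<le> fst w \<and> 0 \<le> snd w"
      hence "g w * norm (exp2 s1 s2 w) \<le> K * 1"
        using g[of w] norm_exp2_le_one[OF s, of w] by (intro mult_mono) auto
      thus "norm (of_real (g w) * exp2 s1 s2 w) \<le> K" using g[of w] by (simp add: norm_mult)
    qed
  qed measurable
  have i1: "integrable p (\<lambda>w. of_real (g1 w) * exp2 s1 s2 w)"
    by (rule bound[of _ K1]) (auto simp: g_bounds)
  have i2: "integrable p (\<lambda>w. of_real (g2 w) * exp2 s1 s2 w)"
    by (rule bound[of _ K2]) (auto simp: g_bounds)
  have L: "laplace N1 s2 = (LINT w|p. of_real (g1 w) * exp2 s1 s2 w)"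
    "laplace N2 s1 = (LINT w|p. of_real (g2 w) * exp2 s1 s2 w)"
    by (simp_all only: laplace_N1 laplace_N2 g1_exp2 g2_exp2)
  have "drift s1 s2 = (\<lambda>w. (s1 * of_real c1 + s2 * of_real c2) * exp2 s1 s2 w
      - (s1 - of_real \<rho>1 * s2) * (of_real (g1 w) * exp2 s1 s2 w)
      - (s2 - of_real \<rho>2 * s1) * (of_real (g2 w) * exp2 s1 s2 w))"
    by (rule ext) (simp add: drift_def v1_def v2_def algebra_simps)
  hence "(LINT w|p. drift s1 s2 w) = (s1 * of_real c1 + s2 * of_real c2) * (LINT w|p. exp2 s1 s2 w)
      - (s1 - of_real \<rho>1 * s2) * laplace N1 s2 - (s2 - of_real \<rho>2 * s1) * laplace N2 s1"
    unfolding L using f_int i1 i2 by simp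
  with generator_equation[OF s] show ?thesis
    by (simp add: Q1.\<psi>_def Q2.\<psi>_def algebra_simps)
qed

end

section \<open>The factorization\<close>

context stationary_model
begin

sublocale N1: nonneg_measure N1 by (rule nonneg_N)
sublocale N2: nonneg_measure N2 by (rule nonneg_N)

abbreviation "n1 \<equiv> measure N1 (space N1)"
abbreviation "n2 \<equiv> measure N2 (space N2)"

lemma nonneg_marginal:
  "nonneg_measure (distr p borel fst)" "nonneg_measure (distr p borel snd)"
  "prob_space (distr p borel fst)" "prob_space (distr p borel snd)"
proof -
  show a: "prob_space (distr p borel fst)" "prob_space (distr p borel snd)"
    by (rule p.prob_space_distr, measurable)+
  have "AE x in distr p borel fst. 0 \<le> x" "AE x in distr p borel snd. 0 \<le> x"
    using p_nonneg by (simp_all add: AE_distr_iff)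
  thus "nonneg_measure (distr p borel fst)" "nonneg_measure (distr p borel snd)"
    using a by (auto intro!: nonneg_measure.intro nonneg_measure_axioms.intro prob_space.finite_measure)
qed

lemma laplace_marginal:
  "laplace (distr p borel fst) s = (LINT w|p. exp2 s 0 w)"
  "laplace (distr p borel snd) s = (LINT w|p. exp2 0 s w)"
  unfolding laplace_def exp2_def[abs_def] by (subst integral_distr; simp)+

lemma marginal_equation_1:
  assumes "0 \<le> Re s"
  shows "Q1.\<Psi> s * laplace (distr p borel fst) s = of_real n1 - of_real \<rho>2 * laplace N2 s"
proof -
  define h where "h s = Q1.\<Psi> s * laplace (distr p borel fst) s - (of_real n1 - of_real \<rho>2 * laplace N2 s)" for s
  have off: "h s = 0" if "0 \<le> Re s" "s \<noteq> 0" for s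
  proof -
    have "Q1.\<psi> s * laplace (distr p borel fst) s = s * (of_real n1 - of_real \<rho>2 * laplace N2 s)"
      using kernel_equation[of s 0] that
      by (simp add: laplace_marginal Q2.psi_0 N1.laplace_0 algebra_simps)
    thus ?thesis using that by (simp add: Q1.psi_eq_Psi h_def mult.assoc)
  qed
  show ?thesis
  proof (cases "s = 0")
    case True
    have cont: "continuous_on {s. 0 \<le> Re s} h"
      unfolding h_def by (intro continuous_intros Q1.continuous_on_Psi N2.continuous_on_laplace
        nonneg_measure.continuous_on_laplace nonneg_marginal)
    have "(\<lambda>n. h (of_real (1 / real (Suc n)))) \<longlonglongrightarrow> h (of_real 0)"
    proof (rule continuous_on_tendsto_compose[OF cont])
      have "(\<lambda>n. 1 / real (Suc n)) \<longlonglongrightarrow> 0" using LIMSEQ_inverse_real_of_nat by (simp add: inverse_eq_divide)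
      thus "(\<lambda>n. complex_of_real (1 / real (Suc n))) \<longlonglongrightarrow> of_real 0" by (intro tendsto_intros)
    qed auto
    moreover have "h (of_real (1 / real (Suc n))) = 0" for n
      by (rule off) (simp_all only: Re_complex_of_real of_real_eq_0_iff, simp_all)
    ultimately have "(\<lambda>n::nat. 0) \<longlonglongrightarrow> h 0" by simp
    thus ?thesis using True by (simp add: LIMSEQ_const_iff h_def)
  qed (use off assms in \<open>auto simp: h_def\<close>)
qed

lemma marginal_equation_2:
  assumes "0 \<le> Re s"
  shows "Q2.\<Psi> s * laplace (distr p borel snd) s = of_real n2 - of_real \<rho>1 * laplace N1 s"
proof -
  define h where "h s = Q2.\<Psi> s * laplace (distr p borel snd) s - (of_real n2 - of_real \<rho>1 * laplace N1 s)" for s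
  have off: "h s = 0" if "0 \<le> Re s" "s \<noteq> 0" for s
  proof -
    have "Q2.\<psi> s * laplace (distr p borel snd) s = s * (of_real n2 - of_real \<rho>1 * laplace N1 s)"
      using kernel_equation[of 0 s] that
      by (simp add: laplace_marginal Q1.psi_0 N2.laplace_0 algebra_simps)
    thus ?thesis using that by (simp add: Q2.psi_eq_Psi h_def mult.assoc)
  qed
  show ?thesis
  proof (cases "s = 0")
    case True
    have cont: "continuous_on {s. 0 \<le> Re s} h"
      unfolding h_def by (intro continuous_intros Q2.continuous_on_Psi N1.continuous_on_laplace
        nonneg_measure.continuous_on_laplace nonneg_marginal)
    have "(\<lambda>n. h (of_real (1 / real (Suc n)))) \<longlonglongrightarrow> h (of_real 0)"
    proof (rule continuous_on_tendsto_compose[OF cont])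
      have "(\<lambda>n. 1 / real (Suc n)) \<longlonglongrightarrow> 0" using LIMSEQ_inverse_real_of_nat by (simp add: inverse_eq_divide)
      thus "(\<lambda>n. complex_of_real (1 / real (Suc n))) \<longlonglongrightarrow> of_real 0" by (intro tendsto_intros)
    qed auto
    moreover have "h (of_real (1 / real (Suc n))) = 0" for n
      by (rule off) (simp_all only: Re_complex_of_real of_real_eq_0_iff, simp_all)
    ultimately have "(\<lambda>n::nat. 0) \<longlonglongrightarrow> h 0" by simp
    thus ?thesis using True by (simp add: LIMSEQ_const_iff h_def)
  qed (use off assms in \<open>auto simp: h_def\<close>)
qed

lemma masses: "n1 = Q1.\<mu> + \<rho>2 * n2" "n2 = Q2.\<mu> + \<rho>1 * n1"
proof -
  have one: "laplace (distr p borel fst) 0 = 1" "laplace (distr p borel snd) 0 = 1"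
    by (simp_all add: laplace_marginal exp2_def p.prob_space)
  have "complex_of_real Q1.\<mu> = of_real (n1 - \<rho>2 * n2)"
    using marginal_equation_1[of 0] by (simp add: one Q1.Psi_0 N2.laplace_0)
  thus "n1 = Q1.\<mu> + \<rho>2 * n2" unfolding of_real_eq_iff by simp
  have "complex_of_real Q2.\<mu> = of_real (n2 - \<rho>1 * n1)"
    using marginal_equation_2[of 0] by (simp add: one Q2.Psi_0 N1.laplace_0)
  thus "n2 = Q2.\<mu> + \<rho>1 * n1" unfolding of_real_eq_iff by simp
qed

lemma n2_eq: "n2 * (1 - \<rho>1 * \<rho>2) = Q2.\<mu> + \<rho>1 * Q1.\<mu>"
proof -
  have "n2 = Q2.\<mu> + \<rho>1 * (Q1.\<mu> + \<rho>2 * n2)" using masses by simp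
  thus ?thesis by (simp add: algebra_simps)
qed

lemma denominator_pos: "0 < Q2.\<mu> + \<rho>1 * Q1.\<mu>"
  using Q1.mean_pos Q2.mean_pos rho by (intro add_pos_nonneg mult_nonneg_nonneg) auto

lemma n2_pos: "0 < n2"
  using n2_eq denominator_pos rho by (metis diff_gt_0_iff_gt zero_less_mult_pos2)

abbreviation "V \<equiv> V_law \<rho>1 \<rho>2 c1 c2 Q1.\<mu> Q2.\<mu> p"

lemma V_law_eq: "V = distr (density p (\<lambda>w. ennreal (1 / n2 * g2 w))) borel fst" (is "_ = ?D")
proof -
  define k where "k = 1 / n2"
  have k0: "0 \<le> k" using n2_pos by (simp add: k_def)
  have k_eq: "k = (1 - \<rho>1 * \<rho>2) / (Q2.\<mu> + \<rho>1 * Q1.\<mu>)"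
    using n2_eq n2_pos denominator_pos by (simp add: k_def field_simps)
  define a where "a = c2 * (1 - \<rho>1 * \<rho>2) / (Q2.\<mu> + \<rho>1 * Q1.\<mu>)"
  define b where "b = \<rho>1 * (c2 * \<rho>2 + c1) / (Q2.\<mu> + \<rho>1 * Q1.\<mu>)"
  have ab0: "0 \<le> a" "0 \<le> b"
    unfolding a_def b_def using Q1.c_pos Q2.c_pos rho denominator_pos
    by (auto intro!: divide_nonneg_pos mult_nonneg_nonneg add_nonneg_nonneg)
  have ka: "k * c2 = a" by (simp add: k_eq a_def)
  have kb: "k * K2 = a + b"
  proof -
    have "k * K2 = k * c2 + \<rho>1 * (k * K1)" by (subst K2_eq) (simp add: algebra_simps)
    also have "k * K1 = (c1 + \<rho>2 * c2) / (Q2.\<mu> + \<rho>1 * Q1.\<mu>)"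
      using rho by (simp add: k_eq max_rate_def)
    finally show ?thesis unfolding ka by (simp add: b_def algebra_simps)
  qed
  have kg: "k * g2 w = a * indicator {w. snd w = 0} w + b * indicator {(0, 0)} w" for w :: "real \<times> real"
    using ka kb by (cases w) (auto simp: g2_def idle_rate_def indicator_def)
  have em: "emeasure ?D B = ennreal a * emeasure p (B \<times> {0}) + ennreal b * emeasure p {(0, 0)} * indicator B 0"
    if B: "B \<in> sets borel" for B
  proof -
    have BB: "B \<times> {0} \<in> sets p" unfolding sets_p using B by (simp add: borel_prod[symmetric])
    have S0: "{(0, 0)} \<in> sets p" unfolding sets_p by simp
    have "emeasure ?D B = emeasure (density p (\<lambda>w. ennreal (k * g2 w))) (fst -` B \<inter> space p)"
      using B by (subst emeasure_distr) (auto simp: k_def)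
    also have "\<dots> = (\<integral>\<^sup>+w. ennreal (k * g2 w) * indicator (fst -` B \<inter> space p) w \<partial>p)"
      using B by (intro emeasure_density) (auto intro!: measurable_sets[OF measurable_coords(1)])
    also have "\<dots> = (\<integral>\<^sup>+w. ennreal a * indicator (B \<times> {0}) w + ennreal b * indicator B 0 * indicator {(0, 0)} w \<partial>p)"
    proof (intro nn_integral_cong)
      fix w :: "real \<times> real"
      show "ennreal (k * g2 w) * indicator (fst -` B \<inter> space p) w =
          ennreal a * indicator (B \<times> {0}) w + ennreal b * indicator B 0 * indicator {(0, 0)} w"
        unfolding kg space_p using ab0 by (cases w) (auto simp: indicator_def ennreal_plus)
    qed
    also have "\<dots> = ennreal a * emeasure p (B \<times> {0}) + ennreal b * indicator B 0 * emeasure p {(0, 0)}"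
      using BB S0 by (subst nn_integral_add) (auto simp: nn_integral_cmult)
    finally show ?thesis by (simp add: mult_ac)
  qed
  have "?D = measure_of (space ?D) (sets ?D) (emeasure ?D)" by (rule measure_of_of_measure[symmetric])
  also have "\<dots> = measure_of UNIV (sets borel)
      (\<lambda>B. ennreal a * emeasure p (B \<times> {0}) + ennreal b * emeasure p {(0, 0)} * indicator B 0)"
    unfolding space_distr sets_distr space_borel
  proof (rule measure_of_eq)
    fix B :: "real set" assume "B \<in> sigma_sets UNIV (sets borel)"
    hence "B \<in> sets borel" using sets.sigma_sets_eq[of "borel :: real measure"] by simp
    thus "emeasure ?D B = ennreal a * emeasure p (B \<times> {0}) + ennreal b * emeasure p {(0, 0)} * indicator B 0"
      by (rule em)
  qed simp
  finally show ?thesis by (simp add: V_law_def a_def b_def)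
qed

lemma nonneg_V: "nonneg_measure V" and laplace_V: "laplace V s = laplace N2 s / of_real n2"
  and prob_V: "prob_space V"
proof -
  have k0: "0 \<le> 1 / n2" using n2_pos by simp
  have fin: "finite_measure V" unfolding V_law_eq
    by (rule finite_measure.finite_measure_distr[OF finite_density[of _ "1 / n2 * K2"]])
       (use k0 in \<open>auto simp: g_bounds intro!: mult_left_mono divide_right_mono\<close>)
  have "AE x in V. 0 \<le> x" unfolding V_law_eq
    by (subst AE_distr_iff) (use p_nonneg in \<open>auto simp: AE_density\<close>)
  with fin show nn: "nonneg_measure V"
    by (intro nonneg_measure.intro nonneg_measure_axioms.intro) (simp_all add: V_law_eq)
  interpret V: nonneg_measure V by (rule nn)
  have L: "laplace V s = laplace N2 s / of_real n2" for s
  proof -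
    have "laplace V s = (LINT w|p. of_real (1 / n2) * (of_real (g2 w) * exp (- s * of_real (fst w))))"
      unfolding laplace_def V_law_eq using k0
      by (subst integral_distr, simp, simp, subst integral_density)
         (auto simp: g_bounds scaleR_conv_of_real mult_ac)
    also have "\<dots> = of_real (1 / n2) * laplace N2 s" unfolding laplace_N2 by (rule integral_mult_right_zero)
    finally show ?thesis by simp
  qed
  show "laplace V s = laplace N2 s / of_real n2" by (rule L)
  have "complex_of_real (measure V (space V)) = of_real 1"
    using L[of 0] n2_pos by (simp add: V.laplace_0 N2.laplace_0)
  hence "measure V (space V) = 1" unfolding of_real_eq_iff .
  thus "prob_space V" by (intro prob_spaceI) (simp add: V.emeasure_eq_measure)
qed

definition "A q = laplace N2 (Q1.\<Phi> q)"
definition "B q = laplace N1 (Q2.\<Phi> q)"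

lemma A_B_holomorphic: "A holomorphic_on {q. 0 < Re q}" "B holomorphic_on {q. 0 < Re q}"
proof -
  have "(laplace N2 \<circ> Q1.\<Phi>) holomorphic_on {q. 0 < Re q}"
    by (rule holomorphic_on_compose_gen[OF Q1.holomorphic_on_Phi N2.holomorphic_on_laplace])
      (use Q1.Re_Phi_pos in auto)
  thus "A holomorphic_on {q. 0 < Re q}" by (simp add: A_def[abs_def] o_def)
  have "(laplace N1 \<circ> Q2.\<Phi>) holomorphic_on {q. 0 < Re q}"
    by (rule holomorphic_on_compose_gen[OF Q2.holomorphic_on_Phi N1.holomorphic_on_laplace])
      (use Q2.Re_Phi_pos in auto)
  thus "B holomorphic_on {q. 0 < Re q}" by (simp add: B_def[abs_def] o_def)
qed

lemma A_B_continuous: "continuous_on {q. 0 \<le> Re q} A" "continuous_on {q. 0 \<le> Re q} B"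
  unfolding A_def[abs_def] B_def[abs_def]
  by (rule continuous_on_compose2[OF N2.continuous_on_laplace Q1.continuous_on_Phi], use Q1.Re_Phi in auto)
     (rule continuous_on_compose2[OF N1.continuous_on_laplace Q2.continuous_on_Phi], use Q2.Re_Phi in auto)

lemma A_B_bounded: "0 \<le> Re q \<Longrightarrow> norm (A q) \<le> n2" "0 \<le> Re q \<Longrightarrow> norm (B q) \<le> n1"
  unfolding A_def B_def using N1.norm_laplace_le N2.norm_laplace_le Q1.Re_Phi Q2.Re_Phi by auto

lemma A_B_boundary:
  assumes "Re q = 0"
  shows "(of_real \<rho>2 * Q1.\<Phi> q - cnj (Q2.\<Phi> q)) * A q =
         (Q1.\<Phi> q - of_real \<rho>1 * cnj (Q2.\<Phi> q)) * cnj (B q)"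
proof -
  have q: "cnj q = - q" using assms by (simp add: complex_eq_iff)
  have "Q1.\<psi> (Q1.\<Phi> q) + Q2.\<psi> (cnj (Q2.\<Phi> q)) = 0"
    using assms by (simp add: Q2.psi_cnj Q1.psi_Phi Q2.psi_Phi q)
  with kernel_equation[of "Q1.\<Phi> q" "cnj (Q2.\<Phi> q)"] Q1.Re_Phi[of q] Q2.Re_Phi[of q] assms
  show ?thesis by (simp add: A_def B_def N1.laplace_cnj algebra_simps)
qed

lemma laplace_N2_real:
  assumes "0 \<le> s"
  obtains x where "0 < x" "laplace N2 (of_real s) = of_real x"
  using N2.laplace_real N2.laplace_real_pos[OF n2_pos assms] that by blast

end

context coupled_queues
begin

lemma laplace_product_identity:
  assumes rho: "0 \<le> \<rho>1" "0 \<le> \<rho>2" "\<rho>1 * \<rho>2 < 1"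
    and st: "stationary_dist \<rho>1 \<rho>2 c1 c2 lam1 lam2 F1 F2 p"
    and st10: "stationary_dist \<rho>1 0 c1 c2 lam1 lam2 F1 F2 p10"
    and st02: "stationary_dist 0 \<rho>2 c1 c2 lam1 lam2 F1 F2 p02"
    and s: "0 < s"
  shows "laplace (V_law \<rho>1 0 c1 c2 Q1.\<mu> Q2.\<mu> p10) (of_real s)
           * laplace (V_law 0 \<rho>2 c1 c2 Q1.\<mu> Q2.\<mu> p02) (of_real s) * Q1.\<Psi> (of_real s)
         = of_real Q1.\<mu> * laplace (V_law \<rho>1 \<rho>2 c1 c2 Q1.\<mu> Q2.\<mu> p) (of_real s)"
proof -
  interpret S: stationary_model c1 lam1 F1 c2 lam2 F2 \<rho>1 \<rho>2 p
    by unfold_locales (use rho st in auto)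
  interpret T: stationary_model c1 lam1 F1 c2 lam2 F2 \<rho>1 0 p10
    by unfold_locales (use rho st10 in auto)
  interpret U: stationary_model c1 lam1 F1 c2 lam2 F2 0 \<rho>2 p02
    by unfold_locales (use rho st02 in auto)
  define A' where "A' q = T.A q * U.A q * Q1.\<Psi> (Q1.\<Phi> q)" for q
  define B' where "B' q = T.B q * U.B q * Q2.\<Psi> (Q2.\<Phi> q)" for q
  have hol: "A' holomorphic_on {q. 0 < Re q}" "B' holomorphic_on {q. 0 < Re q}"
    unfolding A'_def B'_def
    by (intro holomorphic_on_mult T.A_B_holomorphic U.A_B_holomorphic Q1.holomorphic_on_Psi_Phi
      Q2.holomorphic_on_Psi_Phi)+
  have cont: "continuous_on {q. 0 \<le> Re q} A'" "continuous_on {q. 0 \<le> Re q} B'"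
    unfolding A'_def B'_def
    by (intro continuous_on_mult T.A_B_continuous U.A_B_continuous Q1.continuous_on_Psi_Phi
      Q2.continuous_on_Psi_Phi)+
  have bdd: "norm (A' q) \<le> T.n2 * U.n2 * (c1 + lam1 * Q1.m)"
    "norm (B' q) \<le> T.n1 * U.n1 * (c2 + lam2 * Q2.m)" if "0 \<le> Re q" for q
    unfolding A'_def B'_def norm_mult using that
    by (intro mult_mono mult_nonneg_nonneg T.A_B_bounded U.A_B_bounded Q1.norm_Psi_le Q2.norm_Psi_le
      Q1.Re_Phi Q2.Re_Phi; simp)+
  have bnd: "(of_real \<rho>2 * Q1.\<Phi> q - cnj (Q2.\<Phi> q)) * A' q =
      (Q1.\<Phi> q - of_real \<rho>1 * cnj (Q2.\<Phi> q)) * cnj (B' q)" if q: "Re q = 0" for q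
  proof (cases "q = 0")
    case False
    define z1 where "z1 = Q1.\<Phi> q"
    define z2 where "z2 = cnj (Q2.\<Phi> q)"
    have nz: "z1 \<noteq> 0" "z2 \<noteq> 0" using False q Q1.Phi_nonzero Q2.Phi_nonzero by (auto simp: z1_def z2_def)
    have cq: "cnj q = - q" using q by (simp add: complex_eq_iff)
    have e1: "- z2 * T.A q = (z1 - of_real \<rho>1 * z2) * cnj (T.B q)"
      using T.A_B_boundary[OF q] by (simp add: z1_def z2_def)
    have e2: "(of_real \<rho>2 * z1 - z2) * U.A q = z1 * cnj (U.B q)"
      using U.A_B_boundary[OF q] by (simp add: z1_def z2_def)
    have e3: "z1 * Q1.\<Psi> (Q1.\<Phi> q) = - z2 * cnj (Q2.\<Psi> (Q2.\<Phi> q))"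
      using Q1.Phi_mult_Psi[of q] arg_cong[OF Q2.Phi_mult_Psi[of q], of cnj] q cq
      by (simp add: z1_def z2_def)
    have "(- z2 * z1) * ((of_real \<rho>2 * z1 - z2) * A' q) =
        (- z2 * T.A q) * ((of_real \<rho>2 * z1 - z2) * U.A q) * (z1 * Q1.\<Psi> (Q1.\<Phi> q))"
      by (simp only: A'_def mult_ac)
    also have "\<dots> = (- z2 * z1) * ((z1 - of_real \<rho>1 * z2) * cnj (B' q))"
      unfolding e1 e2 e3 by (simp only: B'_def complex_cnj_mult mult_ac)
    finally show ?thesis using nz unfolding z1_def[symmetric] z2_def[symmetric]
      by (simp only: mult_cancel_left) auto
  qed (simp add: Q1.Phi_0 Q2.Phi_0)
  obtain s1 where s1: "0 < s1" "Q1.\<Phi> (of_real 1) = of_real s1" by (rule Q1.Phi_real_pos[of 1]) auto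
  have real_at_1: "\<exists>k. A' 1 = of_real k * S.A 1"
  proof -
    obtain x where x: "0 < x" "laplace S.N2 (of_real s1) = of_real x" using S.laplace_N2_real s1 less_imp_le by metis
    obtain y where y: "laplace T.N2 (of_real s1) = of_real y" using T.laplace_N2_real s1 less_imp_le by metis
    obtain z where z: "laplace U.N2 (of_real s1) = of_real z" using U.laplace_N2_real s1 less_imp_le by metis
    have \<Psi>1: "Q1.\<Psi> (Q1.\<Phi> 1) = of_real (1 / s1)" using Q1.Psi_Phi[of 1] s1 by simp
    have "A' 1 = of_real (y * z * (1 / s1))"
      using s1 y z \<Psi>1 by (simp add: A'_def T.A_def U.A_def)
    also have "\<dots> = of_real (y * z * (1 / s1) / x) * S.A 1" using s1 x by (simp add: S.A_def)
    finally show ?thesis by blast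
  qed
  then obtain k where k: "A' 1 = of_real k * S.A 1" by blast
  have AA: "A' q = of_real k * S.A q" if q: "0 \<le> Re q" for q
  proof -
    have "(\<lambda>q. A' q - of_real k * S.A q) q = 0"
    proof (rule wiener_hopf_trivial[OF rho, where A="\<lambda>q. A' q - of_real k * S.A q"
          and B="\<lambda>q. B' q - of_real k * S.B q"
          and CA="T.n2 * U.n2 * (c1 + lam1 * Q1.m) + \<bar>k\<bar> * S.n2"
          and CB="T.n1 * U.n1 * (c2 + lam2 * Q2.m) + \<bar>k\<bar> * S.n1"])
      show "(\<lambda>q. A' q - of_real k * S.A q) holomorphic_on {q. 0 < Re q}"
        "(\<lambda>q. B' q - of_real k * S.B q) holomorphic_on {q. 0 < Re q}"
        by (intro holomorphic_intros hol S.A_B_holomorphic)+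
      show "continuous_on {q. 0 \<le> Re q} (\<lambda>q. A' q - of_real k * S.A q)"
        "continuous_on {q. 0 \<le> Re q} (\<lambda>q. B' q - of_real k * S.B q)"
        by (intro continuous_intros cont S.A_B_continuous)+
      show "norm (A' q - of_real k * S.A q) \<le> T.n2 * U.n2 * (c1 + lam1 * Q1.m) + \<bar>k\<bar> * S.n2"
        if "0 \<le> Re q" for q
        using bdd(1)[OF that] S.A_B_bounded(1)[OF that]
        by (intro norm_triangle_le_diff add_mono) (auto simp: norm_mult intro: mult_left_mono)
      show "norm (B' q - of_real k * S.B q) \<le> T.n1 * U.n1 * (c2 + lam2 * Q2.m) + \<bar>k\<bar> * S.n1"
        if "0 \<le> Re q" for q
        using bdd(2)[OF that] S.A_B_bounded(2)[OF that]
        by (intro norm_triangle_le_diff add_mono) (auto simp: norm_mult intro: mult_left_mono)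
      show "(of_real \<rho>2 * Q1.\<Phi> q - cnj (Q2.\<Phi> q)) * (A' q - of_real k * S.A q) =
          (Q1.\<Phi> q - of_real \<rho>1 * cnj (Q2.\<Phi> q)) * cnj (B' q - of_real k * S.B q)" if "Re q = 0" for q
      proof -
        have "(of_real \<rho>2 * Q1.\<Phi> q - cnj (Q2.\<Phi> q)) * (A' q - of_real k * S.A q) =
          (of_real \<rho>2 * Q1.\<Phi> q - cnj (Q2.\<Phi> q)) * A' q
            - of_real k * ((of_real \<rho>2 * Q1.\<Phi> q - cnj (Q2.\<Phi> q)) * S.A q)"
          by (simp add: algebra_simps)
        also have "\<dots> = (Q1.\<Phi> q - of_real \<rho>1 * cnj (Q2.\<Phi> q)) * cnj (B' q - of_real k * S.B q)"
          unfolding bnd[OF that] S.A_B_boundary[OF that]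
          by (simp add: algebra_simps)
        finally show ?thesis .
      qed
    qed (use k q in auto)
    thus ?thesis by simp
  qed
  have LL: "laplace T.N2 z * laplace U.N2 z * Q1.\<Psi> z = of_real k * laplace S.N2 z"
    if "0 \<le> Re z" "0 \<le> Re (Q1.\<psi> z)" for z
    using AA[OF that(2)] Q1.Phi_eqI[OF that(1) refl that(2)] by (simp add: A'_def T.A_def U.A_def S.A_def)
  have "complex_of_real (T.n2 * U.n2 * Q1.\<mu>) = of_real (k * S.n2)"
    using LL[of 0] by (simp add: Q1.psi_0 Q1.Psi_0 T.N2.laplace_0 U.N2.laplace_0 S.N2.laplace_0)
  hence kk: "T.n2 * U.n2 * Q1.\<mu> = k * S.n2" unfolding of_real_eq_iff .
  obtain q where "0 < q" "Q1.\<psi> (of_real s) = of_real q" by (rule Q1.psi_of_real_pos[OF s])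
  hence L: "laplace T.N2 (of_real s) * laplace U.N2 (of_real s) * Q1.\<Psi> (of_real s) = of_real k * laplace S.N2 (of_real s)"
    using LL[of "of_real s"] s by simp
  have "laplace T.V (of_real s) * laplace U.V (of_real s) * Q1.\<Psi> (of_real s) =
      (laplace T.N2 (of_real s) * laplace U.N2 (of_real s) * Q1.\<Psi> (of_real s)) / of_real (T.n2 * U.n2)"
    by (simp add: T.laplace_V U.laplace_V)
  also have "\<dots> = of_real (k / (T.n2 * U.n2)) * laplace S.N2 (of_real s)" unfolding L by simp
  also have "k / (T.n2 * U.n2) = Q1.\<mu> / S.n2"
    using kk T.n2_pos U.n2_pos S.n2_pos by (simp add: frac_eq_eq mult_ac)
  finally show ?thesis by (simp add: S.laplace_V)
qed

end

theorem theorem3p2: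
  fixes c1 c2 lam1 lam2 \<rho>1 \<rho>2 :: real
    and F1 F2 :: "real measure"
    and p p10 p02 p00 :: "(real \<times> real) measure"
  assumes "c1 > 0" and "c2 > 0" and "lam1 > 0" and "lam2 > 0"
    and "prob_space F1" and "sets F1 = sets borel" and "emeasure F1 {0<..} = 1"
    and "integrable F1 (\<lambda>x. x)"
    and "prob_space F2" and "sets F2 = sets borel" and "emeasure F2 {0<..} = 1"
    and "integrable F2 (\<lambda>x. x)"
    and "cp_mean c1 lam1 F1 > 0" and "cp_mean c2 lam2 F2 > 0"
    and "\<rho>1 \<ge> 0" and "\<rho>2 \<ge> 0" and "\<rho>1 * \<rho>2 < 1"
    and "stationary_dist \<rho>1 \<rho>2 c1 c2 lam1 lam2 F1 F2 p"
    and "stationary_dist \<rho>1 0 c1 c2 lam1 lam2 F1 F2 p10"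
    and "stationary_dist 0 \<rho>2 c1 c2 lam1 lam2 F1 F2 p02"
    and "stationary_dist 0 0 c1 c2 lam1 lam2 F1 F2 p00"
  shows "(V_law \<rho>1 \<rho>2 c1 c2 (cp_mean c1 lam1 F1) (cp_mean c2 lam2 F2) p
           \<star> V_law 0 0 c1 c2 (cp_mean c1 lam1 F1) (cp_mean c2 lam2 F2) p00)
         = (V_law \<rho>1 0 c1 c2 (cp_mean c1 lam1 F1) (cp_mean c2 lam2 F2) p10
           \<star> V_law 0 \<rho>2 c1 c2 (cp_mean c1 lam1 F1) (cp_mean c2 lam2 F2) p02)
         \<and> V_law 0 0 c1 c2 (cp_mean c1 lam1 F1) (cp_mean c2 lam2 F2) p00 = distr p00 borel fst"
proof -
  interpret C: coupled_queues c1 lam1 F1 c2 lam2 F2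
    by (intro coupled_queues.intro queue_input.intro assms)
  interpret S: stationary_model c1 lam1 F1 c2 lam2 F2 \<rho>1 \<rho>2 p
    by unfold_locales (use assms(15-21) in simp_all)
  interpret T: stationary_model c1 lam1 F1 c2 lam2 F2 \<rho>1 0 p10
    by unfold_locales (use assms(15-21) in simp_all)
  interpret U: stationary_model c1 lam1 F1 c2 lam2 F2 0 \<rho>2 p02
    by unfold_locales (use assms(15-21) in simp_all)
  interpret Z: stationary_model c1 lam1 F1 c2 lam2 F2 0 0 p00
    by unfold_locales (use assms(15-21) in simp_all)
  have Z00: "laplace Z.V (of_real s) * C.Q1.\<Psi> (of_real s) = of_real C.Q1.\<mu>" if s: "0 < s" for s
  proof -
    have "laplace Z.V (of_real s) * laplace Z.V (of_real s) * C.Q1.\<Psi> (of_real s)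
        = of_real C.Q1.\<mu> * laplace Z.V (of_real s)"
      by (rule C.laplace_product_identity) (use assms(21) s in simp_all)
    moreover obtain x where x: "0 < x" "laplace Z.N2 (of_real s) = of_real x"
      using Z.laplace_N2_real s less_imp_le by metis
    hence "laplace Z.V (of_real s) \<noteq> 0" using Z.n2_pos by (simp add: Z.laplace_V)
    ultimately show ?thesis by (simp add: mult.assoc)
  qed
  have "(S.V \<star> Z.V) = (T.V \<star> U.V)"
  proof (rule laplace_unique)
    fix s :: real assume s: "0 < s"
    have \<Psi>0: "C.Q1.\<Psi> (of_real s) \<noteq> 0" using s by (intro C.Q1.Psi_nonzero) simp
    have "laplace S.V (of_real s) * laplace Z.V (of_real s) * C.Q1.\<Psi> (of_real s)
        = of_real C.Q1.\<mu> * laplace S.V (of_real s)"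
      using Z00[OF s] by (simp add: mult.assoc mult.commute)
    also have "\<dots> = laplace T.V (of_real s) * laplace U.V (of_real s) * C.Q1.\<Psi> (of_real s)"
      by (rule C.laplace_product_identity[symmetric]) (use assms(15-21) s in simp_all)
    finally have "laplace S.V (of_real s) * laplace Z.V (of_real s) = laplace T.V (of_real s) * laplace U.V (of_real s)"
      using \<Psi>0 by simp
    thus "laplace (S.V \<star> Z.V) (of_real s) = laplace (T.V \<star> U.V) (of_real s)"
      using s by (simp add: laplace_convolution S.nonneg_V T.nonneg_V U.nonneg_V Z.nonneg_V)
  qed (intro nonneg_measure_convolution S.prob_V T.prob_V U.prob_V Z.prob_V S.nonneg_V T.nonneg_V
      U.nonneg_V Z.nonneg_V)+
  moreover have "Z.V = distr p00 borel fst"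
  proof (rule laplace_unique)
    fix s :: real assume s: "0 < s"
    have \<Psi>0: "C.Q1.\<Psi> (of_real s) \<noteq> 0" using s by (intro C.Q1.Psi_nonzero) simp
    have "C.Q1.\<Psi> (of_real s) * laplace (distr p00 borel fst) (of_real s) = of_real C.Q1.\<mu>"
      using Z.marginal_equation_1[of "of_real s"] Z.masses(1) s by simp
    also have "\<dots> = C.Q1.\<Psi> (of_real s) * laplace Z.V (of_real s)" using Z00[OF s] by (simp add: mult.commute)
    finally show "laplace Z.V (of_real s) = laplace (distr p00 borel fst) (of_real s)" using \<Psi>0 by simp
  qed (intro Z.prob_V Z.nonneg_V Z.nonneg_marginal)+
  ultimately show ?thesis by blast
qed

end
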